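(* Let $(M_1^{m_1},g_1)$ and $(M_2^{m_2},g_2)$ be Einstein structures such that $m_2(m_2-1)\,\mathrm{Sc}(g_1)=-m_1(m_1-1)\,\mathrm{Sc}(g_2)\ne0$, with $n=m_1+m_2$ even (and $n\geq 4$). Let $g$ be a metric on $M_1\times M_2$ conformally related to the product metric $g_1\times g_2$. Then the Fefferman–Graham obstruction tensor $\mathcal B^g$ vanishes everywhere.
   Context: Metrics are pseudo-Riemannian. An $m$-manifold $(M,g)$ is Einstein if $\mathrm{Ric}(g)=\frac1m\mathrm{Sc}(g)\,g$ with scalar curvature $\mathrm{Sc}(g)$ constant. Obstruction tensor: let $n\ge4$ be even and $(M^n,g)$ a pseudo-Riemannian manifold. For a smooth one-parameter family $\tilde g_\rho$ of metrics on $M$ with $\tilde g_0=g$, consider near $\rho=0$ the metric $\boldsymbol h=2t\,dt\,d\rho+2\rho\,dt^2+t^2(\tilde g_\rho)_{ij}dx^idx^j$ on $\mathbb R_+\times M\times(-\epsilon,\epsilon)$. One can choose the family so that the tangential components satisfy $\mathrm{Ric}(\boldsymbol h)_{ij}=O(\rho^{n/2-1})$. The symmetric trace-free 2-tensor $\mathcal B^g$ is, up to a nonzero constant depending only on $n$, the trace-free part (with respect to $g$) of $\big(\rho^{1-n/2}\,\mathrm{Ric}(\boldsymbol h)_{ij}\big)\big|_{\rho=0}$, which is independent of the choice of such a family. It is conformally covariant and for $n=4$ it is the Bach tensor. *)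

theory Defs
  imports "HOL-Analysis.Analysis" "HOL-Library.Landau_Symbols"
begin

section \<open>Smooth maps\<close>

text \<open>
  Only meant for open \<open>S\<close>.  All iterated directional derivatives are required; for a map on a
  product this is joint smoothness in all variables.
\<close>

primrec Ck_on :: "nat \<Rightarrow> 'v::real_normed_vector set \<Rightarrow> ('v \<Rightarrow> 'w::real_normed_vector) \<Rightarrow> bool" where
  "Ck_on 0 S f \<longleftrightarrow> continuous_on S f"
| "Ck_on (Suc k) S f \<longleftrightarrow>
     f differentiable_on S \<and> (\<forall>v. Ck_on k S (\<lambda>x. frechet_derivative f (at x) v))"

definition smooth_on :: "'v::real_normed_vector set \<Rightarrow> ('v \<Rightarrow> 'w::real_normed_vector) \<Rightarrow> bool" where
  "smooth_on S f \<longleftrightarrow> (\<forall>k. Ck_on k S f)"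


section \<open>Smooth manifolds and their products\<close>

text \<open>
  A manifold is a topological space with an indexed smooth atlas (not necessarily maximal).
  The coordinate maps are total functions, of which only the restriction to the chart domain
  matters.
\<close>

record ('a, 'i, 'm) manifold =
  mtop :: "'a topology"
  charts :: "'i set"
  chart_dom :: "'i \<Rightarrow> 'a set"
  coords :: "'i \<Rightarrow> 'a \<Rightarrow> (real, 'm::finite) vec"

definition chart_img :: "('a, 'i, 'm::finite) manifold \<Rightarrow> 'i \<Rightarrow> (real^'m) set" where
  "chart_img M i = coords M i ` chart_dom M i"

definition chart_inv :: "('a, 'i, 'm::finite) manifold \<Rightarrow> 'i \<Rightarrow> real^'m \<Rightarrow> 'a" where
  "chart_inv M i = inv_into (chart_dom M i) (coords M i)"

definition transition :: "('a, 'i, 'm::finite) manifold \<Rightarrow> 'i \<Rightarrow> 'i \<Rightarrow> real^'m \<Rightarrow> real^'m" where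
  "transition M i j = coords M j \<circ> chart_inv M i"

definition smooth_manifold :: "('a, 'i, 'm::finite) manifold \<Rightarrow> bool" where
  "smooth_manifold M \<longleftrightarrow>
     Hausdorff_space (mtop M) \<and> second_countable (mtop M) \<and>
     (\<Union>i\<in>charts M. chart_dom M i) = topspace (mtop M) \<and>
     (\<forall>i\<in>charts M. openin (mtop M) (chart_dom M i) \<and> open (chart_img M i) \<and>
        homeomorphic_map (subtopology (mtop M) (chart_dom M i))
          (top_of_set (chart_img M i)) (coords M i)) \<and>
     (\<forall>i\<in>charts M. \<forall>j\<in>charts M.
        smooth_on (coords M i ` (chart_dom M i \<inter> chart_dom M j)) (transition M i j))"

text \<open>\<open>real^('m1 + 'm2)\<close> plays the role of \<open>real^'m1 \<times> real^'m2\<close>.\<close>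

definition prod_manifold ::
  "('a, 'i, 'm1::finite) manifold \<Rightarrow> ('b, 'j, 'm2::finite) manifold \<Rightarrow>
   ('a \<times> 'b, 'i \<times> 'j, 'm1 + 'm2) manifold" where
  "prod_manifold M1 M2 =
     \<lparr> mtop = prod_topology (mtop M1) (mtop M2),
       charts = charts M1 \<times> charts M2,
       chart_dom = (\<lambda>(i, j). chart_dom M1 i \<times> chart_dom M2 j),
       coords = (\<lambda>(i, j) (p, q).
         \<chi> k. case k of Inl a \<Rightarrow> coords M1 i p $ a | Inr b \<Rightarrow> coords M2 j q $ b) \<rparr>"


section \<open>Pseudo-Riemannian metrics\<close>

text \<open>
  A covariant 2-tensor is given by its component matrices: \<open>T i x\<close> is the matrix of components
  in chart \<open>i\<close> at the point with coordinates \<open>x\<close>.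
\<close>

type_synonym ('i, 'm) tensor2 = "'i \<Rightarrow> real^'m \<Rightarrow> real^'m^'m"

definition tensor_law :: "('a, 'i, 'm::finite) manifold \<Rightarrow> ('i, 'm) tensor2 \<Rightarrow> bool" where
  "tensor_law M T \<longleftrightarrow>
     (\<forall>i\<in>charts M. \<forall>j\<in>charts M. \<forall>p \<in> chart_dom M i \<inter> chart_dom M j.
        let J = matrix (frechet_derivative (transition M i j) (at (coords M i p)))
        in T i (coords M i p) = transpose J ** T j (coords M j p) ** J)"

text \<open>The signature is not fixed; it is locally constant by nondegeneracy.\<close>

definition pseudo_riemannian_metric ::
  "('a, 'i, 'm::finite) manifold \<Rightarrow> ('i, 'm) tensor2 \<Rightarrow> bool" where
  "pseudo_riemannian_metric M g \<longleftrightarrow>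
     tensor_law M g \<and>
     (\<forall>i\<in>charts M. smooth_on (chart_img M i) (g i) \<and>
        (\<forall>x\<in>chart_img M i. transpose (g i x) = g i x \<and> invertible (g i x)))"

definition product_metric ::
  "('i, 'm1::finite) tensor2 \<Rightarrow> ('j, 'm2::finite) tensor2 \<Rightarrow> ('i \<times> 'j, 'm1 + 'm2) tensor2" where
  "product_metric g1 g2 = (\<lambda>(i, j) z. \<chi> k l.
     (case (k, l) of
        (Inl a, Inl b) \<Rightarrow> g1 i (\<chi> c. z $ Inl c) $ a $ b
      | (Inr a, Inr b) \<Rightarrow> g2 j (\<chi> c. z $ Inr c) $ a $ b
      | _ \<Rightarrow> 0))"

definition conformally_related ::
  "('a, 'i, 'm::finite) manifold \<Rightarrow> ('i, 'm) tensor2 \<Rightarrow> ('i, 'm) tensor2 \<Rightarrow> bool" where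
  "conformally_related M g g' \<longleftrightarrow>
     (\<exists>\<Omega> :: 'a \<Rightarrow> real.
        (\<forall>p\<in>topspace (mtop M). \<Omega> p > 0) \<and>
        (\<forall>i\<in>charts M. smooth_on (chart_img M i) (\<Omega> \<circ> chart_inv M i) \<and>
           (\<forall>p\<in>chart_dom M i. g i (coords M i p) = (\<Omega> p)\<^sup>2 *\<^sub>R g' i (coords M i p))))"


section \<open>Curvature\<close>

definition partial :: "'k::finite \<Rightarrow> (real^'k \<Rightarrow> real) \<Rightarrow> real^'k \<Rightarrow> real" where
  "partial i f x = frechet_derivative f (at x) (axis i 1)"

definition christoffel ::
  "(real^'k \<Rightarrow> real^'k^'k) \<Rightarrow> 'k \<Rightarrow> 'k \<Rightarrow> 'k \<Rightarrow> real^'k::finite \<Rightarrow> real" where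
  "christoffel G k i j x = (1/2) * (\<Sum>l\<in>UNIV. matrix_inv (G x) $ k $ l *
     (partial i (\<lambda>y. G y $ j $ l) x + partial j (\<lambda>y. G y $ i $ l) x
      - partial l (\<lambda>y. G y $ i $ j) x))"

text \<open>Sign convention: round spheres have positive Ricci curvature.\<close>

definition ricci :: "(real^'k \<Rightarrow> real^'k^'k) \<Rightarrow> real^'k::finite \<Rightarrow> real^'k^'k" where
  "ricci G x = (\<chi> i j. \<Sum>k\<in>UNIV.
     partial k (christoffel G k i j) x - partial j (christoffel G k i k) x
     + (\<Sum>l\<in>UNIV. christoffel G k k l x * christoffel G l i j x
                  - christoffel G k j l x * christoffel G l i k x))"

definition metric_trace :: "real^'k^'k \<Rightarrow> real^'k^'k::finite \<Rightarrow> real" where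
  "metric_trace G S = (\<Sum>i\<in>UNIV. \<Sum>j\<in>UNIV. matrix_inv G $ i $ j * S $ i $ j)"

definition trace_free_part :: "real^'k^'k \<Rightarrow> real^'k^'k \<Rightarrow> real^'k^'k::finite" where
  "trace_free_part G S = S - (metric_trace G S / CARD('k)) *\<^sub>R G"

definition scalar_curvature :: "(real^'k \<Rightarrow> real^'k^'k) \<Rightarrow> real^'k::finite \<Rightarrow> real" where
  "scalar_curvature G x = metric_trace (G x) (ricci G x)"

text \<open>The metric \<open>g\<close> is Einstein with constant scalar curvature \<open>s\<close>.\<close>

definition einstein :: "('a, 'i, 'm::finite) manifold \<Rightarrow> ('i, 'm) tensor2 \<Rightarrow> real \<Rightarrow> bool" where
  "einstein M g s \<longleftrightarrow>
     (\<forall>i\<in>charts M. \<forall>x\<in>chart_img M i.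
        scalar_curvature (g i) x = s \<and>
        ricci (g i) x = (scalar_curvature (g i) x / CARD('m)) *\<^sub>R g i x)"


section \<open>The Fefferman--Graham obstruction tensor\<close>

text \<open>Coordinate indices on the ambient space: \<open>t\<close>, the coordinates of \<open>M\<close>, and \<open>\<rho>\<close>.\<close>

datatype 'm ambient_index = IxT | IxM 'm | IxRho

instance ambient_index :: (finite) finite
proof
  have "UNIV = {IxT, IxRho} \<union> range (IxM :: 'a \<Rightarrow> 'a ambient_index)"
    by (auto intro: ambient_index.exhaust)
  then show "finite (UNIV :: 'a ambient_index set)"
    by (metis finite.emptyI finite.insertI finite_UnI finite_imageI finite)
qed

definition ambient_point :: "real \<Rightarrow> real^'m \<Rightarrow> real \<Rightarrow> real^('m::finite ambient_index)" where
  "ambient_point t x \<rho> = (\<chi> k. case k of IxT \<Rightarrow> t | IxM a \<Rightarrow> x $ a | IxRho \<Rightarrow> \<rho>)"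

text \<open>
  The matrix of \<open>2 t dt d\<rho> + 2 \<rho> dt\<^sup>2 + t\<^sup>2 (G \<rho>)\<^sub>i\<^sub>j dx\<^sup>i dx\<^sup>j\<close>, where \<open>G \<rho> x\<close> is the matrix of
  the metric at parameter \<open>\<rho>\<close> in one chart.  Products of one-forms are symmetric products, so
  the coefficient \<open>2 t\<close> contributes the two off-diagonal entries \<open>t\<close>.
\<close>

definition ambient_metric ::
  "(real \<Rightarrow> real^'m \<Rightarrow> real^'m^'m) \<Rightarrow>
   real^('m::finite ambient_index) \<Rightarrow> real^('m ambient_index)^('m ambient_index)" where
  "ambient_metric G z =
     (let t = z $ IxT; x = (\<chi> a. z $ IxM a); \<rho> = z $ IxRho in
      \<chi> k l. (case (k, l) of
         (IxT, IxT) \<Rightarrow> 2 * \<rho>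
       | (IxT, IxRho) \<Rightarrow> t
       | (IxRho, IxT) \<Rightarrow> t
       | (IxM a, IxM b) \<Rightarrow> t\<^sup>2 * G \<rho> x $ a $ b
       | _ \<Rightarrow> 0))"

definition tangential_ricci ::
  "(real \<Rightarrow> real^'m \<Rightarrow> real^'m^'m) \<Rightarrow> real \<Rightarrow> real^'m \<Rightarrow> real \<Rightarrow> real^'m::finite^'m" where
  "tangential_ricci G t x \<rho> =
     (\<chi> a b. ricci (ambient_metric G) (ambient_point t x \<rho>) $ IxM a $ IxM b)"

definition admissible_family ::
  "('a, 'i, 'm::finite) manifold \<Rightarrow> ('i, 'm) tensor2 \<Rightarrow> real \<Rightarrow> (real \<Rightarrow> ('i, 'm) tensor2) \<Rightarrow> bool" where
  "admissible_family M g \<epsilon> gt \<longleftrightarrow>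
     \<epsilon> > 0 \<and>
     (\<forall>\<rho>\<in>{-\<epsilon><..<\<epsilon>}. pseudo_riemannian_metric M (gt \<rho>)) \<and>
     (\<forall>i\<in>charts M.
        smooth_on ({-\<epsilon><..<\<epsilon>} \<times> chart_img M i) (\<lambda>(\<rho>, x). gt \<rho> i x) \<and>
        (\<forall>x\<in>chart_img M i. gt 0 i x = g i x \<and>
           (\<forall>t>0. \<forall>a b.
              (\<lambda>\<rho>. tangential_ricci (\<lambda>\<rho>'. gt \<rho>' i) t x \<rho> $ a $ b)
                \<in> O[at 0](\<lambda>\<rho>. \<rho> ^ (CARD('m) div 2 - 1)))))"

text \<open>
  \<open>B\<close> is the obstruction tensor of \<open>g\<close> with normalising constant \<open>c\<close>.  The value of
  \<open>\<rho>\<^sup>1\<^sup>-\<^sup>n\<^sup>/\<^sup>2 Ric\<^sub>i\<^sub>j\<close> at \<open>\<rho> = 0\<close> is its limit there; by homogeneity of the ambient metric it does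
  not depend on \<open>t\<close>.  Meaningful for even \<open>n = CARD('m) \<ge> 4\<close>.
\<close>

definition is_obstruction_tensor ::
  "('a, 'i, 'm::finite) manifold \<Rightarrow> real \<Rightarrow> ('i, 'm) tensor2 \<Rightarrow> ('i, 'm) tensor2 \<Rightarrow> bool" where
  "is_obstruction_tensor M c g B \<longleftrightarrow>
     (\<exists>\<epsilon> gt. admissible_family M g \<epsilon> gt \<and>
        (\<forall>i\<in>charts M. \<forall>x\<in>chart_img M i. \<exists>L.
           (\<forall>t>0. ((\<lambda>\<rho>. inverse (\<rho> ^ (CARD('m) div 2 - 1)) *\<^sub>R
                       tangential_ricci (\<lambda>\<rho>'. gt \<rho>' i) t x \<rho>) \<longlongrightarrow> L) (at 0)) \<and>
           B i x = c *\<^sub>R trace_free_part (g i x) L))"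

end

theory Submission
  imports Defs
begin

text \<open>
  Write \<open>\<kappa> = s\<^sub>1 / (2 m\<^sub>1 (m\<^sub>1 - 1))\<close>.  For the product metric the family
  \<open>(1 + \<kappa> \<rho>)\<^sup>2 g\<^sub>1 \<oplus> (1 - \<kappa> \<rho>)\<^sup>2 g\<^sub>2\<close> makes the ambient metric exactly Ricci flat (the ambient
  metric is a product of two cones).  For a conformal factor \<open>exp (2 w)\<close>, a change of
  coordinates \<open>(t, x, \<rho>) \<mapsto> (t exp f, \<xi>, \<rho> exp (- 2 f))\<close> with \<open>f = w\<close> and \<open>\<xi> = x\<close> at \<open>\<rho> = 0\<close> preserves
  the shape of the ambient metric except for \<open>dx d\<rho>\<close> and \<open>d\<rho>\<^sup>2\<close> terms, and the coefficients of
  \<open>\<rho>\<^sup>k\<close> in \<open>f\<close> and \<open>\<xi>\<close> can be chosen one after the other so that these terms vanish to any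
  prescribed order.  Since the Ricci tensor is natural, dropping them yields a normal form family
  with initial metric \<open>exp (2 w) g\<close> whose ambient Ricci tensor vanishes to high order.  On the other
  hand the tangential Ricci component is a singular second order operator in \<open>\<rho>\<close> which determines
  the Taylor coefficients of a family below order \<open>n / 2\<close>, and at order \<open>n / 2\<close> is insensitive to the
  trace-free part of the coefficient.  Hence any admissible family agrees with the constructed
  one below order \<open>n / 2\<close>, and the leading term of its Ricci tensor is a multiple of the metric.
\<close>

section \<open>Germs of smooth maps\<close>

text \<open>With \<open>r1 = t (1 + \<kappa> \<rho>)\<close> and
  \<open>r2 = t (1 - \<kappa> \<rho>)\<close> one has \<open>2 t dt d\<rho> + 2 \<rho> dt^2 = (dr1^2
  - dr2^2) / (2 \<kappa>)\<close>. So, up to the factor \<open>1 / (2 \<kappa>)\<close>, the ambient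
  metric of the product family is \<open>dr1^2 + r1^2 (2 \<kappa> g1)\<close> minus
  \<open>dr2^2 + r2^2 (- 2 \<kappa> g2)\<close>. A cone over \<open>h\<close> is Ricci flat when
  \<open>Ric h = (m - 1) h\<close>; this fixes \<kappa> by
  \<open>s1 / m1 = 2 (m1 - 1) \<kappa>\<close>, and the relation between the scalar curvatures is
  the same condition for \<open>g2\<close> with \<open>- \<kappa>\<close>. The hypothesis on
  \<open>B\<close> only supplies some admissible family, so an arbitrary one has to be handled.
  Conformal covariance is replaced by a comparison family built directly for the conformal metric.
  It only has to exist as a germ along \<rho> = 0 in one chart, since \<open>B\<close> is checked
  chart by chart and nothing is glued. Its jets must be controlled on the whole slice, not at one
  point: then tangential derivatives cost no order, and only \<rho>-derivatives enter the
  recursion.\<close>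

lemma has_derivative_cong_nhds:
  assumes "\<forall>\<^sub>F y in nhds x. f y = g y"
  shows "(f has_derivative f') (at x) \<longleftrightarrow> (g has_derivative f') (at x)"
proof -
  have "\<forall>\<^sub>F y in at x. f y = g y" "f x = g x"
    using assms eventually_nhds_x_imp_x by (auto simp: eventually_nhds_conv_at)
  then show ?thesis
    using has_derivative_transform_eventually[of f f' x UNIV g]
      has_derivative_transform_eventually[of g f' x UNIV f] by (auto simp: eq_commute)
qed

lemma frechet_derivative_cong_eventually:
  assumes "\<forall>\<^sub>F y in nhds x. f y = g y"
  shows "frechet_derivative f (at x) = frechet_derivative g (at x)"
  using has_derivative_cong_nhds[OF assms] by (simp add: frechet_derivative_def)

lemma differentiable_cong_eventually:
  assumes "\<forall>\<^sub>F y in nhds x. f y = g y"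
  shows "f differentiable (at x) \<longleftrightarrow> g differentiable (at x)"
  using has_derivative_cong_nhds[OF assms] by (simp add: differentiable_def)

lemma eventually_nhds_open:
  "open S \<Longrightarrow> x \<in> S \<Longrightarrow> (\<And>y. y \<in> S \<Longrightarrow> P y) \<Longrightarrow> \<forall>\<^sub>F y in nhds x. P y"
  using eventually_nhds by blast

lemma Ck_on_cong:
  assumes "open S" "\<And>x. x \<in> S \<Longrightarrow> f x = g x"
  shows "Ck_on k S f \<longleftrightarrow> Ck_on k S g"
  using assms(2)
proof (induction k arbitrary: f g)
  case 0
  then show ?case using continuous_on_cong[of S S f g] by simp
next
  case (Suc k)
  have ev: "\<forall>\<^sub>F y in nhds x. f y = g y" if "x \<in> S" for x
    by (rule eventually_nhds_open[OF assms(1) that]) (rule Suc.prems)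
  have d: "f differentiable_on S \<longleftrightarrow> g differentiable_on S"
    using differentiable_cong_eventually[OF ev] assms(1)
    by (auto simp: differentiable_on_def at_within_open_NO_MATCH)
  have "Ck_on k S (\<lambda>x. frechet_derivative f (at x) v) \<longleftrightarrow> Ck_on k S (\<lambda>x. frechet_derivative g (at x) v)" for v
    by (rule Suc.IH) (use frechet_derivative_cong_eventually[OF ev] in auto)
  with d show ?case by simp
qed

lemma Ck_on_subset: "Ck_on k S f \<Longrightarrow> T \<subseteq> S \<Longrightarrow> Ck_on k T f"
  by (induction k arbitrary: f) (auto intro: continuous_on_subset differentiable_on_subset)

lemma Ck_on_Suc_imp: "Ck_on (Suc k) S f \<Longrightarrow> Ck_on k S f"
  by (induction k arbitrary: f) (auto intro: differentiable_imp_continuous_on)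

lemma Ck_on_const: "Ck_on k S (\<lambda>x. c)"
  by (induction k arbitrary: c) (simp_all add: frechet_derivative_const)

lemma frechet_derivative_eq:
  "(f has_derivative f') (at x) \<Longrightarrow> frechet_derivative f (at x) = f'"
  by (metis frechet_derivative_at)

text \<open>By uniqueness of the derivative, an induction on \<open>k\<close> may continue with a
  hand-computed formula in place of \<open>frechet_derivative\<close>.\<close>

lemma Ck_on_SucI:
  assumes "open S" "\<And>x. x \<in> S \<Longrightarrow> (f has_derivative f' x) (at x)" "\<And>v. Ck_on k S (\<lambda>x. f' x v)"
  shows "Ck_on (Suc k) S f"
proof -
  have "f differentiable_on S"
    unfolding differentiable_on_def
    using assms(1) differentiableI[OF assms(2)] by (simp add: at_within_open_NO_MATCH)
  moreover have "Ck_on k S (\<lambda>x. frechet_derivative f (at x) v)" for v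
    using Ck_on_cong[OF assms(1), of "\<lambda>x. frechet_derivative f (at x) v" "\<lambda>x. f' x v" k] assms(3)[of v]
      frechet_derivative_eq[OF assms(2)] by auto
  ultimately show ?thesis by simp
qed

lemma Ck_on_has_derivative:
  assumes "open S" "Ck_on (Suc k) S f" "x \<in> S"
  shows "(f has_derivative frechet_derivative f (at x)) (at x)"
  using assms by (auto simp: differentiable_on_def at_within_open_NO_MATCH frechet_derivative_works)

lemma Ck_on_bounded_linear:
  assumes "open S" "bounded_linear h"
  shows "Ck_on k S f \<Longrightarrow> Ck_on k S (\<lambda>x. h (f x))"
proof (induction k arbitrary: f)
  case 0
  then show ?case using assms(2) by (auto intro: bounded_linear.continuous_on)
next
  case (Suc k)
  show ?case
    by (rule Ck_on_SucI[OF assms(1)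
          bounded_linear.has_derivative[OF assms(2) Ck_on_has_derivative[OF assms(1) Suc.prems]]])
      (use Suc in auto)
qed

lemma Ck_on_add:
  assumes "open S"
  shows "Ck_on k S f \<Longrightarrow> Ck_on k S g \<Longrightarrow> Ck_on k S (\<lambda>x. f x + g x)"
proof (induction k arbitrary: f g)
  case 0
  then show ?case by (auto intro: continuous_on_add)
next
  case (Suc k)
  show ?case
    by (rule Ck_on_SucI[OF assms has_derivative_add[OF Ck_on_has_derivative[OF assms Suc.prems(1)]
            Ck_on_has_derivative[OF assms Suc.prems(2)]]])
      (use Suc in auto)
qed

lemma Ck_on_bilinear:
  assumes "open S" "bounded_bilinear h"
  shows "Ck_on k S f \<Longrightarrow> Ck_on k S g \<Longrightarrow> Ck_on k S (\<lambda>x. h (f x) (g x))"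
proof (induction k arbitrary: f g)
  case 0
  then show ?case using bounded_bilinear.continuous_on[OF assms(2)] by auto
next
  case (Suc k)
  note f = Ck_on_Suc_imp[OF Suc.prems(1)] and g = Ck_on_Suc_imp[OF Suc.prems(2)]
  show ?case
    by (rule Ck_on_SucI[OF assms(1) bounded_bilinear.FDERIV[OF assms(2)
            Ck_on_has_derivative[OF assms(1) Suc.prems(1)] Ck_on_has_derivative[OF assms(1) Suc.prems(2)]]])
      (use Suc f g in \<open>auto intro!: Ck_on_add[OF assms(1)] Suc.IH\<close>)
qed

lemma Ck_on_sum:
  assumes "open S" "\<And>i. i \<in> I \<Longrightarrow> Ck_on k S (f i)"
  shows "Ck_on k S (\<lambda>x. \<Sum>i\<in>I. f i x)"
  using assms(2) by (induction I rule: infinite_finite_induct) (auto intro: Ck_on_const Ck_on_add[OF assms(1)])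

lemma linear_family_expand:
  fixes L :: "'a::euclidean_space \<Rightarrow> 'b::real_normed_vector"
  assumes "linear L" shows "L v = (\<Sum>b\<in>Basis. (v \<bullet> b) *\<^sub>R L b)"
proof -
  have "L (\<Sum>b\<in>Basis. (v \<bullet> b) *\<^sub>R b) = (\<Sum>b\<in>Basis. (v \<bullet> b) *\<^sub>R L b)"
    by (simp only: linear_sum[OF assms] linear_cmul[OF assms])
  then show ?thesis unfolding euclidean_representation .
qed

lemma Ck_on_compose:
  fixes g :: "'b::euclidean_space \<Rightarrow> 'c::real_normed_vector" and f :: "'a::real_normed_vector \<Rightarrow> 'b"
  assumes "open S" "open T" "\<And>x. x \<in> S \<Longrightarrow> f x \<in> T"
  shows "Ck_on k T g \<Longrightarrow> Ck_on k S f \<Longrightarrow> Ck_on k S (\<lambda>x. g (f x))"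
proof (induction k arbitrary: g)
  case 0
  then show ?case using assms(3) by (auto intro!: continuous_on_compose2[of T g S f])
next
  case (Suc k)
  note f = Ck_on_Suc_imp[OF Suc.prems(2)] 
  \<comment> \<open>\<open>Ck_on\<close> only speaks about fixed directions, while here the
    direction moves with \<open>x\<close>. Expanding it over the basis turns the chain rule into a
    finite sum of products to which the induction hypothesis applies.\<close>
  have eq: "frechet_derivative g (at (f x)) (frechet_derivative f (at x) v)
     = (\<Sum>b\<in>Basis. (frechet_derivative f (at x) v \<bullet> b) *\<^sub>R frechet_derivative g (at (f x)) b)"
    if "x \<in> S" for x v
    using linear_family_expand[OF has_derivative_linear[OF
        Ck_on_has_derivative[OF assms(2) Suc.prems(1) assms(3)[OF that]]]] .
  show ?case
  proof (rule Ck_on_SucI[OF assms(1),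
          where f' = "\<lambda>x v. frechet_derivative g (at (f x)) (frechet_derivative f (at x) v)"])
    show "((\<lambda>x. g (f x)) has_derivative (\<lambda>v. frechet_derivative g (at (f x)) (frechet_derivative f (at x) v))) (at x)"
      if "x \<in> S" for x
      by (rule has_derivative_compose[OF Ck_on_has_derivative[OF assms(1) Suc.prems(2) that]
          Ck_on_has_derivative[OF assms(2) Suc.prems(1) assms(3)[OF that]]])
    show "Ck_on k S (\<lambda>x. frechet_derivative g (at (f x)) (frechet_derivative f (at x) v))" for v
    proof -
      have "Ck_on k S (\<lambda>x. \<Sum>b\<in>Basis. (frechet_derivative f (at x) v \<bullet> b) *\<^sub>R frechet_derivative g (at (f x)) b)"
        using Suc f
        by (intro Ck_on_sum assms Ck_on_bilinear[OF assms(1) bounded_bilinear_scaleR]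
            Ck_on_bounded_linear[OF assms(1) bounded_linear_inner_left]) auto
      then show ?thesis
        by (subst Ck_on_cong[OF assms(1) eq]) simp_all
    qed
  qed
qed

lemma Ck_on_exp: "open S \<Longrightarrow> Ck_on k S (exp :: real \<Rightarrow> real)"
proof (induction k)
  case 0
  then show ?case by (auto intro: continuous_intros)
next
  case (Suc k)
  show ?case
    by (rule Ck_on_SucI[OF Suc.prems, where f' = "\<lambda>x v. exp x * v"])
      (use Suc in \<open>auto intro!: derivative_eq_intros Ck_on_bilinear[OF _ bounded_bilinear_mult] Ck_on_const\<close>)
qed

lemma Ck_on_inverse: "open S \<Longrightarrow> 0 \<notin> S \<Longrightarrow> Ck_on k S (inverse :: real \<Rightarrow> real)"
proof (induction k)
  case 0
  then show ?case by (auto intro: continuous_intros)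
next
  case (Suc k)
  show ?case
  proof (rule Ck_on_SucI[OF Suc.prems(1)])
    show "(inverse has_derivative (\<lambda>v. - (inverse x * v * inverse x))) (at x)" if "x \<in> S" for x :: real
      using that Suc.prems(2) by (intro has_derivative_inverse') auto
    show "Ck_on k S (\<lambda>x. - (inverse x * v * inverse x))" for v
      by (intro Ck_on_bounded_linear[OF Suc.prems(1) bounded_linear_minus[OF bounded_linear_ident]]
          Ck_on_bilinear[OF Suc.prems(1) bounded_bilinear_mult] Ck_on_const Suc)
  qed
qed

text \<open>A germ version of \<open>smooth_on\<close>: the closure rules become pointwise, and no
  open domain has to be carried through compositions and inverses.\<close>

definition smooth_near :: "('v::real_normed_vector \<Rightarrow> 'w::real_normed_vector) \<Rightarrow> 'v \<Rightarrow> bool" where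
  "smooth_near f x \<longleftrightarrow> (\<exists>W. open W \<and> x \<in> W \<and> smooth_on W f)"

text \<open>The direction comes first so that \<open>dd v f\<close> is again a function and
  derivatives iterate as \<open>dd u (dd v f)\<close>.\<close>

definition dd :: "'v::real_normed_vector \<Rightarrow> ('v \<Rightarrow> 'w::real_normed_vector) \<Rightarrow> 'v \<Rightarrow> 'w" where
  "dd v f x = frechet_derivative f (at x) v"

lemma dd_cong: "\<forall>\<^sub>F y in nhds x. f y = g y \<Longrightarrow> dd v f x = dd v g x"
  by (simp add: dd_def frechet_derivative_cong_eventually)

lemma dd_cong_eventually:
  "\<forall>\<^sub>F y in nhds x. f y = g y \<Longrightarrow> \<forall>\<^sub>F y in nhds x. dd v f y = dd v g y"
  using eventually_eventually[of "\<lambda>y. f y = g y" x] dd_cong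
  by (metis (mono_tags, lifting) eventually_mono)

lemma smooth_near_cong:
  assumes "\<forall>\<^sub>F y in nhds x. f y = g y" "smooth_near f x" shows "smooth_near g x"
proof -
  obtain S where S: "open S" "x \<in> S" "\<And>y. y \<in> S \<Longrightarrow> f y = g y"
    using assms(1) by (auto simp: eventually_nhds)
  obtain W where W: "open W" "x \<in> W" "smooth_on W f"
    using assms(2) by (auto simp: smooth_near_def)
  have "Ck_on k (W \<inter> S) g" for k
    using Ck_on_cong[of "W \<inter> S" f g k] S W Ck_on_subset[of k W f "W \<inter> S"]
    by (auto simp: smooth_on_def)
  then show ?thesis
    using S W by (auto simp: smooth_near_def smooth_on_def intro!: exI[of _ "W \<inter> S"])
qed

lemma smooth_on_imp_near: "open S \<Longrightarrow> smooth_on S f \<Longrightarrow> x \<in> S \<Longrightarrow> smooth_near f x"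
  by (auto simp: smooth_near_def)

lemma smooth_near_eventually:
  assumes "smooth_near f x" shows "\<forall>\<^sub>F y in nhds x. smooth_near f y"
  using assms by (auto simp: smooth_near_def eventually_nhds)

lemma smooth_near_dd: "smooth_near f x \<Longrightarrow> smooth_near (dd v f) x"
  unfolding smooth_near_def smooth_on_def dd_def[abs_def] by (metis Ck_on.simps(2))

lemma smooth_near_differentiable: 
  assumes "smooth_near f x" shows "f differentiable (at x)"
proof -
  obtain W where "open W" "x \<in> W" "Ck_on (Suc 0) W f"
    using assms unfolding smooth_near_def smooth_on_def by blast
  then show ?thesis
    using Ck_on_has_derivative differentiableI by blast
qed

lemma smooth_near_has_derivative: 
  "smooth_near f x \<Longrightarrow> (f has_derivative (\<lambda>v. dd v f x)) (at x)"
  using smooth_near_differentiable[of f x] unfolding dd_def frechet_derivative_works by simp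

lemma smooth_near_isCont: "smooth_near f x \<Longrightarrow> isCont f x"
  using smooth_near_differentiable differentiable_imp_continuous_within by blast

lemma dd_eqI: "(f has_derivative f') (at x) \<Longrightarrow> dd v f x = f' v"
  by (simp add: dd_def frechet_derivative_eq)

lemma linear_dd: "smooth_near f x \<Longrightarrow> linear (\<lambda>v. dd v f x)"
  using smooth_near_has_derivative has_derivative_linear by blast

lemma smooth_near_const [simp]: "smooth_near (\<lambda>x. c) x"
  by (auto simp: smooth_near_def smooth_on_def intro!: exI[of _ UNIV] Ck_on_const)

lemma dd_const [simp]: "dd v (\<lambda>x. c) x = 0"
  by (simp add: dd_def)

lemma smooth_near_combine:
  assumes "\<And>S k. open S \<Longrightarrow> Ck_on k S f \<Longrightarrow> Ck_on k S g \<Longrightarrow> Ck_on k S h"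
    and "smooth_near f x" "smooth_near g x"
  shows "smooth_near h x"
proof -
  obtain U V where "open U" "x \<in> U" "smooth_on U f" "open V" "x \<in> V" "smooth_on V g"
    using assms(2,3) by (auto simp: smooth_near_def)
  then show ?thesis
    using assms(1)[of "U \<inter> V"] Ck_on_subset[of _ U f "U \<inter> V"] Ck_on_subset[of _ V g "U \<inter> V"]
    unfolding smooth_near_def smooth_on_def by (intro exI[of _ "U \<inter> V"]) auto
qed

lemma smooth_near_bounded_linear:
  "bounded_linear h \<Longrightarrow> smooth_near f x \<Longrightarrow> smooth_near (\<lambda>x. h (f x)) x"
  using smooth_near_combine[of f f "\<lambda>x. h (f x)" x] Ck_on_bounded_linear by blast

lemma smooth_near_add [intro]: "smooth_near f x \<Longrightarrow> smooth_near g x \<Longrightarrow> smooth_near (\<lambda>x. f x + g x) x"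
  using smooth_near_combine[of f g "\<lambda>x. f x + g x" x] Ck_on_add by blast

lemma smooth_near_bilinear:
  "bounded_bilinear h \<Longrightarrow> smooth_near f x \<Longrightarrow> smooth_near g x \<Longrightarrow> smooth_near (\<lambda>x. h (f x) (g x)) x"
  using smooth_near_combine[of f g "\<lambda>x. h (f x) (g x)" x] Ck_on_bilinear by blast

lemmas smooth_near_mult [intro] =
  smooth_near_bilinear[OF bounded_bilinear_mult]
lemmas smooth_near_scaleR [intro] =
  smooth_near_bilinear[OF bounded_bilinear_scaleR]

lemma smooth_near_minus [intro]: "smooth_near f x \<Longrightarrow> smooth_near (\<lambda>x. - f x) x"
  by (rule smooth_near_bounded_linear[OF bounded_linear_minus[OF bounded_linear_ident]])

lemma smooth_near_diff [intro]: "smooth_near f x \<Longrightarrow> smooth_near g x \<Longrightarrow> smooth_near (\<lambda>x. f x - g x) x"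
  using smooth_near_add[of f x "\<lambda>x. - g x"] by auto

lemma smooth_near_sum [intro]:
  "(\<And>i. i \<in> I \<Longrightarrow> smooth_near (f i) x) \<Longrightarrow> smooth_near (\<lambda>x. \<Sum>i\<in>I. f i x) x"
  by (induction I rule: infinite_finite_induct) auto

lemma smooth_near_prod [intro]:
  fixes f :: "'i \<Rightarrow> 'v::real_normed_vector \<Rightarrow> real"
  shows "(\<And>i. i \<in> I \<Longrightarrow> smooth_near (f i) x) \<Longrightarrow> smooth_near (\<lambda>x. \<Prod>i\<in>I. f i x) x"
  by (induction I rule: infinite_finite_induct) auto

lemma smooth_near_power [intro]:
  fixes f :: "'v::real_normed_vector \<Rightarrow> real"
  shows "smooth_near f x \<Longrightarrow> smooth_near (\<lambda>x. f x ^ k) x"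
  by (induction k) auto

lemma smooth_near_compose:
  fixes g :: "'b::euclidean_space \<Rightarrow> 'c::real_normed_vector" and f :: "'a::real_normed_vector \<Rightarrow> 'b"
  assumes "smooth_near g (f x)" "smooth_near f x"
  shows "smooth_near (\<lambda>x. g (f x)) x"
proof -
  obtain T W where T: "open T" "f x \<in> T" "smooth_on T g" and W: "open W" "x \<in> W" "smooth_on W f"
    using assms by (auto simp: smooth_near_def)
  have "continuous_on W f"
    using W Ck_on.simps(1) unfolding smooth_on_def by blast
  then obtain S where S: "open S" "S \<inter> W = f -` T \<inter> W"
    using T(1) W(1) unfolding continuous_on_open_invariant by blast
  have "Ck_on k (S \<inter> W) (\<lambda>x. g (f x))" for k
  proof (rule Ck_on_compose[OF open_Int[OF S(1) W(1)] T(1)])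
    show "f y \<in> T" if "y \<in> S \<inter> W" for y using S(2) that by blast
    show "Ck_on k T g" using T by (simp add: smooth_on_def)
    show "Ck_on k (S \<inter> W) f" using W Ck_on_subset[of k W f "S \<inter> W"] by (simp add: smooth_on_def)
  qed
  moreover have "x \<in> S \<inter> W"
    using S T W by auto
  ultimately show ?thesis
    using open_Int[OF S(1) W(1)] unfolding smooth_near_def smooth_on_def by blast
qed

lemma smooth_near_ident [simp]: "smooth_near (\<lambda>x. x) x"
proof -
  have "Ck_on k UNIV (\<lambda>x. x :: 'a)" for k
    by (cases k) (auto intro: Ck_on_const simp: differentiable_on_def)
  then show ?thesis by (auto simp: smooth_near_def smooth_on_def)
qed

lemma smooth_near_linear: "bounded_linear h \<Longrightarrow> smooth_near h x"
  using smooth_near_bounded_linear[of h "\<lambda>x. x"] by simp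

lemma smooth_near_exp [intro]: 
  fixes f :: "'a::real_normed_vector \<Rightarrow> real"
  shows "smooth_near f x \<Longrightarrow> smooth_near (\<lambda>x. exp (f x)) x"
  by (rule smooth_near_compose)
    (auto simp: smooth_near_def smooth_on_def intro!: exI[of _ UNIV] Ck_on_exp)

lemma smooth_near_inverse [intro]:
  fixes f :: "'a::real_normed_vector \<Rightarrow> real"
  shows "f x \<noteq> 0 \<Longrightarrow> smooth_near f x \<Longrightarrow> smooth_near (\<lambda>x. inverse (f x)) x"
  by (rule smooth_near_compose)
    (auto simp: smooth_near_def smooth_on_def intro!: exI[of _ "- {0}"] Ck_on_inverse)

lemma smooth_near_divide [intro]:
  fixes f :: "'a::real_normed_vector \<Rightarrow> real"
  shows "g x \<noteq> 0 \<Longrightarrow> smooth_near f x \<Longrightarrow> smooth_near g x \<Longrightarrow> smooth_near (\<lambda>x. f x / g x) x"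
  using smooth_near_mult[OF _ smooth_near_inverse] by (simp add: divide_inverse)

lemma smooth_near_nth [intro]: "smooth_near f x \<Longrightarrow> smooth_near (\<lambda>x. f x $ i) x"
  by (rule smooth_near_bounded_linear[OF bounded_linear_vec_nth])

lemma bounded_linear_axis: "bounded_linear (axis i :: 'b::euclidean_space \<Rightarrow> 'b^'n)"
  unfolding linear_conv_bounded_linear[symmetric] by (rule linearI) (simp_all add: axis_def vec_eq_iff)

lemma smooth_near_vec [intro]:
  fixes f :: "'a::real_normed_vector \<Rightarrow> 'b::euclidean_space^'n"
  assumes "\<And>i. smooth_near (\<lambda>x. f x $ i) x"
  shows "smooth_near f x"
proof -
  have "smooth_near (\<lambda>x. \<Sum>i\<in>UNIV. axis i (f x $ i)) x"
    by (intro smooth_near_sum smooth_near_bounded_linear[of "axis _"] assms bounded_linear_axis)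
  moreover have "(\<Sum>i\<in>UNIV. axis i (f x $ i)) = f x" for x
    by (simp add: vec_eq_iff axis_def)
  ultimately show ?thesis by simp
qed

lemma smooth_near_vec_iff:
  fixes f :: "'a::real_normed_vector \<Rightarrow> 'b::euclidean_space^'n"
  shows "smooth_near f x \<longleftrightarrow> (\<forall>i. smooth_near (\<lambda>x. f x $ i) x)"
  by auto

lemma smooth_near_Pair [intro]:
  assumes "smooth_near f x" "smooth_near g x" shows "smooth_near (\<lambda>x. (f x, g x)) x"
proof -
  have "smooth_near (\<lambda>x. (f x, 0) + (0, g x)) x"
    by (intro smooth_near_add smooth_near_bounded_linear[of "\<lambda>u. (u, 0)"] smooth_near_bounded_linear[of "\<lambda>u. (0, u)"]
        assms bounded_linear_Pair bounded_linear_ident bounded_linear_zero)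
  then show ?thesis by simp
qed

lemma smooth_near_fst [intro]: "smooth_near f x \<Longrightarrow> smooth_near (\<lambda>x. fst (f x)) x"
  by (rule smooth_near_bounded_linear[OF bounded_linear_fst])

lemma smooth_near_snd [intro]: "smooth_near f x \<Longrightarrow> smooth_near (\<lambda>x. snd (f x)) x"
  by (rule smooth_near_bounded_linear[OF bounded_linear_snd])

lemma smooth_near_det [intro]:
  fixes A :: "'a::real_normed_vector \<Rightarrow> real^'n^'n"
  assumes "smooth_near A x" shows "smooth_near (\<lambda>x. det (A x)) x"
  unfolding det_def by (intro smooth_near_sum smooth_near_mult smooth_near_const smooth_near_prod
      smooth_near_nth assms)

lemma isCont_eventually_ne:
  fixes f :: "'a::t2_space \<Rightarrow> real"
  assumes "isCont f x" "f x \<noteq> c" shows "\<forall>\<^sub>F y in nhds x. f y \<noteq> c"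
  using tendsto_imp_eventually_ne[of f "f x" "at x" c] assms
  by (auto simp: isCont_def eventually_nhds_conv_at)

section \<open>Smooth dependence of the inverse matrix\<close>

lemma matrix_inv_inverse:
  fixes A :: "real^'n^'n"
  assumes "invertible A"
  shows "A ** matrix_inv A = mat 1" "matrix_inv A ** A = mat 1"
  using someI_ex[OF assms[unfolded invertible_def]] by (auto simp: matrix_inv_def)

text \<open>Cramer's rule presents each entry as a quotient of polynomials in the entries of
  \<open>A\<close>, from which smoothness of the inverse is read off.\<close>

lemma matrix_inv_entry_cramer:
  fixes A :: "real^'n^'n"
  assumes "det A \<noteq> 0"
  shows "matrix_inv A $ k $ l = det (\<chi> i j. if j = k then axis l 1 $ i else A $ i $ j) / det A"
proof -
  have "A ** matrix_inv A = mat 1"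
    using assms invertible_det_nz matrix_inv_inverse(1) by blast
  then have "A *v (matrix_inv A *v axis l 1) = axis l 1"
    by (simp add: matrix_vector_mul_assoc)
  then have "matrix_inv A *v axis l 1 = (\<chi> k. det (\<chi> i j. if j = k then axis l 1 $ i else A $ i $ j) / det A)"
    using cramer[OF assms] by blast
  moreover have "(matrix_inv A *v axis l 1) $ k = matrix_inv A $ k $ l"
    by (simp add: matrix_vector_mult_basis column_def)
  ultimately show ?thesis by simp
qed

lemma smooth_near_matrix_inv [intro]:
  fixes A :: "'a::real_normed_vector \<Rightarrow> real^'n^'n"
  assumes "smooth_near A x" "det (A x) \<noteq> 0" shows "smooth_near (\<lambda>x. matrix_inv (A x)) x"
proof (intro smooth_near_vec)
  fix k l
  let ?B = "\<lambda>x. \<chi> i j. if j = k then axis l 1 $ i else A x $ i $ j"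
  have "smooth_near ?B x"
  proof (intro smooth_near_vec)
    fix i j
    show "smooth_near (\<lambda>x. ?B x $ i $ j) x"
      using assms(1) by (cases "j = k") auto
  qed
  then have "smooth_near (\<lambda>x. det (?B x) / det (A x)) x"
    using assms by (intro smooth_near_divide smooth_near_det)
  moreover have "\<forall>\<^sub>F y in nhds x. det (?B y) / det (A y) = matrix_inv (A y) $ k $ l"
  proof -
    have "isCont (\<lambda>x. det (A x)) x"
      using assms(1) by (intro smooth_near_isCont smooth_near_det)
    then have "\<forall>\<^sub>F y in nhds x. det (A y) \<noteq> 0"
      using assms(2) by (rule isCont_eventually_ne)
    then show ?thesis
      by (rule eventually_mono) (simp add: matrix_inv_entry_cramer)
  qed
  ultimately show "smooth_near (\<lambda>x. matrix_inv (A x) $ k $ l) x"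
    by (rule smooth_near_cong[rotated])
qed

lemma dd_add: "smooth_near f x \<Longrightarrow> smooth_near g x \<Longrightarrow> dd v (\<lambda>x. f x + g x) x = dd v f x + dd v g x"
  by (rule dd_eqI[OF has_derivative_add]) (auto intro: smooth_near_has_derivative)

lemma dd_diff: "smooth_near f x \<Longrightarrow> smooth_near g x \<Longrightarrow> dd v (\<lambda>x. f x - g x) x = dd v f x - dd v g x"
  by (rule dd_eqI[OF has_derivative_diff]) (auto intro: smooth_near_has_derivative)

lemma dd_bilinear:
  "bounded_bilinear h \<Longrightarrow> smooth_near f x \<Longrightarrow> smooth_near g x \<Longrightarrow>
    dd v (\<lambda>x. h (f x) (g x)) x = h (f x) (dd v g x) + h (dd v f x) (g x)"
  by (rule dd_eqI[OF bounded_bilinear.FDERIV]) (auto intro: smooth_near_has_derivative)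

lemmas dd_mult = dd_bilinear[OF bounded_bilinear_mult]
lemmas dd_scaleR = dd_bilinear[OF bounded_bilinear_scaleR]

lemma dd_sum:
  "(\<And>i. i \<in> I \<Longrightarrow> smooth_near (f i) x) \<Longrightarrow> dd v (\<lambda>x. \<Sum>i\<in>I. f i x) x = (\<Sum>i\<in>I. dd v (f i) x)"
  by (rule dd_eqI[OF has_derivative_sum]) (auto intro: smooth_near_has_derivative)

lemma dd_bounded_linear:
  "bounded_linear h \<Longrightarrow> smooth_near f x \<Longrightarrow> dd v (\<lambda>x. h (f x)) x = h (dd v f x)"
  by (rule dd_eqI[OF bounded_linear.has_derivative]) (auto intro: smooth_near_has_derivative)

lemma dd_linear: "bounded_linear h \<Longrightarrow> dd v h x = h v"
  by (rule dd_eqI) (rule bounded_linear_imp_has_derivative)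

lemmas dd_nth = dd_bounded_linear[OF bounded_linear_vec_nth]

lemma dd_compose:
  assumes "smooth_near g (f x)" "smooth_near f x"
  shows "dd v (\<lambda>x. g (f x)) x = dd (dd v f x) g (f x)"
  by (rule dd_eqI[OF has_derivative_compose[OF smooth_near_has_derivative[OF assms(2)]
      smooth_near_has_derivative[OF assms(1)]]])

lemma dd_exp:
  fixes f :: "'a::real_normed_vector \<Rightarrow> real"
  assumes "smooth_near f x"
  shows "dd v (\<lambda>x. exp (f x)) x = exp (f x) * dd v f x"
  using smooth_near_has_derivative[OF assms]
  by (intro dd_eqI[where f' = "\<lambda>v. exp (f x) * dd v f x"]) (auto intro!: derivative_eq_intros)

section \<open>Symmetry of second derivatives\<close>

lemma DERIV_line:
  fixes f :: "'a::real_normed_vector \<Rightarrow> real"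
  assumes "smooth_near f (a + s *\<^sub>R u)"
  shows "((\<lambda>s. f (a + s *\<^sub>R u)) has_real_derivative dd u f (a + s *\<^sub>R u)) (at s)"
proof -
  have "((\<lambda>s. a + s *\<^sub>R u) has_derivative (\<lambda>h. h *\<^sub>R u)) (at s)"
    by (auto intro!: derivative_eq_intros)
  from has_derivative_compose[OF this smooth_near_has_derivative[OF assms]]
  show ?thesis
    using linear_cmul[OF linear_dd[OF assms]]
    by (simp add: has_field_derivative_def mult.commute[of _ "dd _ _ _"] mult_commute_abs)
qed

text \<open>The mean value theorem is applied twice: in direction \<open>u\<close> to the difference
  of \<open>f\<close> at points shifted by \<open>h v\<close>, then in direction \<open>v\<close> to
  \<open>dd u f\<close>.\<close>

lemma second_difference:
  fixes f :: "'a::real_normed_vector \<Rightarrow> real"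
  assumes h: "h > 0" and sm: "\<And>s t. 0 \<le> s \<Longrightarrow> s \<le> h \<Longrightarrow> 0 \<le> t \<Longrightarrow> t \<le> h \<Longrightarrow> smooth_near f (x + s *\<^sub>R u + t *\<^sub>R v)"
  shows "\<exists>s t. 0 < s \<and> s < h \<and> 0 < t \<and> t < h \<and>
    f (x + h *\<^sub>R u + h *\<^sub>R v) - f (x + h *\<^sub>R u) - f (x + h *\<^sub>R v) + f x
      = h * h * dd v (dd u f) (x + s *\<^sub>R u + t *\<^sub>R v)"
proof -
  have "\<exists>s>0. s < h \<and> (f (x + h *\<^sub>R v + h *\<^sub>R u) - f (x + h *\<^sub>R u)) - (f (x + h *\<^sub>R v + 0 *\<^sub>R u) - f (x + 0 *\<^sub>R u))
     = (h - 0) * (dd u f (x + h *\<^sub>R v + s *\<^sub>R u) - dd u f (x + s *\<^sub>R u))"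
    using sm[of _ h] sm[of _ 0] h
    by (intro MVT2[OF h] DERIV_diff DERIV_line) (auto simp: algebra_simps)
  then obtain s where s: "s > 0" "s < h"
    "f (x + h *\<^sub>R u + h *\<^sub>R v) - f (x + h *\<^sub>R u) - f (x + h *\<^sub>R v) + f x
     = h * (dd u f (x + s *\<^sub>R u + h *\<^sub>R v) - dd u f (x + s *\<^sub>R u + 0 *\<^sub>R v))"
    by (auto simp: algebra_simps)
  have "\<exists>t>0. t < h \<and> dd u f (x + s *\<^sub>R u + h *\<^sub>R v) - dd u f (x + s *\<^sub>R u + 0 *\<^sub>R v)
     = (h - 0) * dd v (dd u f) (x + s *\<^sub>R u + t *\<^sub>R v)"
    using sm[of s] s by (intro MVT2[OF h] DERIV_line smooth_near_dd) auto
  with s show ?thesis by auto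
qed

text \<open>Schwarz's theorem: the second difference over a parallelogram is symmetric in
  \<open>u\<close> and \<open>v\<close>, so the two mixed derivatives share a value at two points
  near \<open>x\<close>, and continuity forbids a gap at \<open>x\<close>.\<close>

lemma dd_swap_real:
  fixes f :: "'a::real_normed_vector \<Rightarrow> real"
  assumes "smooth_near f x"
  shows "dd u (dd v f) x = dd v (dd u f) x"
proof (rule ccontr)
  \<comment> \<open>Half of the supposed gap: values within distance \<open>e\<close> of its two
    ends cannot coincide.\<close>
  define e where "e = \<bar>dd u (dd v f) x - dd v (dd u f) x\<bar> / 2"
  assume "dd u (dd v f) x \<noteq> dd v (dd u f) x"
  then have e: "e > 0" by (simp add: e_def)
  have "isCont (dd u (dd v f)) x" "isCont (dd v (dd u f)) x"
    using assms by (auto intro!: smooth_near_isCont smooth_near_dd)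
  then have "\<forall>\<^sub>F y in nhds x. dist (dd u (dd v f) y) (dd u (dd v f) x) < e"
    "\<forall>\<^sub>F y in nhds x. dist (dd v (dd u f) y) (dd v (dd u f) x) < e"
    using e tendstoD[of "dd u (dd v f)" "dd u (dd v f) x" "at x" e] tendstoD[of "dd v (dd u f)" "dd v (dd u f) x" "at x" e]
    by (auto simp: isCont_def eventually_nhds_conv_at)
  then have "\<forall>\<^sub>F y in nhds x. smooth_near f y \<and> dist (dd u (dd v f) y) (dd u (dd v f) x) < e
      \<and> dist (dd v (dd u f) y) (dd v (dd u f) x) < e"
    using smooth_near_eventually[OF assms] by (intro eventually_conj)
  then obtain d where d: "d > 0" "\<And>y. dist y x < d \<Longrightarrow> smooth_near f y \<and> dist (dd u (dd v f) y) (dd u (dd v f) x) < e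
      \<and> dist (dd v (dd u f) y) (dd v (dd u f) x) < e"
    by (auto simp: eventually_nhds_metric)
  \<comment> \<open>Keeps the whole parallelogram within distance \<open>d\<close> of
    \<open>x\<close>; the summand 1 avoids a zero denominator.\<close>
  define h where "h = d / (2 * (norm u + norm v + 1))"
  have h: "h > 0" using d by (auto simp: h_def intro!: divide_pos_pos add_nonneg_pos)
  have near: "dist (x + s *\<^sub>R u + t *\<^sub>R v) x < d" if "0 \<le> s" "s \<le> h" "0 \<le> t" "t \<le> h" for s t
  proof -
    have "dist (x + s *\<^sub>R u + t *\<^sub>R v) x \<le> s * norm u + t * norm v"
      using that norm_triangle_ineq[of "s *\<^sub>R u" "t *\<^sub>R v"] by (simp add: dist_norm)
    also have "\<dots> \<le> h * norm u + h * norm v"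
      using that by (intro add_mono mult_right_mono) auto
    also have "\<dots> < h * (2 * (norm u + norm v + 1))"
    proof -
      have "a + b < 2 * (a + b + 1)" if "0 \<le> a" "0 \<le> b" for a b :: real
        using that by argo
      from this[OF norm_ge_zero norm_ge_zero] have "norm u + norm v < 2 * (norm u + norm v + 1)" .
      from mult_strict_left_mono[OF this h] show ?thesis by (simp add: algebra_simps)
    qed
    also have "\<dots> = d"
    proof -
      have "2 * (norm u + norm v + 1) \<noteq> 0"
        using add_nonneg_pos[of "norm u + norm v" 1] by simp
      then show ?thesis by (simp add: h_def)
    qed
    finally show ?thesis .
  qed
  obtain s t where 1: "0 < s" "s < h" "0 < t" "t < h" 
    "f (x + h *\<^sub>R u + h *\<^sub>R v) - f (x + h *\<^sub>R u) - f (x + h *\<^sub>R v) + f x = h * h * dd v (dd u f) (x + s *\<^sub>R u + t *\<^sub>R v)"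
    using second_difference[OF h, of f x u v] near d by metis
  have near': "dist (x + t *\<^sub>R v + s *\<^sub>R u) x < d" if "0 \<le> s" "s \<le> h" "0 \<le> t" "t \<le> h" for s t
    using near[OF that] by (simp add: algebra_simps)
  obtain s' t' where 2: "0 < s'" "s' < h" "0 < t'" "t' < h" 
    "f (x + h *\<^sub>R v + h *\<^sub>R u) - f (x + h *\<^sub>R v) - f (x + h *\<^sub>R u) + f x = h * h * dd u (dd v f) (x + t' *\<^sub>R v + s' *\<^sub>R u)"
    using second_difference[OF h, of f x v u] near' d by metis
  have "h * h * dd v (dd u f) (x + s *\<^sub>R u + t *\<^sub>R v) = h * h * dd u (dd v f) (x + t' *\<^sub>R v + s' *\<^sub>R u)"
    using 1(5) 2(5) by (simp add: algebra_simps)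
  then have "dd v (dd u f) (x + s *\<^sub>R u + t *\<^sub>R v) = dd u (dd v f) (x + t' *\<^sub>R v + s' *\<^sub>R u)"
    using h by simp
  moreover have "dist (dd v (dd u f) (x + s *\<^sub>R u + t *\<^sub>R v)) (dd v (dd u f) x) < e"
    using d(2)[OF near] 1 by simp
  moreover have "dist (dd u (dd v f) (x + t' *\<^sub>R v + s' *\<^sub>R u)) (dd u (dd v f) x) < e"
    using d(2)[OF near'] 2 by simp
  ultimately show False
    unfolding e_def dist_real_def by (simp add: abs_if split: if_splits)
qed

lemma dd_swap:
  fixes f :: "'a::real_normed_vector \<Rightarrow> 'b::euclidean_space"
  assumes "smooth_near f x"
  shows "dd u (dd v f) x = dd v (dd u f) x"
proof (rule euclidean_eqI)
  fix b :: 'b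
  note bl = bounded_linear_inner_left[of b]
  have ev: "\<forall>\<^sub>F y in nhds x. dd w f y \<bullet> b = dd w (\<lambda>y. f y \<bullet> b) y" for w
    using smooth_near_eventually[OF assms] by (rule eventually_mono) (simp add: dd_bounded_linear[OF bl])
  have "dd u (dd v f) x \<bullet> b = dd u (dd v (\<lambda>y. f y \<bullet> b)) x" for u v
    using dd_bounded_linear[OF bl smooth_near_dd[OF assms], of u v] dd_cong[OF ev[of v], of u] by simp
  moreover have "smooth_near (\<lambda>y. f y \<bullet> b) x"
    by (rule smooth_near_bounded_linear[OF bl assms])
  ultimately show "dd u (dd v f) x \<bullet> b = dd v (dd u f) x \<bullet> b"
    using dd_swap_real[of "\<lambda>y. f y \<bullet> b" x u v] by simp
qed

lemma partial_dd: "partial i f x = dd (axis i 1) f x"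
  by (simp add: partial_def dd_def)

section \<open>Vanishing jets\<close>

text \<open>All derivatives of \<open>f\<close> of order less than \<open>m\<close>, in all directions, vanish at \<open>x\<close>.  Along the hypersurface
  \<open>\<rho> = 0\<close> this replaces divisibility by \<open>\<rho>\<^sup>m\<close>, so that no Hadamard lemma is needed.\<close>

primrec flat :: "nat \<Rightarrow> ('v::real_normed_vector \<Rightarrow> real) \<Rightarrow> 'v \<Rightarrow> bool" where
  "flat 0 f x \<longleftrightarrow> True"
| "flat (Suc m) f x \<longleftrightarrow> f x = 0 \<and> (\<forall>v. flat m (dd v f) x)"

lemma flat_SucD: "flat (Suc m) f x \<Longrightarrow> f x = 0" "flat (Suc m) f x \<Longrightarrow> flat m (dd v f) x"
  by auto

lemma flat_cong: "\<forall>\<^sub>F y in nhds x. f y = g y \<Longrightarrow> flat m f x \<longleftrightarrow> flat m g x"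
proof (induction m arbitrary: f g)
  case (Suc m)
  then show ?case
    using Suc.IH[OF dd_cong_eventually[OF Suc.prems]] eventually_nhds_x_imp_x[OF Suc.prems] by auto
qed simp

lemma flat_transfer: "flat m f x \<Longrightarrow> \<forall>\<^sub>F y in nhds x. f y = g y \<Longrightarrow> flat m g x"
  using flat_cong by blast

lemma flat_Suc_imp: "flat (Suc m) f x \<Longrightarrow> flat m f x"
  by (induction m arbitrary: f) auto

lemma flat_mono: "flat m f x \<Longrightarrow> k \<le> m \<Longrightarrow> flat k f x"
proof (induction m)
  case (Suc m)
  then show ?case using flat_Suc_imp[of m f x] by (cases "k = Suc m") auto
qed simp

lemma flat_zero [simp]: "flat m (\<lambda>x. 0) x"
proof (induction m)
  case (Suc m)
  moreover have "dd v (\<lambda>x::'a. 0 :: real) = (\<lambda>x. 0)" for v :: 'a by (simp add: fun_eq_iff)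
  ultimately show ?case by simp
qed simp

lemma flat_add:
  "flat m f x \<Longrightarrow> flat m g x \<Longrightarrow> smooth_near f x \<Longrightarrow> smooth_near g x \<Longrightarrow> flat m (\<lambda>y. f y + g y) x"
proof (induction m arbitrary: f g)
  case (Suc m)
  have "\<forall>\<^sub>F y in nhds x. dd v f y + dd v g y = dd v (\<lambda>y. f y + g y) y" for v
    using smooth_near_eventually[OF Suc.prems(3)] smooth_near_eventually[OF Suc.prems(4)]
    by eventually_elim (simp add: dd_add)
  moreover have "flat m (\<lambda>y. dd v f y + dd v g y) x" for v
    using Suc by (simp add: smooth_near_dd)
  ultimately have "flat m (dd v (\<lambda>y. f y + g y)) x" for v
    using flat_transfer by blast
  then show ?case
    using Suc.prems(1,2) by simp
qed simp

text \<open>Leibniz rule, by induction on the total order. Differentiating one factor lowers its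
  order by one; if that order is already zero, the other factor alone carries the total
  order.\<close>

lemma flat_mult:
  assumes "flat m f x" "flat l g x" "smooth_near f x" "smooth_near g x"
  shows "flat (m + l) (\<lambda>y. f y * g y) x"
  using assms
proof (induction "m + l" arbitrary: m l f g)
  case 0
  then show ?case by simp
next
  case (Suc n)
  have n: "m + l = Suc n" using Suc(2) by simp
  have "f x * g x = 0"
    using n Suc.prems(1,2) by (cases m; cases l) auto
  moreover have "flat n (dd v (\<lambda>y. f y * g y)) x" for v
  proof -
    have ev: "\<forall>\<^sub>F y in nhds x. f y * dd v g y + dd v f y * g y = dd v (\<lambda>y. f y * g y) y"
      using smooth_near_eventually[OF Suc.prems(3)] smooth_near_eventually[OF Suc.prems(4)]
      by eventually_elim (simp add: dd_mult)
    have 1: "flat n (\<lambda>y. f y * dd v g y) x"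
    proof (cases l)
      case 0
      then show ?thesis
        using Suc.hyps(1)[of n 0 f "dd v g"] flat_mono[OF Suc.prems(1), of n] n Suc.prems by (simp add: smooth_near_dd)
    next
      case (Suc l')
      then show ?thesis
        using Suc.hyps(1)[of m l' f "dd v g"] n Suc.prems by (simp add: smooth_near_dd)
    qed
    have 2: "flat n (\<lambda>y. dd v f y * g y) x"
    proof (cases m)
      case 0
      then show ?thesis
        using Suc.hyps(1)[of 0 n "dd v f" g] flat_mono[OF Suc.prems(2), of n] n Suc.prems by (simp add: smooth_near_dd)
    next
      case (Suc m')
      then show ?thesis
        using Suc.hyps(1)[of m' l "dd v f" g] n Suc.prems by (simp add: smooth_near_dd)
    qed
    have "flat n (\<lambda>y. f y * dd v g y + dd v f y * g y) x"
      using 1 2 Suc.prems by (intro flat_add smooth_near_mult smooth_near_dd)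
    then show ?thesis using flat_cong[OF ev] by blast
  qed
  ultimately show ?case by (simp add: n)
qed

lemma flat_mult_left:
  "flat m f x \<Longrightarrow> smooth_near f x \<Longrightarrow> smooth_near g x \<Longrightarrow> flat m (\<lambda>y. g y * f y) x"
  using flat_mult[of 0 g x m f] by simp

lemma flat_mult_right:
  "flat m f x \<Longrightarrow> smooth_near f x \<Longrightarrow> smooth_near g x \<Longrightarrow> flat m (\<lambda>y. f y * g y) x"
  using flat_mult[of m f x 0 g] by simp

lemma flat_minus: "flat m f x \<Longrightarrow> smooth_near f x \<Longrightarrow> flat m (\<lambda>y. - f y) x"
  using flat_mult_left[of m f x "\<lambda>y. - 1"] by simp

lemma flat_diff:
  "flat m f x \<Longrightarrow> flat m g x \<Longrightarrow> smooth_near f x \<Longrightarrow> smooth_near g x \<Longrightarrow> flat m (\<lambda>y. f y - g y) x"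
  using flat_add[of m f x "\<lambda>y. - g y"] flat_minus[of m g x] by auto

lemma flat_sum:
  "(\<And>i. i \<in> I \<Longrightarrow> flat m (f i) x) \<Longrightarrow> (\<And>i. i \<in> I \<Longrightarrow> smooth_near (f i) x) \<Longrightarrow>
    flat m (\<lambda>y. \<Sum>i\<in>I. f i y) x"
  by (induction I rule: infinite_finite_induct) (auto intro!: flat_add)

lemma flat_power:
  assumes "flat 1 f x" "smooth_near f x" shows "flat m (\<lambda>y. f y ^ m) x"
proof (induction m)
  case (Suc m)
  from flat_mult[OF assms(1) Suc] assms(2) show ?case by auto
qed simp

text \<open>Chain rule with the outer derivative taken in fixed basis directions, so that the order
  of vanishing can be tracked summand by summand.\<close>

lemma dd_compose_sum:
  fixes g :: "'b::euclidean_space \<Rightarrow> real"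
  assumes "smooth_near g (f x)" "smooth_near f x"
  shows "\<forall>\<^sub>F y in nhds x. (\<Sum>b\<in>Basis. (dd v f y \<bullet> b) * dd b g (f y)) = dd v (\<lambda>y. g (f y)) y"
proof -
  have "\<forall>\<^sub>F y in nhds x. smooth_near g (f y)"
  proof -
    have "\<forall>\<^sub>F z in nhds (f x). smooth_near g z"
      by (rule smooth_near_eventually) fact
    moreover have "filterlim f (nhds (f x)) (nhds x)"
      using smooth_near_isCont[OF assms(2)] by (simp add: isCont_def tendsto_nhds_iff)
    ultimately show ?thesis by (rule eventually_compose_filterlim)
  qed
  with smooth_near_eventually[OF assms(2)] show ?thesis
  proof eventually_elim
    fix y assume s: "smooth_near f y" "smooth_near g (f y)"
    show "(\<Sum>b\<in>Basis. (dd v f y \<bullet> b) * dd b g (f y)) = dd v (\<lambda>y. g (f y)) y"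
      using linear_family_expand[OF linear_dd[OF s(2)], of "dd v f y"] dd_compose[OF s(2,1)] by simp
  qed
qed

lemma flat_compose:
  fixes F :: "'b::euclidean_space \<Rightarrow> real"
  assumes "smooth_near \<phi> x"
  shows "flat m F (\<phi> x) \<Longrightarrow> smooth_near F (\<phi> x) \<Longrightarrow> flat m (\<lambda>y. F (\<phi> y)) x"
proof (induction m arbitrary: F)
  case (Suc m)
  have "flat m (\<lambda>y. \<Sum>b\<in>Basis. (dd v \<phi> y \<bullet> b) * dd b F (\<phi> y)) x" for v
  proof (rule flat_sum)
    fix b :: 'b
    have 1: "flat m (\<lambda>y. dd b F (\<phi> y)) x" "smooth_near (dd b F) (\<phi> x)"
      using Suc by (auto simp: smooth_near_dd)
    note 2 = smooth_near_compose[OF 1(2) assms]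
    have 3: "smooth_near (\<lambda>y. dd v \<phi> y \<bullet> b) x"
      using assms by (intro smooth_near_bounded_linear[OF bounded_linear_inner_left] smooth_near_dd)
    show "flat m (\<lambda>y. (dd v \<phi> y \<bullet> b) * dd b F (\<phi> y)) x"
      "smooth_near (\<lambda>y. (dd v \<phi> y \<bullet> b) * dd b F (\<phi> y)) x"
      using flat_mult_left[OF 1(1) 2 3] 2 3 by auto
  qed
  with flat_cong[OF dd_compose_sum[OF Suc.prems(2) assms]] Suc.prems(1) show ?case by simp
qed simp

text \<open>Differentiating and telescoping gives \<open>d(\<phi> - \<psi>) dF(\<phi>) + d\<psi>
  (dF(\<phi>) - dF(\<psi>))\<close>: the first term has the required order by assumption, the second
  by induction for the partial derivatives of \<open>F\<close>.\<close>

lemma flat_compose_diff: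
  fixes F :: "'b::euclidean_space \<Rightarrow> real"
  assumes "smooth_near \<phi> x" "smooth_near \<psi> x"
  shows "(\<forall>b\<in>Basis. flat m (\<lambda>y. (\<phi> y - \<psi> y) \<bullet> b) x) \<Longrightarrow> smooth_near F (\<phi> x) \<Longrightarrow>
    flat m (\<lambda>y. F (\<phi> y) - F (\<psi> y)) x"
proof (induction m arbitrary: F)
  case (Suc m)
  note bl = bounded_linear_inner_left
  have "\<forall>b\<in>Basis. (\<phi> x - \<psi> x) \<bullet> b = 0" using Suc.prems(1) by auto
  then have "\<phi> x - \<psi> x = 0" using euclidean_eqI[of "\<phi> x - \<psi> x" 0] by simp
  then have eq: "\<psi> x = \<phi> x" by simp
  have sm: "smooth_near F (\<psi> x)" using Suc.prems eq by simp
  have fl': "flat m (\<lambda>y. (\<phi> y - \<psi> y) \<bullet> b) x" if "b \<in> Basis" for b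
    using flat_Suc_imp Suc.prems(1) that by blast
  have "flat m (dd v (\<lambda>y. F (\<phi> y) - F (\<psi> y))) x" for v
  proof -
    have *: "flat m (\<lambda>y. \<Sum>b\<in>Basis. (dd v (\<lambda>y. (\<phi> y - \<psi> y) \<bullet> b) y) * dd b F (\<phi> y)
        + (dd v \<psi> y \<bullet> b) * (dd b F (\<phi> y) - dd b F (\<psi> y))) x"
    proof (intro flat_sum flat_add)
      fix b :: 'b assume b: "b \<in> Basis"
      have s: "smooth_near (\<lambda>y. dd b F (\<phi> y)) x" "smooth_near (\<lambda>y. dd b F (\<psi> y)) x"
        using Suc.prems sm assms by (auto intro!: smooth_near_compose[OF smooth_near_dd])
      have s2: "smooth_near (dd v (\<lambda>y. (\<phi> y - \<psi> y) \<bullet> b)) x" "smooth_near (\<lambda>y. dd v \<psi> y \<bullet> b) x"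
        using assms by (auto intro!: smooth_near_dd smooth_near_bounded_linear[OF bl])
      show "flat m (\<lambda>y. dd v (\<lambda>y. (\<phi> y - \<psi> y) \<bullet> b) y * dd b F (\<phi> y)) x"
        by (rule flat_mult_right[OF _ s2(1) s(1)]) (use Suc.prems(1) b in auto)
      show "flat m (\<lambda>y. (dd v \<psi> y \<bullet> b) * (dd b F (\<phi> y) - dd b F (\<psi> y))) x"
        by (rule flat_mult_left[OF Suc.IH[OF _ smooth_near_dd[OF Suc.prems(2)]]])
          (use fl' s s2 in \<open>auto intro: smooth_near_diff\<close>)
      show "smooth_near (\<lambda>y. dd v (\<lambda>y. (\<phi> y - \<psi> y) \<bullet> b) y * dd b F (\<phi> y)) x"
        "smooth_near (\<lambda>y. (dd v \<psi> y \<bullet> b) * (dd b F (\<phi> y) - dd b F (\<psi> y))) x"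
        using s s2 by auto
      then show "smooth_near (\<lambda>y. dd v (\<lambda>y. (\<phi> y - \<psi> y) \<bullet> b) y * dd b F (\<phi> y)
        + (dd v \<psi> y \<bullet> b) * (dd b F (\<phi> y) - dd b F (\<psi> y))) x" by auto
    qed
    have "smooth_near (\<lambda>y. F (\<phi> y)) x" "smooth_near (\<lambda>y. F (\<psi> y)) x"
      using smooth_near_compose[OF Suc.prems(2) assms(1)] smooth_near_compose[OF sm assms(2)] by auto
    note ev = smooth_near_eventually[OF this(1)] smooth_near_eventually[OF this(2)]
    have "\<forall>\<^sub>F y in nhds x. (\<Sum>b\<in>Basis. (dd v (\<lambda>y. (\<phi> y - \<psi> y) \<bullet> b) y) * dd b F (\<phi> y)
        + (dd v \<psi> y \<bullet> b) * (dd b F (\<phi> y) - dd b F (\<psi> y))) = dd v (\<lambda>y. F (\<phi> y) - F (\<psi> y)) y"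
      using smooth_near_eventually[OF assms(1)] smooth_near_eventually[OF assms(2)]
        dd_compose_sum[OF Suc.prems(2) assms(1), of v] dd_compose_sum[OF sm assms(2), of v] ev
    proof (eventually_elim, goal_cases)
      case (1 y)
        have *: "dd v (\<lambda>y. (\<phi> y - \<psi> y) \<bullet> b) y = dd v \<phi> y \<bullet> b - dd v \<psi> y \<bullet> b" for b
          using 1 dd_bounded_linear[OF bl smooth_near_diff[OF 1(1,2)], of v b] by (simp only: dd_diff inner_diff_left)
        show ?case
          unfolding dd_diff[OF 1(5,6)] 1(3,4)[symmetric] sum_subtractf[symmetric] *
          by (intro sum.cong refl) (simp add: algebra_simps)
    qed
    from flat_cong[OF this] * show ?thesis by blast
  qed
  then show ?case by (simp add: eq)
qed simp

text \<open>Repeated mean value theorem along the line \<open>a + \<rho> e\<close>. Together with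
  the next lemma this is the only passage from jets back to limits in \<rho>.\<close>

lemma flat_line_bound:
  assumes "smooth_near f a" "flat m f a"
  shows "\<exists>C d. d > 0 \<and> (\<forall>\<rho>. \<bar>\<rho>\<bar> < d \<longrightarrow> \<bar>f (a + \<rho> *\<^sub>R e)\<bar> \<le> C * \<bar>\<rho>\<bar> ^ m)"
  using assms
proof (induction m arbitrary: f)
  case 0
  have "isCont (\<lambda>\<rho>. f (a + \<rho> *\<^sub>R e)) 0"
    using DERIV_line[of f a 0 e] 0 by (auto intro: DERIV_isCont)
  then have "((\<lambda>\<rho>. f (a + \<rho> *\<^sub>R e)) \<longlongrightarrow> f a) (nhds 0)"
    by (simp add: isCont_def tendsto_nhds_iff)
  from tendstoD[OF this, of 1]
  obtain d where "d > 0" "\<And>\<rho>. \<bar>\<rho>\<bar> < d \<Longrightarrow> dist (f (a + \<rho> *\<^sub>R e)) (f a) < 1"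
    by (auto simp: eventually_nhds_metric)
  then show ?case
    by (intro exI[of _ "\<bar>f a\<bar> + 1"] exI[of _ d]) (fastforce simp: dist_real_def)
next
  case (Suc m)
  have "smooth_near (dd e f) a" "flat m (dd e f) a" using Suc.prems by (auto intro: smooth_near_dd)
  from Suc.IH[OF this] obtain C d where d: "d > 0"
    "\<And>\<rho>. \<bar>\<rho>\<bar> < d \<Longrightarrow> \<bar>dd e f (a + \<rho> *\<^sub>R e)\<bar> \<le> C * \<bar>\<rho>\<bar> ^ m" by blast
  have "filterlim (\<lambda>\<rho>::real. a + \<rho> *\<^sub>R e) (nhds a) (nhds 0)"
    by (auto intro!: tendsto_eq_intros simp: filterlim_ident)
  from eventually_compose_filterlim[OF smooth_near_eventually[OF Suc.prems(1)] this]
  obtain d' where d': "d' > 0" "\<And>\<rho>. \<bar>\<rho>\<bar> < d' \<Longrightarrow> smooth_near f (a + \<rho> *\<^sub>R e)"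
    by (auto simp: eventually_nhds_metric)
  have "\<bar>f (a + \<rho> *\<^sub>R e)\<bar> \<le> \<bar>C\<bar> * \<bar>\<rho>\<bar> ^ Suc m" if \<rho>: "\<bar>\<rho>\<bar> < min d d'" for \<rho>
  proof -
    have der: "((\<lambda>s. f (a + s *\<^sub>R e)) has_real_derivative dd e f (a + s *\<^sub>R e)) (at s)" if "\<bar>s\<bar> \<le> \<bar>\<rho>\<bar>" for s
      using \<rho> that by (intro DERIV_line d') auto
    have "\<exists>s. \<bar>s\<bar> \<le> \<bar>\<rho>\<bar> \<and> f (a + \<rho> *\<^sub>R e) - f a = \<rho> * dd e f (a + s *\<^sub>R e)"
    proof (cases "\<rho>" "0 :: real" rule: linorder_cases)
      case less
      then obtain z where "\<rho> < z" "z < 0" "f (a + 0 *\<^sub>R e) - f (a + \<rho> *\<^sub>R e) = (0 - \<rho>) * dd e f (a + z *\<^sub>R e)"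
        using MVT2[OF less, of "\<lambda>s. f (a + s *\<^sub>R e)" "\<lambda>s. dd e f (a + s *\<^sub>R e)"] der by auto
      then show ?thesis by (intro exI[of _ z]) auto
    next
      case greater
      then obtain z where "0 < z" "z < \<rho>" "f (a + \<rho> *\<^sub>R e) - f (a + 0 *\<^sub>R e) = (\<rho> - 0) * dd e f (a + z *\<^sub>R e)"
        using MVT2[OF greater, of "\<lambda>s. f (a + s *\<^sub>R e)" "\<lambda>s. dd e f (a + s *\<^sub>R e)"] der by auto
      then show ?thesis by (intro exI[of _ z]) auto
    qed auto
    then obtain s where s: "\<bar>s\<bar> \<le> \<bar>\<rho>\<bar>" "f (a + \<rho> *\<^sub>R e) - f a = \<rho> * dd e f (a + s *\<^sub>R e)" by blast
    have "\<bar>dd e f (a + s *\<^sub>R e)\<bar> \<le> C * \<bar>s\<bar> ^ m" using d(2) s \<rho> by auto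
    also have "\<dots> \<le> \<bar>C\<bar> * \<bar>\<rho>\<bar> ^ m" using s by (intro mult_mono power_mono) auto
    finally have "\<bar>\<rho>\<bar> * \<bar>dd e f (a + s *\<^sub>R e)\<bar> \<le> \<bar>\<rho>\<bar> * (\<bar>C\<bar> * \<bar>\<rho>\<bar> ^ m)"
      by (rule mult_left_mono) simp
    then show ?thesis using s Suc.prems by (simp add: abs_mult mult_ac)
  qed
  then show ?case using d(1) d'(1) by (intro exI[of _ "\<bar>C\<bar>"] exI[of _ "min d d'"]) (simp del: power_Suc)
qed

lemma flat_lineD:
  assumes "smooth_near f a" "flat (Suc m) f a"
  shows "((\<lambda>\<rho>. f (a + \<rho> *\<^sub>R e) / \<rho> ^ m) \<longlongrightarrow> 0) (at 0)"
proof -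
  obtain C d where *: "d > 0" "\<And>\<rho>. \<bar>\<rho>\<bar> < d \<Longrightarrow> \<bar>f (a + \<rho> *\<^sub>R e)\<bar> \<le> C * \<bar>\<rho>\<bar> ^ Suc m"
    using flat_line_bound[OF assms] by blast
  have "\<forall>\<^sub>F \<rho> in at 0. norm (f (a + \<rho> *\<^sub>R e) / \<rho> ^ m) \<le> norm \<rho> * C"
  proof -
    have "norm (f (a + \<rho> *\<^sub>R e) / \<rho> ^ m) \<le> norm \<rho> * C" if "\<rho> \<noteq> 0" "\<bar>\<rho>\<bar> < d" for \<rho>
      using *(2)[OF that(2)] that by (simp add: power_abs divide_simps mult_ac)
    then show ?thesis using *(1) by (auto simp: eventually_at intro!: exI[of _ d])
  qed
  then show ?thesis
    by (rule Lim_null_comparison) (auto intro!: tendsto_eq_intros)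
qed

lemma smooth_near_comp_snd:
  "smooth_near \<gamma> (snd y) \<Longrightarrow> smooth_near (\<lambda>y. \<gamma> (snd y :: 'e::euclidean_space)) y"
  by (rule smooth_near_compose[OF _ smooth_near_snd[OF smooth_near_ident]])

lemmas smooth_intros = smooth_near_const smooth_near_add smooth_near_diff smooth_near_mult
  smooth_near_sum smooth_near_power smooth_near_exp smooth_near_dd

lemma smooth_near_rho_power: "smooth_near (\<lambda>y. fst y ^ m :: real) (y :: real \<times> 'e::euclidean_space)"
  by (intro smooth_near_power smooth_near_fst smooth_near_ident)

lemma flat_rho_power: "flat m (\<lambda>y. fst y ^ m :: real) (0 :: real, x :: 'e::euclidean_space)"
  by (rule flat_power) (auto intro: smooth_near_fst)

lemma dd_fst: "dd v fst (y :: 'a::real_normed_vector \<times> 'b::real_normed_vector) = fst v"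
  by (rule dd_linear) (rule bounded_linear_fst)

lemma dd_snd: "dd v snd (y :: 'a::real_normed_vector \<times> 'b::real_normed_vector) = snd v"
  by (rule dd_linear) (rule bounded_linear_snd)

lemma dd_rho_power_times:
  fixes v y :: "real \<times> 'e::euclidean_space"
  assumes "smooth_near \<gamma> (snd y)"
  shows "dd v (\<lambda>y. fst y ^ Suc m * \<gamma> (snd y)) y
    = real (Suc m) * fst v * fst y ^ m * \<gamma> (snd y) + fst y ^ Suc m * dd (snd v) \<gamma> (snd y)"
proof -
  have "((\<lambda>y. fst y ^ Suc m) has_derivative (\<lambda>v. real (Suc m) * fst v * fst y ^ m)) (at y)"
    using has_derivative_power[OF bounded_linear_imp_has_derivative[OF bounded_linear_fst], where n = "Suc m" and x = y]
    by (simp add: algebra_simps)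
  then have "dd v (\<lambda>y. fst y ^ Suc m) y = real (Suc m) * fst v * fst y ^ m" by (rule dd_eqI)
  moreover have "dd v (\<lambda>y. \<gamma> (snd y)) y = dd (snd v) \<gamma> (snd y)"
    using dd_compose[of \<gamma> snd y v] assms by (simp add: dd_snd smooth_near_linear bounded_linear_snd)
  moreover have "smooth_near (\<lambda>y. \<gamma> (snd y)) y"
    using assms by (rule smooth_near_comp_snd)
  ultimately show ?thesis
    using dd_mult[OF smooth_near_rho_power, of "\<lambda>y. \<gamma> (snd y)" y v "Suc m"] by simp
qed

lemma eventually_snd_mem: 
  assumes "open X" "x \<in> X" shows "\<forall>\<^sub>F y in nhds (a, x). snd y \<in> X"
  by (rule eventually_nhds_open[of "UNIV \<times> X"]) (use assms in \<open>auto simp: open_Times\<close>)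

section \<open>Jets along the hypersurface \<rho> = 0\<close>

context
  fixes X :: "'e::euclidean_space set"
  assumes X: "open X"
begin

text \<open>Vanishing along the whole open slice \<open>X\<close>, not just at a point, lets
  tangential derivatives keep the full order \<open>m\<close>. The induction passes through
  \<open>dd v f\<close>, using that \<open>dd v\<close> and \<open>dd (0, u)\<close>
  commute.\<close>

lemma flat_tangential:
  assumes "\<And>x. x \<in> X \<Longrightarrow> smooth_near f (0::real, x)" "\<And>x. x \<in> X \<Longrightarrow> flat m f (0, x)" "x \<in> X"
  shows "flat m (dd (0, u) f) (0, x)"
  using assms
proof (induction m arbitrary: f x)
  case (Suc m)
  have "dd (0, u) f (0, x) = 0"
  proof -
    have "dd (0, u) f (0, x) = dd u (\<lambda>x. f (0, x)) x"
      using dd_compose[of f "\<lambda>x. (0, x)" x u] dd_linear[of "\<lambda>x. (0::real, x::'e)" u x] Suc.prems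
      by (simp add: smooth_near_Pair bounded_linear_Pair bounded_linear_zero bounded_linear_ident)
    also have "\<dots> = dd u (\<lambda>x. 0) x"
      using Suc.prems(2) by (intro dd_cong eventually_nhds_open[OF X Suc.prems(3)]) auto
    finally show ?thesis by simp
  qed
  moreover have "flat m (dd v (dd (0, u) f)) (0, x)" for v
  proof -
    have "flat m (dd (0, u) (dd v f)) (0, x)"
      by (rule Suc.IH) (use Suc.prems in \<open>auto simp only: intro: smooth_near_dd flat_SucD\<close>)
    moreover have "\<forall>\<^sub>F y in nhds (0, x). dd (0, u) (dd v f) y = dd v (dd (0, u) f) y"
      using smooth_near_eventually[OF Suc.prems(1)[OF Suc.prems(3)]] by eventually_elim (rule dd_swap)
    ultimately show ?thesis using flat_cong by blast
  qed
  ultimately show ?case by simp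
qed simp

text \<open>The gain of one order has to be checked in the normal direction only: every direction
  combines \<open>(1, 0)\<close> with a tangential one, and the latter costs nothing by
  \<open>flat_tangential\<close>.\<close>

lemma flat_Suc_normal:
  assumes sm: "\<And>x. x \<in> X \<Longrightarrow> smooth_near f (0::real, x)" and fl: "\<And>x. x \<in> X \<Longrightarrow> flat m f (0, x)"
    and z: "\<And>x. x \<in> X \<Longrightarrow> f (0, x) = 0" and n: "\<And>x. x \<in> X \<Longrightarrow> flat m (dd (1, 0) f) (0, x)" 
    and x: "x \<in> X"
  shows "flat (Suc m) f (0, x)"
proof -
  have "flat m (dd (r, u) f) (0, x)" for r u
  proof -
    have "flat m (\<lambda>y. r * dd (1, 0) f y + dd (0, u) f y) (0, x)"
      using x by (intro flat_add flat_mult_left n flat_tangential[OF sm fl] smooth_near_mult smooth_near_dd sm) auto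
    moreover have "\<forall>\<^sub>F y in nhds (0, x). r * dd (1, 0) f y + dd (0, u) f y = dd (r, u) f y"
      using smooth_near_eventually[OF sm[OF x]]
    proof eventually_elim
      case (elim y)
      from linear_add[OF linear_dd[OF elim], of "r *\<^sub>R (1, 0)" "(0, u)"] linear_cmul[OF linear_dd[OF elim], of r "(1, 0)"]
      show ?case by simp
    qed
    ultimately show ?thesis by (rule flat_transfer)
  qed
  then show ?thesis using z x by auto
qed

text \<open>The coefficient is the m-th \<rho>-derivative at \<rho> = 0 divided by
  \<open>m!\<close>, found recursively from the coefficient of \<open>dd (1, 0) f\<close>. It is
  smooth in \<open>x\<close>, so later constructions may differentiate it.\<close>

lemma flat_leading_coeff:
  assumes "\<And>x. x \<in> X \<Longrightarrow> smooth_near f (0::real, x)" "\<And>x. x \<in> X \<Longrightarrow> flat m f (0, x)"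
  shows "\<exists>\<gamma>. (\<forall>x\<in>X. smooth_near \<gamma> x) \<and> (\<forall>x\<in>X. flat (Suc m) (\<lambda>y. f y - fst y ^ m * \<gamma> (snd y)) (0, x))"
  using assms
proof (induction m arbitrary: f)
  case 0
  have "smooth_near (\<lambda>x. f (0, x)) x" if "x \<in> X" for x
    by (rule smooth_near_compose[of f]) (use 0(1)[OF that] in \<open>auto intro: smooth_near_Pair\<close>)
  then show ?case by (intro exI[of _ "\<lambda>x. f (0, x)"]) auto
next
  case (Suc m)
  obtain \<gamma> where \<gamma>: "\<And>x. x \<in> X \<Longrightarrow> smooth_near \<gamma> x"
    "\<And>x. x \<in> X \<Longrightarrow> flat (Suc m) (\<lambda>y. dd (1, 0) f y - fst y ^ m * \<gamma> (snd y)) (0, x)"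
    using Suc.IH[of "dd (1, 0) f", OF smooth_near_dd[OF Suc.prems(1)] flat_SucD(2)[OF Suc.prems(2)]] by blast
  \<comment> \<open>The antiderivative of \<open>\<rho>^m \<gamma>\<close> in \<rho> is
    \<open>\<rho>^(m+1) \<gamma> / (m+1)\<close>.\<close>
  let ?\<gamma> = "\<lambda>x. \<gamma> x / real (Suc m)"
  let ?h = "\<lambda>y. f y - fst y ^ Suc m * ?\<gamma> (snd y)"
  have sg: "smooth_near ?\<gamma> x" if "x \<in> X" for x using \<gamma>(1)[OF that] by (intro smooth_near_divide) auto
  have sg': "smooth_near (\<lambda>y. ?\<gamma> (snd y)) (0, x)" if "x \<in> X" for x
    by (rule smooth_near_comp_snd) (use sg[OF that] in simp)
  have "flat (Suc (Suc m)) ?h (0, x)" if "x \<in> X" for x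
  proof (rule flat_Suc_normal[OF _ _ _ _ that])
    fix x assume x: "x \<in> X"
    show "smooth_near ?h (0, x)"
      using Suc.prems x by (intro smooth_near_diff smooth_near_mult smooth_near_rho_power sg') auto
    have "flat (Suc m) (\<lambda>y. fst y ^ Suc m * ?\<gamma> (snd y)) (0, x)"
      by (rule flat_mult_right) (intro flat_rho_power smooth_near_rho_power sg' x)+
    then show "flat (Suc m) ?h (0, x)"
      by (rule flat_diff[OF Suc.prems(2)[OF x]])
        (intro Suc.prems smooth_near_mult smooth_near_rho_power sg' x)+
    show "?h (0, x) = 0" using Suc.prems(2)[OF x] by simp
    have "\<forall>\<^sub>F y in nhds (0, x). snd y \<in> X"
      by (rule eventually_snd_mem[OF X x])
    with smooth_near_eventually[OF Suc.prems(1)[OF x]]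
    have "\<forall>\<^sub>F y in nhds (0, x). dd (1, 0) f y - fst y ^ m * \<gamma> (snd y) = dd (1, 0) ?h y"
    proof eventually_elim
      case (elim y)
      have "smooth_near (\<lambda>y. fst y ^ Suc m * ?\<gamma> (snd y)) y"
        using sg[OF elim(2)]
        by (rule smooth_near_mult[OF smooth_near_rho_power smooth_near_comp_snd])
      from dd_diff[OF elim(1) this, of "(1, 0)"] show ?case
        using linear_0[OF linear_dd[OF sg[OF elim(2)]]]
        unfolding dd_rho_power_times[of ?\<gamma>, OF sg[OF elim(2)]] by simp
    qed
    from flat_cong[OF this] \<gamma>(2)[OF x] show "flat (Suc m) (dd (1, 0) ?h) (0, x)" by blast
  qed
  with sg show ?case by blast
qed

end

section \<open>Naturality of the Ricci tensor\<close>

lemma smooth_near_linear_family: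
  fixes L :: "'z::real_normed_vector \<Rightarrow> 'a::euclidean_space \<Rightarrow> 'b::real_normed_vector"
  assumes lin: "\<forall>\<^sub>F z in nhds z0. linear (L z)" and sm: "\<And>b. smooth_near (\<lambda>z. L z b) z0"
    and c: "smooth_near c z0"
  shows "smooth_near (\<lambda>z. L z (c z)) z0"
proof (rule smooth_near_cong)
  show "\<forall>\<^sub>F z in nhds z0. (\<Sum>b\<in>Basis. (c z \<bullet> b) *\<^sub>R L z b) = L z (c z)"
    using lin by eventually_elim (simp flip: linear_family_expand)
  show "smooth_near (\<lambda>z. \<Sum>b\<in>Basis. (c z \<bullet> b) *\<^sub>R L z b) z0"
    by (intro smooth_near_sum smooth_near_scaleR sm smooth_near_bounded_linear[OF bounded_linear_inner_left] c)
qed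

text \<open>Product rule for a varying linear map applied to a varying vector, needed where both the
  base point of \<open>chr\<close> and its arguments move.\<close>

lemma dd_linear_family:
  fixes L :: "'z::real_normed_vector \<Rightarrow> 'a::euclidean_space \<Rightarrow> 'b::real_normed_vector"
  assumes lin: "\<forall>\<^sub>F z in nhds z0. linear (L z)" and sm: "\<And>b. smooth_near (\<lambda>z. L z b) z0"
    and c: "smooth_near c z0"
  shows "dd w (\<lambda>z. L z (c z)) z0 = dd w (\<lambda>z. L z (c z0)) z0 + L z0 (dd w c z0)"
proof -
  note sc = smooth_near_bounded_linear[OF bounded_linear_inner_left c]
  have "dd w (\<lambda>z. L z (d z)) z0 = dd w (\<lambda>z. \<Sum>b\<in>Basis. (d z \<bullet> b) *\<^sub>R L z b) z0" for d
    using lin by (intro dd_cong, eventually_elim) (rule linear_family_expand)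
  from this[of c] this[of "\<lambda>_. c z0"]
  have e: "dd w (\<lambda>z. L z (c z)) z0 = dd w (\<lambda>z. \<Sum>b\<in>Basis. (c z \<bullet> b) *\<^sub>R L z b) z0"
    "dd w (\<lambda>z. L z (c z0)) z0 = dd w (\<lambda>z. \<Sum>b\<in>Basis. (c z0 \<bullet> b) *\<^sub>R L z b) z0" .
  have 1: "dd w (\<lambda>z. L z (c z)) z0
      = (\<Sum>b\<in>Basis. (c z0 \<bullet> b) *\<^sub>R dd w (\<lambda>z. L z b) z0 + (dd w c z0 \<bullet> b) *\<^sub>R L z0 b)"
    unfolding e
    by (simp add: dd_sum dd_scaleR dd_bounded_linear[OF bounded_linear_inner_left c] smooth_near_scaleR sm sc)
  have 2: "dd w (\<lambda>z. L z (c z0)) z0 = (\<Sum>b\<in>Basis. (c z0 \<bullet> b) *\<^sub>R dd w (\<lambda>z. L z b) z0)"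
    unfolding e by (simp add: dd_sum dd_scaleR smooth_near_scaleR sm)
  have "linear (L z0)" using lin by (rule eventually_nhds_x_imp_x)
  from linear_family_expand[OF this, of "dd w c z0"] show ?thesis
    unfolding 1 2 by (simp add: sum.distrib)
qed

lemma bounded_bilinear_matrix_vector_mult:
  "bounded_bilinear ((*v) :: real^'n^'m \<Rightarrow> real^'n \<Rightarrow> real^'m)"
  unfolding bilinear_conv_bounded_bilinear[symmetric] bilinear_def
  by (auto intro!: linearI simp: matrix_vector_mult_def vec_eq_iff algebra_simps sum.distrib sum_distrib_left)

section \<open>Levi-Civita connection and curvature without indices\<close>

definition gform :: "real^'k^'k \<Rightarrow> real^'k \<Rightarrow> real^'k \<Rightarrow> real" where
  "gform A u v = u \<bullet> (A *v v)"

lemma gform_axis: "gform A (axis i 1) (axis j 1) = A $ i $ j"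
  by (simp add: gform_def matrix_vector_mult_basis column_def inner_axis')

lemma gform_sum: "gform A u v = (\<Sum>i\<in>UNIV. \<Sum>j\<in>UNIV. A $ i $ j * u $ i * v $ j)"
  by (simp add: gform_def inner_vec_def matrix_vector_mult_def sum_distrib_left mult_ac)

lemma gform_sym: "transpose A = A \<Longrightarrow> gform A u v = gform A v u"
  by (metis dot_lmul_matrix gform_def inner_commute transpose_matrix_vector)

lemma gform_add1: "gform A (u + u') v = gform A u v + gform A u' v"
  by (simp add: gform_def inner_left_distrib)

lemma gform_add2: "gform A u (v + v') = gform A u v + gform A u v'"
  by (simp add: gform_def matrix_vector_right_distrib inner_right_distrib)

lemma gform_scale1: "gform A (c *\<^sub>R u) v = c * gform A u v"
  by (simp add: gform_def)

lemma gform_scale2: "gform A u (c *\<^sub>R v) = c * gform A u v"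
  by (simp add: gform_def matrix_vector_mult_scaleR)

lemma dd_gform:
  assumes "smooth_near A z" "smooth_near u z" "smooth_near v z"
  shows "dd w (\<lambda>z. gform (A z) (u z) (v z)) z
    = gform (dd w A z) (u z) (v z) + gform (A z) (dd w u z) (v z) + gform (A z) (u z) (dd w v z)"
proof -
  have "smooth_near (\<lambda>z. A z *v v z) z"
    by (rule smooth_near_bilinear[OF bounded_bilinear_matrix_vector_mult assms(1,3)])
  from dd_bilinear[OF bounded_bilinear_inner assms(2) this] show ?thesis
    by (simp add: gform_def dd_bilinear[OF bounded_bilinear_matrix_vector_mult assms(1,3)]
        inner_right_distrib)
qed

lemma smooth_near_gform:
  assumes "smooth_near A z" "smooth_near u z" "smooth_near v z"
  shows "smooth_near (\<lambda>z. gform (A z) (u z) (v z)) z"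
  unfolding gform_def
  by (intro smooth_near_bilinear[OF bounded_bilinear_inner]
    smooth_near_bilinear[OF bounded_bilinear_matrix_vector_mult] assms)

lemma gform_nondegenerate:
  assumes "invertible A" "\<And>w. gform A w y = gform A w y'" shows "y = y'"
proof -
  have "\<And>w. w \<bullet> (A *v y) = w \<bullet> (A *v y')" using assms(2) by (simp add: gform_def)
  then have "A *v y = A *v y'" by (metis vector_eq_ldot)
  then have "matrix_inv A *v (A *v y) = matrix_inv A *v (A *v y')" by simp
  then show ?thesis by (simp add: matrix_vector_mul_assoc matrix_inv_inverse[OF assms(1)])
qed

text \<open>The Koszul formula for constant vector fields, whose brackets vanish: the Christoffel
  symbols of the first kind.\<close>

definition koszul :: "(real^'k \<Rightarrow> real^'k^'k) \<Rightarrow> real^'k \<Rightarrow> real^'k \<Rightarrow> real^'k \<Rightarrow> real^'k \<Rightarrow> real" where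
  "koszul G x u v w = (gform (dd u G x) v w + gform (dd v G x) u w - gform (dd w G x) u v) / 2"

text \<open>The Christoffel symbols as a vector-valued bilinear map, the form in which a change of
  coordinates acts without index sums.\<close>

definition chr :: "(real^'k \<Rightarrow> real^'k^'k) \<Rightarrow> real^'k \<Rightarrow> real^'k \<Rightarrow> real^'k \<Rightarrow> real^'k" where
  "chr G x u v = matrix_inv (G x) *v (\<chi> l. koszul G x u v (axis l 1))"

text \<open>Symmetry is demanded nearby because derivatives of \<open>G\<close> must inherit it;
  nondegeneracy at the point spreads by continuity.\<close>

definition metric_near :: "('v::real_normed_vector \<Rightarrow> real^'k^'k) \<Rightarrow> 'v \<Rightarrow> bool" where
  "metric_near G x \<longleftrightarrow> smooth_near G x \<and> det (G x) \<noteq> 0 \<and> (\<forall>\<^sub>F y in nhds x. transpose (G y) = G y)"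

lemma metric_near_eventually:
  assumes "metric_near G x" shows "\<forall>\<^sub>F y in nhds x. metric_near G y"
proof -
  have s: "smooth_near G x" and d: "det (G x) \<noteq> 0" and t: "\<forall>\<^sub>F y in nhds x. transpose (G y) = G y"
    using assms by (auto simp: metric_near_def)
  have "\<forall>\<^sub>F y in nhds x. det (G y) \<noteq> 0"
    by (rule isCont_eventually_ne[OF smooth_near_isCont[OF smooth_near_det[OF s]] d])
  moreover have "\<forall>\<^sub>F y in nhds x. \<forall>\<^sub>F z in nhds y. transpose (G z) = G z"
    using t by (simp add: eventually_eventually)
  ultimately show ?thesis
    using smooth_near_eventually[OF s] by eventually_elim (simp add: metric_near_def)
qed

lemma metric_near_dd_sym:
  fixes G :: "'v::real_normed_vector \<Rightarrow> real^'k^'k"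
  assumes "metric_near G x" shows "transpose (dd w G x) = dd w G x"
proof -
  have bl: "bounded_linear (transpose :: real^'k^'k \<Rightarrow> _)"
    unfolding linear_conv_bounded_linear[symmetric]
    by (rule linearI) (simp_all add: transpose_def vec_eq_iff)
  have "dd w (\<lambda>x. transpose (G x)) x = dd w G x"
    using assms by (intro dd_cong) (simp add: metric_near_def)
  then show ?thesis
    using dd_bounded_linear[OF bl, of G x w] assms by (simp add: metric_near_def)
qed

lemma dd_add_dir: "smooth_near f x \<Longrightarrow> dd (u + v) f x = dd u f x + dd v f x"
  using linear_add[OF linear_dd] by blast

lemma dd_scale_dir: "smooth_near f x \<Longrightarrow> dd (c *\<^sub>R u) f x = c *\<^sub>R dd u f x"
  using linear_cmul[OF linear_dd] by blast

lemma gform_mat_add: "gform (A + B) u v = gform A u v + gform B u v"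
  by (simp add: gform_def matrix_vector_mult_add_rdistrib inner_right_distrib)

lemma gform_mat_scale: "gform (c *\<^sub>R A) u v = c * gform A u v"
  by (simp add: gform_def scaleR_matrix_vector_assoc[symmetric])

lemma koszul_linear:
  assumes "smooth_near G x"
  shows "koszul G x (u + u') v w = koszul G x u v w + koszul G x u' v w"
    "koszul G x u (v + v') w = koszul G x u v w + koszul G x u v' w"
    "koszul G x u v (w + w') = koszul G x u v w + koszul G x u v w'"
    "koszul G x (c *\<^sub>R u) v w = c * koszul G x u v w"
    "koszul G x u (c *\<^sub>R v) w = c * koszul G x u v w"
    "koszul G x u v (c *\<^sub>R w) = c * koszul G x u v w"
  by (simp_all add: koszul_def dd_add_dir dd_scale_dir assms gform_mat_add gform_mat_scale
      gform_add1 gform_add2 gform_scale1 gform_scale2 field_simps)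

lemma inner_koszul:
  assumes "smooth_near G x"
  shows "w \<bullet> (\<chi> l. koszul G x u v (axis l 1)) = koszul G x u v w"
proof -
  have lin: "linear (koszul G x u v)"
    by (rule linearI) (simp_all add: koszul_linear[OF assms])
  have "koszul G x u v (\<Sum>l\<in>UNIV. w $ l *\<^sub>R axis l 1) = (\<Sum>l\<in>UNIV. w $ l * koszul G x u v (axis l 1))"
    by (simp only: linear_sum[OF lin] linear_cmul[OF lin] real_scaleR_def)
  moreover have "(\<Sum>l\<in>UNIV. w $ l *\<^sub>R axis l 1) = w"
    using basis_expansion[of w] by (simp add: scalar_mult_eq_scaleR)
  ultimately show ?thesis by (simp add: inner_vec_def)
qed

text \<open>Determines \<open>chr\<close> by pairing with test vectors, so that two connections can
  be compared with no explicit inverse matrix.\<close>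

lemma gform_chr:
  assumes "metric_near G x" shows "gform (G x) w (chr G x u v) = koszul G x u v w"
proof -
  have "G x *v chr G x u v = (\<chi> l. koszul G x u v (axis l 1))"
    using assms matrix_inv_inverse[of "G x"]
    by (simp add: chr_def matrix_vector_mul_assoc metric_near_def invertible_det_nz)
  then show ?thesis using inner_koszul[of G x w u v] assms by (simp add: gform_def metric_near_def)
qed

lemma chr_linear:
  assumes "smooth_near G x"
  shows "linear (\<lambda>u. chr G x u v)" (is ?A1) "linear (\<lambda>v. chr G x u v)" (is ?A2)
proof -
  have "(\<chi> l. koszul G x (u + u') v (axis l 1)) = (\<chi> l. koszul G x u v (axis l 1)) + (\<chi> l. koszul G x u' v (axis l 1))"
    "(\<chi> l. koszul G x u (v + v') (axis l 1)) = (\<chi> l. koszul G x u v (axis l 1)) + (\<chi> l. koszul G x u v' (axis l 1))"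
    "(\<chi> l. koszul G x (c *\<^sub>R u) v (axis l 1)) = c *\<^sub>R (\<chi> l. koszul G x u v (axis l 1))"
    "(\<chi> l. koszul G x u (c *\<^sub>R v) (axis l 1)) = c *\<^sub>R (\<chi> l. koszul G x u v (axis l 1))" for u u' v v' c
    by (simp_all add: vec_eq_iff koszul_linear[OF assms])
  then show ?A1 ?A2
    by (auto intro!: linearI simp: chr_def matrix_vector_right_distrib matrix_vector_mult_scaleR)
qed

lemma chr_sym: "metric_near G x \<Longrightarrow> chr G x u v = chr G x v u"
  using gform_sym[OF metric_near_dd_sym] unfolding chr_def koszul_def
  by (metis (no_types, lifting) add.commute)

lemma smooth_near_koszul:
  assumes "smooth_near G x" shows "smooth_near (\<lambda>x. koszul G x u v w) x"
  unfolding koszul_def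
  by (intro smooth_near_divide smooth_intros smooth_near_gform assms) simp

lemma smooth_near_chr:
  assumes "metric_near G x" shows "smooth_near (\<lambda>x. chr G x u v) x"
proof -
  have "smooth_near (\<lambda>x. \<chi> l. koszul G x u v (axis l 1)) x"
    using assms by (intro smooth_near_vec) (simp add: smooth_near_koszul metric_near_def)
  then show ?thesis
    using assms unfolding chr_def metric_near_def
    by (intro smooth_near_bilinear[OF bounded_bilinear_matrix_vector_mult] smooth_near_matrix_inv) auto
qed

lemma christoffel_chr:
  assumes "metric_near G x"
  shows "christoffel G k i j x = chr G x (axis i 1) (axis j 1) $ k"
proof -
  have s: "smooth_near G x" and t: "transpose (G x) = G x"
    using assms eventually_nhds_x_imp_x by (auto simp: metric_near_def)
  have p: "partial i (\<lambda>y. G y $ j $ l) x = dd (axis i 1) G x $ j $ l" for i j l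
    using dd_nth[OF smooth_near_nth[OF s, of j], of "axis i 1" l] dd_nth[OF s, of "axis i 1" j]
    by (simp add: partial_dd)
  show ?thesis
    unfolding christoffel_def chr_def koszul_def p
    by (simp add: matrix_vector_mult_def gform_axis sum_distrib_left sum_divide_distrib mult_ac)
qed

text \<open>The curvature \<open>R(w, v) u\<close> of constant vector fields.\<close>

definition riem :: "(real^'k \<Rightarrow> real^'k^'k) \<Rightarrow> real^'k \<Rightarrow> real^'k \<Rightarrow> real^'k \<Rightarrow> real^'k \<Rightarrow> real^'k" where
  "riem G x w v u = dd w (\<lambda>y. chr G y v u) x - dd v (\<lambda>y. chr G y w u) x
     + chr G x w (chr G x v u) - chr G x v (chr G x w u)"

lemma metric_near_smooth: "metric_near G x \<Longrightarrow> smooth_near G x"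
  by (simp add: metric_near_def)

lemma dd_chr_linear:
  assumes "metric_near G x"
  shows "linear (\<lambda>v. dd w (\<lambda>y. chr G y v u) x)" (is ?A1) "linear (\<lambda>u. dd w (\<lambda>y. chr G y v u) x)" (is ?A2)
proof -
  note sm = smooth_near_chr[OF assms]
  have ev: "\<forall>\<^sub>F y in nhds x. linear (\<lambda>v. chr G y v u)" "\<forall>\<^sub>F y in nhds x. linear (\<lambda>u. chr G y v u)" for u v
    using smooth_near_eventually[OF metric_near_smooth[OF assms]]
    by (auto elim!: eventually_mono intro: chr_linear)
  have l1: "chr G y (v + v') u = chr G y v u + chr G y v' u" "chr G y (c *\<^sub>R v) u = c *\<^sub>R chr G y v u"
    if "linear (\<lambda>v. chr G y v u)" for y v v' u c
    using linear_add[OF that] linear_cmul[OF that] by auto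
  have l2: "chr G y v (u + u') = chr G y v u + chr G y v u'" "chr G y v (c *\<^sub>R u) = c *\<^sub>R chr G y v u"
    if "linear (\<lambda>u. chr G y v u)" for y v u u' c
    using linear_add[OF that] linear_cmul[OF that] by auto
  have "dd w (\<lambda>y. chr G y (v + v') u) x = dd w (\<lambda>y. chr G y v u + chr G y v' u) x" for v v'
    by (rule dd_cong, rule eventually_mono[OF ev(1)[of u]], rule l1)
  moreover have "dd w (\<lambda>y. chr G y (c *\<^sub>R v) u) x = dd w (\<lambda>y. c *\<^sub>R chr G y v u) x" for v c
    by (rule dd_cong, rule eventually_mono[OF ev(1)[of u]], rule l1)
  ultimately show ?A1
    by (intro linearI) (simp_all add: dd_add sm dd_bounded_linear[OF bounded_linear_scaleR_right])
  have "dd w (\<lambda>y. chr G y v (u + u')) x = dd w (\<lambda>y. chr G y v u + chr G y v u') x" for u u'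
    by (rule dd_cong, rule eventually_mono[OF ev(2)[of v]], rule l2)
  moreover have "dd w (\<lambda>y. chr G y v (c *\<^sub>R u)) x = dd w (\<lambda>y. c *\<^sub>R chr G y v u) x" for u c
    by (rule dd_cong, rule eventually_mono[OF ev(2)[of v]], rule l2)
  ultimately show ?A2
    by (intro linearI) (simp_all add: dd_add sm dd_bounded_linear[OF bounded_linear_scaleR_right])
qed

lemma riem_linear:
  assumes "metric_near G x"
  shows "linear (\<lambda>w. riem G x w v u)" (is ?A1) "linear (\<lambda>v. riem G x w v u)" (is ?A2) "linear (\<lambda>u. riem G x w v u)" (is ?A3)
proof -
  note c = chr_linear[OF metric_near_smooth[OF assms]]
  note d = dd_chr_linear[OF assms] linear_dd[OF smooth_near_chr[OF assms]]
  note [simp] = c[THEN linear_add] c[THEN linear_cmul] d[THEN linear_add] d[THEN linear_cmul]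
  show ?A1 ?A2 ?A3
    unfolding riem_def by (auto intro!: linearI simp: algebra_simps)
qed

definition ric :: "(real^'k \<Rightarrow> real^'k^'k) \<Rightarrow> real^'k \<Rightarrow> real^'k \<Rightarrow> real^'k \<Rightarrow> real" where
  "ric G x u v = (\<Sum>k\<in>UNIV. riem G x (axis k 1) v u $ k)"

lemma chr_expand:
  assumes "smooth_near G x"
  shows "chr G x u y $ k = (\<Sum>l\<in>UNIV. chr G x u (axis l 1) $ k * y $ l)"
proof -
  note lin = chr_linear(2)[OF assms, of u]
  have "chr G x u (\<Sum>l\<in>UNIV. y $ l *\<^sub>R axis l 1) = (\<Sum>l\<in>UNIV. y $ l *\<^sub>R chr G x u (axis l 1))"
    by (simp only: linear_sum[OF lin] linear_cmul[OF lin])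
  moreover have "(\<Sum>l\<in>UNIV. y $ l *\<^sub>R axis l 1) = y"
    using basis_expansion[of y] by (simp add: scalar_mult_eq_scaleR)
  ultimately show ?thesis by (simp add: mult_ac)
qed

lemma ricci_ric:
  assumes "metric_near G x"
  shows "ricci G x $ i $ j = ric G x (axis i 1) (axis j 1)"
proof -
  note s = metric_near_smooth[OF assms]
  \<comment> \<open>The lower indices are swapped so that \<open>j\<close>, the index of
    differentiation in \<open>ricci\<close>, becomes the first argument of \<open>chr\<close>, as in
    \<open>riem\<close>.\<close>
  have c: "christoffel G k i j x = chr G x (axis j 1) (axis i 1) $ k" for i j k
    using christoffel_chr[OF assms, of k i j] chr_sym[OF assms] by metis
  have p: "partial w (christoffel G k i j) x = dd (axis w 1) (\<lambda>y. chr G y (axis j 1) (axis i 1)) x $ k" for i j k w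
  proof -
    have "\<forall>\<^sub>F y in nhds x. christoffel G k i j y = chr G y (axis j 1) (axis i 1) $ k"
      using metric_near_eventually[OF assms]
      by eventually_elim (metis christoffel_chr chr_sym)
    from dd_cong[OF this] show ?thesis
      by (simp add: partial_dd dd_nth[OF smooth_near_chr[OF assms]])
  qed
  have "christoffel G k k l x * christoffel G l i j x = chr G x (axis k 1) (axis l 1) $ k * chr G x (axis j 1) (axis i 1) $ l"
    "christoffel G k j l x * christoffel G l i k x = chr G x (axis j 1) (axis l 1) $ k * chr G x (axis k 1) (axis i 1) $ l" for k l
    using c[of l i j] c[of l i k] christoffel_chr[OF assms] by simp_all
  then show ?thesis
    unfolding ricci_def ric_def riem_def p
    by (simp add: chr_expand[OF s, of "axis _ 1" "chr _ _ _ _"] sum_subtractf algebra_simps)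
qed

lemma ric_zero:
  assumes "metric_near G x" "ricci G x = 0" shows "ric G x u v = 0"
proof -
  note l = riem_linear[OF assms(1)]
  have l1: "linear (\<lambda>u. ric G x u v)" and l2: "linear (\<lambda>v. ric G x u v)" for u v
    by (intro linearI; simp add: ric_def linear_add[OF l(2)] linear_cmul[OF l(2)]
      linear_add[OF l(3)] linear_cmul[OF l(3)] sum.distrib sum_distrib_left)+
  have ax: "ric G x (axis i 1) (axis j 1) = 0" for i j
    using ricci_ric[OF assms(1)] assms(2) by (metis zero_index)
  have b: "(\<Sum>i\<in>UNIV. u $ i *\<^sub>R axis i 1) = u" for u :: "real^'a"
    using basis_expansion[of u] by (simp add: scalar_mult_eq_scaleR)
  have "ric G x (axis i 1) (\<Sum>j\<in>UNIV. v $ j *\<^sub>R axis j 1) = 0" for i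
    by (simp only: linear_sum[OF l2] linear_cmul[OF l2] ax) simp
  then have ax2: "ric G x (axis i 1) v = 0" for i unfolding b .
  have "ric G x (\<Sum>j\<in>UNIV. u $ j *\<^sub>R axis j 1) v = 0"
    by (simp only: linear_sum[OF l1] linear_cmul[OF l1] ax2) simp
  then show ?thesis unfolding b .
qed

text \<open>The Christoffel symbols of a pulled-back metric differ from the pulled-back Christoffel
  symbols by the second derivative of the map.\<close>

context
  fixes \<Phi> :: "real^'k \<Rightarrow> real^'n" and h :: "real^'n \<Rightarrow> real^'n^'n" and H :: "real^'k \<Rightarrow> real^'k^'k"
begin

definition pulls_back :: "real^'k \<Rightarrow> bool" where
  "pulls_back z \<longleftrightarrow> (\<forall>\<^sub>F y in nhds z. \<forall>u v. gform (H y) u v = gform (h (\<Phi> y)) (dd u \<Phi> y) (dd v \<Phi> y))"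

lemma dd_pullback:
  assumes pull: "pulls_back z" and \<Phi>: "smooth_near \<Phi> z" and h: "smooth_near h (\<Phi> z)" and H: "smooth_near H z"
  shows "gform (dd w H z) u v = gform (dd (dd w \<Phi> z) h (\<Phi> z)) (dd u \<Phi> z) (dd v \<Phi> z)
    + gform (h (\<Phi> z)) (dd w (dd u \<Phi>) z) (dd v \<Phi> z) + gform (h (\<Phi> z)) (dd u \<Phi> z) (dd w (dd v \<Phi>) z)"
proof -
  have "dd w (\<lambda>z. gform (H z) u v) z = gform (dd w H z) u v"
    by (simp only: dd_gform[OF H smooth_near_const smooth_near_const]) (simp add: gform_def)
  moreover have "dd w (\<lambda>z. gform (H z) u v) z = dd w (\<lambda>z. gform (h (\<Phi> z)) (dd u \<Phi> z) (dd v \<Phi> z)) z"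
    using pull unfolding pulls_back_def by (intro dd_cong) (auto elim: eventually_mono)
  moreover have "smooth_near (\<lambda>z. h (\<Phi> z)) z" by (rule smooth_near_compose[OF h \<Phi>])
  ultimately show ?thesis
    by (simp add: dd_gform smooth_near_dd \<Phi> dd_compose[OF h \<Phi>])
qed

lemma chr_pullback:
  assumes pull: "pulls_back z" and \<Phi>: "smooth_near \<Phi> z" and h: "metric_near h (\<Phi> z)" and H: "metric_near H z"
    and surj: "surj (\<lambda>v. dd v \<Phi> z)"
  shows "dd (chr H z u v) \<Phi> z = chr h (\<Phi> z) (dd u \<Phi> z) (dd v \<Phi> z) + dd u (dd v \<Phi>) z"
proof -
  note D = dd_pullback[OF pull \<Phi> metric_near_smooth[OF h] metric_near_smooth[OF H]]
  have pull': "gform (H z) u v = gform (h (\<Phi> z)) (dd u \<Phi> z) (dd v \<Phi> z)" for u v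
    using eventually_nhds_x_imp_x[OF pull[unfolded pulls_back_def]] by blast
  have sym: "gform (h (\<Phi> z)) a b = gform (h (\<Phi> z)) b a" for a b
    using h eventually_nhds_x_imp_x by (intro gform_sym) (auto simp: metric_near_def)
  have inv: "invertible (h (\<Phi> z))" using h by (simp add: metric_near_def invertible_det_nz)
  show ?thesis
  proof (rule gform_nondegenerate[OF inv])
    fix w' obtain w where w: "w' = dd w \<Phi> z" using surj by (auto simp: surj_def)
    have "gform (h (\<Phi> z)) (dd w \<Phi> z) (dd (chr H z u v) \<Phi> z) = koszul H z u v w"
      using gform_chr[OF H] pull' by metis
    \<comment> \<open>Of the six terms with second derivatives of \<open>\<Phi>\<close>, the four in
      which \<open>w\<close> is a direction of differentiation cancel in pairs; the two copies of
      the one in \<open>u\<close> and \<open>v\<close> absorb the factor one half.\<close>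
    also have "\<dots> = koszul h (\<Phi> z) (dd u \<Phi> z) (dd v \<Phi> z) (dd w \<Phi> z)
        + gform (h (\<Phi> z)) (dd w \<Phi> z) (dd u (dd v \<Phi>) z)"
      unfolding koszul_def D
      using sym[of "dd w \<Phi> z" "dd u (dd v \<Phi>) z"] sym[of "dd u \<Phi> z" "dd v (dd w \<Phi>) z"]
        sym[of "dd v \<Phi> z" "dd u (dd w \<Phi>) z"] dd_swap[OF \<Phi>, of u v] dd_swap[OF \<Phi>, of u w] dd_swap[OF \<Phi>, of v w]
      by simp
    also have "\<dots> = gform (h (\<Phi> z)) (dd w \<Phi> z) (chr h (\<Phi> z) (dd u \<Phi> z) (dd v \<Phi> z) + dd u (dd v \<Phi>) z)"
      by (simp add: gform_add2 gform_chr[OF h])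
    finally show "gform (h (\<Phi> z)) w' (dd (chr H z u v) \<Phi> z)
        = gform (h (\<Phi> z)) w' (chr h (\<Phi> z) (dd u \<Phi> z) (dd v \<Phi> z) + dd u (dd v \<Phi>) z)"
      by (simp add: w)
  qed
qed

text \<open>The law of \<open>chr_pullback\<close> is differentiated along \<open>w\<close>;
  subtracting the same identity with \<open>w\<close> and \<open>v\<close> exchanged removes every
  term that is not tensorial.\<close>

lemma riem_pullback:
  assumes pull: "pulls_back z" and \<Phi>: "smooth_near \<Phi> z" and h: "metric_near h (\<Phi> z)" and H: "metric_near H z"
    and surj: "\<forall>\<^sub>F y in nhds z. surj (\<lambda>v. dd v \<Phi> y)"
  shows "dd (riem H z w v u) \<Phi> z = riem h (\<Phi> z) (dd w \<Phi> z) (dd v \<Phi> z) (dd u \<Phi> z)"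
proof -
  note ls = linear_add[OF linear_dd[OF \<Phi>]] linear_diff[OF linear_dd[OF \<Phi>]]
  have lim: "filterlim \<Phi> (nhds (\<Phi> z)) (nhds z)"
    using smooth_near_isCont[OF \<Phi>] by (simp add: isCont_def tendsto_nhds_iff)
  have "\<forall>\<^sub>F y in nhds z. pulls_back y"
    using pull by (simp add: pulls_back_def eventually_eventually)
  note ev = smooth_near_eventually[OF \<Phi>] metric_near_eventually[OF H] surj
    eventually_compose_filterlim[OF metric_near_eventually[OF h] lim] this
  note c = chr_pullback[OF pull \<Phi> h H eventually_nhds_x_imp_x[OF surj]]
  note hl = chr_linear[OF metric_near_smooth[OF h]]
  \<comment> \<open>One half of the curvature, before antisymmetrizing. Apart from the first two
    terms, everything on the right is symmetric in \<open>w\<close> and \<open>v\<close>, including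
    the third derivative of \<open>\<Phi>\<close>, and so cancels.\<close>
  have A: "dd (dd w (\<lambda>y. chr H y v u) z + chr H z w (chr H z v u)) \<Phi> z
     = dd (dd w \<Phi> z) (\<lambda>y. chr h y (dd v \<Phi> z) (dd u \<Phi> z)) (\<Phi> z)
     + chr h (\<Phi> z) (dd w \<Phi> z) (chr h (\<Phi> z) (dd v \<Phi> z) (dd u \<Phi> z))
     + (chr h (\<Phi> z) (dd w \<Phi> z) (dd v (dd u \<Phi>) z) + chr h (\<Phi> z) (dd v \<Phi> z) (dd w (dd u \<Phi>) z))
     + chr h (\<Phi> z) (dd w (dd v \<Phi>) z) (dd u \<Phi> z) + dd w (dd v (dd u \<Phi>)) z" for w v u
  proof -
    have e1: "dd w (\<lambda>y. dd (chr H y v u) \<Phi> y) z = dd w (\<lambda>y. dd (chr H z v u) \<Phi> y) z + dd (dd w (\<lambda>y. chr H y v u) z) \<Phi> z"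
      using ev(1) by (intro dd_linear_family[of "\<lambda>y v. dd v \<Phi> y"] smooth_near_chr H smooth_near_dd \<Phi>)
        (auto elim!: eventually_mono intro: linear_dd)
    have e2: "dd w (dd (chr H z v u) \<Phi>) z = dd (chr H z w (chr H z v u)) \<Phi> z
      - chr h (\<Phi> z) (dd w \<Phi> z) (chr h (\<Phi> z) (dd v \<Phi> z) (dd u \<Phi> z) + dd v (dd u \<Phi>) z)"
      using c[of w "chr H z v u"] c[of v u] by simp
    have e3: "dd w (\<lambda>y. dd (chr H y v u) \<Phi> y) z
      = dd w (\<lambda>y. chr h (\<Phi> y) (dd v \<Phi> y) (dd u \<Phi> y) + dd v (dd u \<Phi>) y) z"
      using ev by (intro dd_cong, eventually_elim) (rule chr_pullback)
    have sc: "smooth_near (\<lambda>y. chr h (\<Phi> y) a b) z" for a b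
      using smooth_near_compose[OF smooth_near_chr[OF h] \<Phi>] .
    have l1: "\<forall>\<^sub>F y in nhds z. linear (\<lambda>a. chr h (\<Phi> y) a (b y))" for b
      using ev(4) by eventually_elim (blast intro: chr_linear metric_near_smooth)
    have l2: "\<forall>\<^sub>F y in nhds z. linear (\<lambda>b. chr h (\<Phi> y) a b)" for a
      using ev(4) by eventually_elim (blast intro: chr_linear metric_near_smooth)
    have sc2: "smooth_near (\<lambda>y. chr h (\<Phi> y) a (dd u \<Phi> y)) z" for a
      by (rule smooth_near_linear_family[OF l2 sc smooth_near_dd[OF \<Phi>]])
    have sc3: "smooth_near (\<lambda>y. chr h (\<Phi> y) (dd v \<Phi> y) (dd u \<Phi> y)) z"
      by (rule smooth_near_linear_family[OF l1 sc2 smooth_near_dd[OF \<Phi>]])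
    have "dd w (\<lambda>y. chr h (\<Phi> y) (dd v \<Phi> y) (dd u \<Phi> y)) z
      = dd w (\<lambda>y. chr h (\<Phi> y) (dd v \<Phi> z) (dd u \<Phi> y)) z + chr h (\<Phi> z) (dd w (dd v \<Phi>) z) (dd u \<Phi> z)"
      by (rule dd_linear_family[OF l1 sc2 smooth_near_dd[OF \<Phi>]])
    also have "dd w (\<lambda>y. chr h (\<Phi> y) (dd v \<Phi> z) (dd u \<Phi> y)) z
      = dd w (\<lambda>y. chr h (\<Phi> y) (dd v \<Phi> z) (dd u \<Phi> z)) z + chr h (\<Phi> z) (dd v \<Phi> z) (dd w (dd u \<Phi>) z)"
      by (rule dd_linear_family[OF l2 sc smooth_near_dd[OF \<Phi>]])
    also have "dd w (\<lambda>y. chr h (\<Phi> y) (dd v \<Phi> z) (dd u \<Phi> z)) z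
      = dd (dd w \<Phi> z) (\<lambda>y. chr h y (dd v \<Phi> z) (dd u \<Phi> z)) (\<Phi> z)"
      by (rule dd_compose[OF smooth_near_chr[OF h] \<Phi>])
    finally have e4: "dd w (\<lambda>y. chr h (\<Phi> y) (dd v \<Phi> y) (dd u \<Phi> y) + dd v (dd u \<Phi>) y) z
      = dd (dd w \<Phi> z) (\<lambda>y. chr h y (dd v \<Phi> z) (dd u \<Phi> z)) (\<Phi> z)
       + chr h (\<Phi> z) (dd v \<Phi> z) (dd w (dd u \<Phi>) z) + chr h (\<Phi> z) (dd w (dd v \<Phi>) z) (dd u \<Phi> z)
       + dd w (dd v (dd u \<Phi>)) z"
      by (simp add: dd_add sc3 smooth_near_dd \<Phi>)
    show ?thesis using e1 e2 e3 e4
      by (simp add: ls linear_add[OF hl(2)] algebra_simps)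
  qed
  have "riem H z w v u = (dd w (\<lambda>y. chr H y v u) z + chr H z w (chr H z v u))
      - (dd v (\<lambda>y. chr H y w u) z + chr H z v (chr H z w u))"
    by (simp add: riem_def)
  then have "dd (riem H z w v u) \<Phi> z = dd (dd w (\<lambda>y. chr H y v u) z + chr H z w (chr H z v u)) \<Phi> z
      - dd (dd v (\<lambda>y. chr H y w u) z + chr H z v (chr H z w u)) \<Phi> z"
    by (simp only: ls)
  then show ?thesis
    unfolding A riem_def
    using dd_swap[OF \<Phi>, of w v] dd_swap[OF smooth_near_dd[OF \<Phi>, of u], of v w] by simp
qed

end

section \<open>Ricci flatness under pullback\<close>

lemma gform_congruence: "gform (transpose J ** A ** J) u v = gform A (J *v u) (J *v v)"
proof -
  have "u \<bullet> (transpose J *v y) = (J *v u) \<bullet> y" for y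
    by (metis dot_lmul_matrix inner_commute transpose_matrix_vector)
  then show ?thesis by (simp add: gform_def flip: matrix_vector_mul_assoc)
qed

lemma trace_matrix: "(\<Sum>k\<in>UNIV. L (axis k 1) $ k) = trace (matrix L)"
  by (simp add: trace_def matrix_def)

text \<open>The Jacobian conjugates the endomorphism \<open>w \<mapsto> R(w, v) u\<close> of the
  pullback to that of \<open>h\<close>, and conjugate endomorphisms have equal traces.\<close>

lemma ricci_flat_pullback:
  fixes \<Phi> :: "real^'k \<Rightarrow> real^'k"
  assumes pull: "pulls_back \<Phi> h H z"
    and \<Phi>: "smooth_near \<Phi> z" and h: "metric_near h (\<Phi> z)" and H: "metric_near H z"
    and flat: "ricci h (\<Phi> z) = 0"
  shows "ricci H z = 0"
proof -
  define J where "J = (\<lambda>y. matrix (\<lambda>v. dd v \<Phi> y))"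
  have J: "J y *v v = dd v \<Phi> y" if "smooth_near \<Phi> y" for y v
    using linear_dd[OF that] by (simp add: J_def matrix_works linear_matrix_vector_mul_eq linear_linear)
  have evd: "\<forall>\<^sub>F y in nhds z. det (H y) \<noteq> 0"
    using metric_near_eventually[OF H] by eventually_elim (simp add: metric_near_def)
  \<comment> \<open>Invertibility of the Jacobian comes from the metrics: \<open>H = J^T h J\<close>
    has nonzero determinant.\<close>
  have inv: "\<forall>\<^sub>F y in nhds z. invertible (J y)"
    using evd smooth_near_eventually[OF \<Phi>] pull[unfolded pulls_back_def]
  proof eventually_elim
    case (elim y)
    have "H y = transpose (J y) ** h (\<Phi> y) ** J y"
    proof -
      have "H y $ i $ j = (transpose (J y) ** h (\<Phi> y) ** J y) $ i $ j" for i j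
      proof -
        have "H y $ i $ j = gform (h (\<Phi> y)) (J y *v axis i 1) (J y *v axis j 1)"
          using elim(3)[rule_format, of "axis i 1" "axis j 1"] by (simp add: J[OF elim(2)] gform_axis)
        also have "\<dots> = gform (transpose (J y) ** h (\<Phi> y) ** J y) (axis i 1) (axis j 1)"
          by (rule gform_congruence[symmetric])
        finally show ?thesis by (simp add: gform_axis)
      qed
      then show ?thesis by (simp add: vec_eq_iff)
    qed
    then have "det (J y) \<noteq> 0" using elim(1) by (auto simp: det_mul)
    then show ?case by (simp add: invertible_det_nz)
  qed
  have surj: "\<forall>\<^sub>F y in nhds z. surj (\<lambda>v. dd v \<Phi> y)"
    using inv smooth_near_eventually[OF \<Phi>]
  proof eventually_elim
    case (elim y)
    have "dd (matrix_inv (J y) *v v) \<Phi> y = v" for v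
      using matrix_inv_inverse(1)[OF elim(1)] by (simp add: matrix_vector_mul_assoc flip: J[OF elim(2)])
    then show ?case by (metis surjI)
  qed
  note R = riem_pullback[OF pull \<Phi> h H surj]
  define J0 where "J0 = J z"
  have Ji: "invertible J0" using inv eventually_nhds_x_imp_x J0_def by blast
  have "ric H z u v = 0" for u v
  proof -
    define A where "A = matrix (\<lambda>w. riem H z w v u)"
    define B where "B = matrix (\<lambda>w. riem h (\<Phi> z) w (dd v \<Phi> z) (dd u \<Phi> z))"
    have Av: "A *v w = riem H z w v u" for w
      using riem_linear(1)[OF H] by (simp add: A_def matrix_works linear_linear)
    have Bv: "B *v w = riem h (\<Phi> z) w (dd v \<Phi> z) (dd u \<Phi> z)" for w
      using riem_linear(1)[OF h] by (simp add: B_def matrix_works linear_linear)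
    have "J0 ** A = B ** J0"
    proof -
      have "(J0 ** A) *v w = (B ** J0) *v w" for w
        unfolding matrix_vector_mul_assoc[symmetric] Av Bv J0_def J[OF \<Phi>] R ..
      then show ?thesis by (simp add: matrix_eq)
    qed
    then have "matrix_inv J0 ** J0 ** A = matrix_inv J0 ** (B ** J0)"
      by (simp only: matrix_mul_assoc[symmetric])
    then have "A = matrix_inv J0 ** (B ** J0)"
      by (simp add: matrix_inv_inverse(2)[OF Ji])
    then have "trace A = trace (B ** J0 ** matrix_inv J0)"
      by (simp only: trace_mul_sym[of "matrix_inv J0"])
    also have "\<dots> = trace B"
      by (simp only: matrix_mul_assoc[symmetric] matrix_inv_inverse(1)[OF Ji] matrix_mul_rid)
    finally show ?thesis
      using ric_zero[OF h flat, of "dd u \<Phi> z" "dd v \<Phi> z"]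
      unfolding ric_def A_def B_def trace_matrix[of "\<lambda>w. riem H z w v u"]
        trace_matrix[of "\<lambda>w. riem h (\<Phi> z) w (dd v \<Phi> z) (dd u \<Phi> z)"] by simp
  qed
  then show ?thesis by (simp add: vec_eq_iff ricci_ric[OF H])
qed

section \<open>Congruence of jets\<close>

text \<open>Smoothness of both sides is built in, so that congruences can be combined and
  differentiated without side conditions.\<close>

definition fcong :: "nat \<Rightarrow> ('v::real_normed_vector \<Rightarrow> real) \<Rightarrow> ('v \<Rightarrow> real) \<Rightarrow> 'v \<Rightarrow> bool" where
  "fcong m f g x \<longleftrightarrow> smooth_near f x \<and> smooth_near g x \<and> flat m (\<lambda>y. f y - g y) x"

lemma fcong_refl: "smooth_near f x \<Longrightarrow> fcong m f f x"
  by (simp add: fcong_def)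

lemma fcong_const: "fcong m (\<lambda>x. c) (\<lambda>x. c) x"
  by (simp add: fcong_refl)

lemma fcong_trans: "fcong m f g x \<Longrightarrow> fcong m g h x \<Longrightarrow> fcong m f h x"
  using flat_add[of m "\<lambda>y. f y - g y" x "\<lambda>y. g y - h y"] by (auto simp: fcong_def)

lemma fcong_sym: "fcong m f g x \<Longrightarrow> fcong m g f x"
  using flat_minus[of m "\<lambda>y. f y - g y" x] by (auto simp: fcong_def)

lemma fcong_mono: "fcong m f g x \<Longrightarrow> k \<le> m \<Longrightarrow> fcong k f g x"
  using flat_mono by (auto simp: fcong_def)

lemma fcong_add: "fcong m f f' x \<Longrightarrow> fcong m g g' x \<Longrightarrow> fcong m (\<lambda>y. f y + g y) (\<lambda>y. f' y + g' y) x"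
  using flat_add[of m "\<lambda>y. f y - f' y" x "\<lambda>y. g y - g' y"] by (auto simp: fcong_def algebra_simps)

lemma fcong_diff: "fcong m f f' x \<Longrightarrow> fcong m g g' x \<Longrightarrow> fcong m (\<lambda>y. f y - g y) (\<lambda>y. f' y - g' y) x"
  using flat_diff[of m "\<lambda>y. f y - f' y" x "\<lambda>y. g y - g' y"] by (auto simp: fcong_def algebra_simps)

text \<open>One may trade vanishing of one factor for order of agreement of the other.\<close>

lemma fcong_mult_flat:
  assumes "fcong m f f' x" "fcong l g g' x" "flat k f x" "flat j g' x" "n \<le> k + l" "n \<le> m + j"
  shows "fcong n (\<lambda>y. f y * g y) (\<lambda>y. f' y * g' y) x"
proof -
  have s: "smooth_near f x" "smooth_near f' x" "smooth_near g x" "smooth_near g' x"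
    using assms by (auto simp: fcong_def)
  have "flat n (\<lambda>y. f y * (g y - g' y)) x"
    using assms s by (intro flat_mono[OF flat_mult[of k f x l]]) (auto simp: fcong_def)
  moreover have "flat n (\<lambda>y. (f y - f' y) * g' y) x"
    using assms s by (intro flat_mono[OF flat_mult[of m _ x j g']]) (auto simp: fcong_def)
  ultimately have "flat n (\<lambda>y. f y * (g y - g' y) + (f y - f' y) * g' y) x"
    using s by (intro flat_add) auto
  then show ?thesis using s by (auto simp: fcong_def algebra_simps)
qed

lemma fcong_mult: "fcong m f f' x \<Longrightarrow> fcong m g g' x \<Longrightarrow> fcong m (\<lambda>y. f y * g y) (\<lambda>y. f' y * g' y) x"
  by (rule fcong_mult_flat[where k = 0 and j = 0]) auto

lemma fcong_sum:
  "(\<And>i. i \<in> I \<Longrightarrow> fcong m (f i) (f' i) x) \<Longrightarrow> fcong m (\<lambda>y. \<Sum>i\<in>I. f i y) (\<lambda>y. \<Sum>i\<in>I. f' i y) x"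
  by (induction I rule: infinite_finite_induct) (auto intro: fcong_add fcong_const)

lemma fcong_dd: "fcong (Suc m) f f' x \<Longrightarrow> fcong m (dd v f) (dd v f') x"
proof -
  assume *: "fcong (Suc m) f f' x"
  then have s: "smooth_near f x" "smooth_near f' x" by (auto simp: fcong_def)
  have ev: "\<forall>\<^sub>F y in nhds x. dd v (\<lambda>y. f y - f' y) y = dd v f y - dd v f' y"
    using s[THEN smooth_near_eventually] by eventually_elim (rule dd_diff)
  have "flat (Suc m) (\<lambda>y. f y - f' y) x" using * by (simp add: fcong_def)
  from flat_transfer[OF flat_SucD(2)[OF this] ev] have "flat m (\<lambda>y. dd v f y - dd v f' y) x" .
  then show ?thesis using s by (simp add: fcong_def smooth_near_dd)
qed

lemma fcong_transfer:
  assumes "fcong m f g x" "\<forall>\<^sub>F y in nhds x. f y = f' y" "\<forall>\<^sub>F y in nhds x. g y = g' y"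
  shows "fcong m f' g' x"
proof -
  have "\<forall>\<^sub>F y in nhds x. f y - g y = f' y - g' y"
    using assms(2,3) by eventually_elim simp
  then show ?thesis
    using assms smooth_near_cong[of f f' x] smooth_near_cong[of g g' x] flat_transfer
    by (auto simp: fcong_def)
qed

lemma smooth_near_entries:
  fixes A :: "'v::real_normed_vector \<Rightarrow> real^'n^'m"
  shows "smooth_near A x \<longleftrightarrow> (\<forall>i j. smooth_near (\<lambda>y. A y $ i $ j) x)"
  by (auto simp: smooth_near_vec_iff)

text \<open>An entry of the inverse is a smooth function of the matrix near an invertible one, so
  \<open>flat_compose_diff\<close> applies.\<close>

lemma fcong_matrix_inv:
  fixes A B :: "'v::real_normed_vector \<Rightarrow> real^'n^'n"
  assumes "\<And>i j. fcong m (\<lambda>y. A y $ i $ j) (\<lambda>y. B y $ i $ j) x" "det (A x) \<noteq> 0" "det (B x) \<noteq> 0"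
  shows "fcong m (\<lambda>y. matrix_inv (A y) $ k $ l) (\<lambda>y. matrix_inv (B y) $ k $ l) x"
proof -
  have s: "smooth_near A x" "smooth_near B x"
    using assms by (auto simp: smooth_near_entries fcong_def)
  have "flat m (\<lambda>y. matrix_inv (A y) $ k $ l - matrix_inv (B y) $ k $ l) x"
  proof (rule flat_compose_diff[OF s, where F = "\<lambda>M. matrix_inv M $ k $ l"])
    show "\<forall>b\<in>Basis. flat m (\<lambda>y. (A y - B y) \<bullet> b) x"
      using assms(1) by (auto simp: Basis_vec_def inner_axis fcong_def)
    show "smooth_near (\<lambda>M. matrix_inv M $ k $ l) (A x)"
      using assms by (intro smooth_near_nth smooth_near_matrix_inv smooth_near_ident)
  qed
  then show ?thesis
    using s assms by (auto simp: fcong_def intro!: smooth_near_nth smooth_near_matrix_inv)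
qed

lemma partial_fun: "partial i f = dd (axis i 1) f"
  by (simp add: fun_eq_iff partial_dd)

lemma fcong_christoffel:
  assumes "\<And>i j. fcong (Suc m) (\<lambda>y. A y $ i $ j) (\<lambda>y. B y $ i $ j) x" "det (A x) \<noteq> 0" "det (B x) \<noteq> 0"
  shows "fcong m (christoffel A k i j) (christoffel B k i j) x"
  unfolding christoffel_def[abs_def] partial_fun
  using assms
  by (intro fcong_mult fcong_const fcong_sum fcong_add fcong_diff fcong_dd fcong_matrix_inv)
    (auto intro: fcong_mono[where m = "Suc m"])

text \<open>The Ricci tensor contains two derivatives of the metric, hence two orders are
  lost.\<close>

lemma fcong_ricci:
  assumes "\<And>i j. fcong (Suc (Suc m)) (\<lambda>y. A y $ i $ j) (\<lambda>y. B y $ i $ j) x" "det (A x) \<noteq> 0" "det (B x) \<noteq> 0"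
  shows "fcong m (\<lambda>y. ricci A y $ i $ j) (\<lambda>y. ricci B y $ i $ j) x"
  using fcong_christoffel[OF assms] unfolding ricci_def partial_fun
  by (auto intro!: fcong_add fcong_diff fcong_sum fcong_mult fcong_dd intro: fcong_mono[where m = "Suc m"])

section \<open>The ambient metric in normal form\<close>

lemma sum_ambient:
  fixes f :: "'m::finite ambient_index \<Rightarrow> 'b::comm_monoid_add"
  shows "(\<Sum>k\<in>UNIV. f k) = f IxT + f IxRho + (\<Sum>a\<in>UNIV. f (IxM a))"
proof -
  have U: "(UNIV :: 'm ambient_index set) = {IxT, IxRho} \<union> range IxM"
    by (auto intro: ambient_index.exhaust)
  show ?thesis
    unfolding U by (subst sum.union_disjoint) (auto simp: sum.reindex inj_def)
qed

type_synonym 'm cyl = "real \<times> (real^'m)"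

text \<open>Forgets \<open>t\<close>. By homogeneity every coefficient of the ambient metric is a
  power of \<open>t\<close> times a function of this projection.\<close>

definition amb_proj :: "real^('m::finite ambient_index) \<Rightarrow> 'm cyl" where
  "amb_proj z = (z $ IxRho, \<chi> a. z $ IxM a)"

lemma bounded_linear_amb_proj: "bounded_linear amb_proj"
  unfolding linear_conv_bounded_linear[symmetric]
  by (rule linearI) (simp_all add: amb_proj_def vec_eq_iff)

lemma amb_proj_axis [simp]:
  "amb_proj (axis IxT 1) = 0" "amb_proj (axis IxRho 1) = (1, 0)" "amb_proj (axis (IxM a) 1) = (0, axis a 1)"
  by (auto simp: amb_proj_def axis_def vec_eq_iff zero_prod_def)

lemma smooth_near_lift: "smooth_near F (amb_proj z) \<Longrightarrow> smooth_near (\<lambda>z. F (amb_proj z)) z"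
  by (rule smooth_near_compose[OF _ smooth_near_linear[OF bounded_linear_amb_proj]])

lemma dd_lift: "smooth_near F (amb_proj z) \<Longrightarrow> dd v (\<lambda>z. F (amb_proj z)) z = dd (amb_proj v) F (amb_proj z)"
  using dd_compose[OF _ smooth_near_linear[OF bounded_linear_amb_proj]] dd_linear[OF bounded_linear_amb_proj] by metis

lemma dd_coord: "dd v (\<lambda>z. z $ i) (z :: real^'n) = v $ i"
  by (rule dd_linear[OF bounded_linear_vec_nth])

lemma eventually_amb_proj:
  assumes "\<forall>\<^sub>F y in nhds (amb_proj z). P y" shows "\<forall>\<^sub>F z in nhds z. P (amb_proj z)"
  using assms smooth_near_isCont[OF smooth_near_linear[OF bounded_linear_amb_proj, of z]]
  by (auto simp: isCont_def tendsto_nhds_iff intro: eventually_compose_filterlim)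

text \<open>
  A family of metrics is a matrix function of \<open>(\<rho>, x)\<close>.  Below are its \<open>\<rho>\<close>-derivative, its Christoffel
  symbols at fixed \<open>\<rho>\<close>, the endomorphism \<open>g\<^sup>-\<^sup>1 g' / 2\<close> and its Ricci tensor at fixed \<open>\<rho>\<close>.
\<close>

definition gdot :: "('m cyl \<Rightarrow> real^'m^'m) \<Rightarrow> 'm \<Rightarrow> 'm \<Rightarrow> 'm cyl \<Rightarrow> real" where
  "gdot G a b = dd (1, 0) (\<lambda>y. G y $ a $ b)"

definition gam :: "('m cyl \<Rightarrow> real^'m^'m) \<Rightarrow> 'm \<Rightarrow> 'm \<Rightarrow> 'm \<Rightarrow> 'm cyl \<Rightarrow> real" where
  "gam G c a b y = (1/2) * (\<Sum>d\<in>UNIV. matrix_inv (G y) $ c $ d *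
     (dd (0, axis a 1) (\<lambda>y. G y $ b $ d) y + dd (0, axis b 1) (\<lambda>y. G y $ a $ d) y
      - dd (0, axis d 1) (\<lambda>y. G y $ a $ b) y))"

definition shp :: "('m cyl \<Rightarrow> real^'m^'m) \<Rightarrow> 'm \<Rightarrow> 'm \<Rightarrow> 'm cyl \<Rightarrow> real" where
  "shp G c a y = (1/2) * (\<Sum>d\<in>UNIV. matrix_inv (G y) $ c $ d * gdot G a d y)"

definition ricY :: "('m cyl \<Rightarrow> real^'m^'m) \<Rightarrow> 'm \<Rightarrow> 'm \<Rightarrow> 'm cyl \<Rightarrow> real" where
  "ricY G a b y = (\<Sum>c\<in>UNIV. dd (0, axis c 1) (gam G c a b) y - dd (0, axis b 1) (gam G c a c) y
     + (\<Sum>d\<in>UNIV. gam G c c d y * gam G d a b y - gam G c b d y * gam G d a c y))"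

lemma metric_near_symD: 
  assumes "metric_near G y" shows "G y $ a $ b = G y $ b $ a"
proof -
  have "transpose (G y) = G y"
    using assms unfolding metric_near_def using eventually_nhds_x_imp_x[of "\<lambda>y. transpose (G y) = G y" y] by blast
  then have "transpose (G y) $ b $ a = G y $ b $ a" by simp
  then show ?thesis by (simp add: transpose_def)
qed

lemma metric_near_entry_dd_sym: "metric_near G y \<Longrightarrow> dd v (\<lambda>y. G y $ a $ b) y = dd v (\<lambda>y. G y $ b $ a) y"
  by (rule dd_cong, rule eventually_mono[OF metric_near_eventually], assumption, rule metric_near_symD)

lemma smooth_near_fam:
  assumes "metric_near G y"
  shows "smooth_near (\<lambda>y. G y $ a $ b) y" (is ?A1) "smooth_near (gdot G a b) y" (is ?A2) "smooth_near (gam G c a b) y" (is ?A3)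
    "smooth_near (shp G c a) y" (is ?A4)
proof -
  have 1: "smooth_near (\<lambda>y. G y $ a $ b) y" for a b
    using assms by (auto simp: metric_near_def)
  have 2: "smooth_near (\<lambda>y. matrix_inv (G y) $ a $ b) y" for a b
    using assms by (auto simp: metric_near_def intro!: smooth_near_nth smooth_near_matrix_inv)
  show ?A1 ?A2 ?A3 ?A4
    unfolding gdot_def gam_def[abs_def] shp_def[abs_def]
    by (intro smooth_intros 1 2)+
qed

abbreviation ambm :: "('m cyl \<Rightarrow> real^'m^'m) \<Rightarrow> real^('m::finite ambient_index) \<Rightarrow> real^('m ambient_index)^('m ambient_index)" where
  "ambm G \<equiv> ambient_metric (\<lambda>\<rho> x. G (\<rho>, x))"

section \<open>Inverse and Christoffel symbols of the ambient metric\<close>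

lemma ambient_metric_entries:
  "ambm G z $ IxT $ IxT = 2 * z $ IxRho"
  "ambm G z $ IxT $ IxRho = z $ IxT"
  "ambm G z $ IxRho $ IxT = z $ IxT"
  "ambm G z $ IxRho $ IxRho = 0"
  "ambm G z $ IxT $ IxM a = 0"
  "ambm G z $ IxM a $ IxT = 0"
  "ambm G z $ IxRho $ IxM a = 0"
  "ambm G z $ IxM a $ IxRho = 0"
  "ambm G z $ IxM a $ IxM b = (z $ IxT)\<^sup>2 * G (amb_proj z) $ a $ b"
  by (simp_all add: ambient_metric_def Let_def amb_proj_def)

text \<open>Block inverse: the \<open>(t, \<rho>)\<close> block with entries
  \<open>2 \<rho>, t, t, 0\<close> inverts to
  \<open>0, 1 / t, 1 / t, - 2 \<rho> / t^2\<close>.\<close>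

definition amb_inv :: "('m cyl \<Rightarrow> real^'m^'m) \<Rightarrow> real^('m::finite ambient_index) \<Rightarrow> real^('m ambient_index)^('m ambient_index)" where
  "amb_inv G z = (\<chi> k l. (case (k, l) of
         (IxRho, IxRho) \<Rightarrow> - 2 * z $ IxRho / (z $ IxT)\<^sup>2
       | (IxT, IxRho) \<Rightarrow> 1 / z $ IxT
       | (IxRho, IxT) \<Rightarrow> 1 / z $ IxT
       | (IxM a, IxM b) \<Rightarrow> matrix_inv (G (amb_proj z)) $ a $ b / (z $ IxT)\<^sup>2
       | _ \<Rightarrow> 0))"

lemma matrix_inv_unique:
  fixes A B :: "real^'n^'n"
  assumes "A ** B = mat 1" shows "matrix_inv A = B" "det A \<noteq> 0"
proof -
  have "invertible A" using assms by (auto simp: invertible_def matrix_left_right_inverse)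
  then show "det A \<noteq> 0" by (simp add: invertible_det_nz)
  have "matrix_inv A = matrix_inv A ** (A ** B)" using assms by simp
  also have "\<dots> = B" by (simp only: matrix_mul_assoc matrix_inv_inverse(2)[OF \<open>invertible A\<close>] matrix_mul_lid)
  finally show "matrix_inv A = B" .
qed

lemma matrix_inv_entries:
  fixes A :: "real^'n^'n"
  assumes "det A \<noteq> 0"
  shows "(\<Sum>c\<in>UNIV. A $ a $ c * matrix_inv A $ c $ b) = (if a = b then 1 else 0)"
    "(\<Sum>c\<in>UNIV. matrix_inv A $ a $ c * A $ c $ b) = (if a = b then 1 else 0)"
  using matrix_inv_inverse[of A] assms
  by (auto simp: invertible_det_nz matrix_matrix_mult_def mat_def vec_eq_iff)

lemma ambient_metric_inverse:
  assumes "z $ IxT \<noteq> 0" "det (G (amb_proj z)) \<noteq> 0"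
  shows "matrix_inv (ambm G z) = amb_inv G z" (is ?A1) "det (ambm G z) \<noteq> 0" (is ?A2)
proof -
  have "(ambm G z ** amb_inv G z) $ k $ l = mat 1 $ k $ l" for k l
    using assms matrix_inv_entries(1)[OF assms(2)]
    by (cases k; cases l)
      (simp_all add: matrix_matrix_mult_def sum_ambient ambient_metric_entries amb_inv_def mat_def
        power2_eq_square field_simps)
  then have "ambm G z ** amb_inv G z = mat 1" by (simp add: vec_eq_iff)
  then show ?A1 ?A2
    by (rule matrix_inv_unique)+
qed

lemma ambient_metric_near:
  assumes "z $ IxT \<noteq> 0" "metric_near G (amb_proj z)"
  shows "metric_near (ambm G) z"
  unfolding metric_near_def
proof (intro conjI)
  note s = smooth_near_lift[OF smooth_near_fam(1)[OF assms(2)]]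
  have "smooth_near (\<lambda>z. ambm G z $ k $ l) z" for k l
    by (cases k; cases l)
      (auto simp: ambient_metric_entries intro!: smooth_near_mult smooth_near_power smooth_near_nth s)
  then show "smooth_near (ambm G) z" by (simp add: smooth_near_entries)
  show "det (ambm G z) \<noteq> 0"
    using ambient_metric_inverse(2) assms by (auto simp: metric_near_def)
  have "\<forall>\<^sub>F z in nhds z. transpose (G (amb_proj z)) = G (amb_proj z)"
    using assms(2) by (intro eventually_amb_proj) (simp add: metric_near_def)
  then show "\<forall>\<^sub>F y in nhds z. transpose (ambm G y) = ambm G y"
  proof eventually_elim
    case (elim y)
    have "ambm G y $ l $ k = ambm G y $ k $ l" for k l
      using elim[symmetric] by (cases k; cases l) (simp_all add: ambient_metric_entries transpose_def vec_eq_iff)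
    then show ?case by (simp add: transpose_def vec_eq_iff)
  qed
qed

text \<open>The table of ambient Christoffel symbols. Constants and \<open>inverse\<close> are kept
  as separate factors, in the shape to which the product rule applies, because the table is
  differentiated again for the curvature.\<close>

definition amb_chr :: "('m cyl \<Rightarrow> real^'m^'m) \<Rightarrow> 'm ambient_index \<Rightarrow> 'm ambient_index \<Rightarrow> 'm ambient_index
    \<Rightarrow> real^('m::finite ambient_index) \<Rightarrow> real" where
  "amb_chr G k i j z = (case k of
     IxT \<Rightarrow> (case i of IxM a \<Rightarrow> (case j of IxM b \<Rightarrow> - (1/2) * (z $ IxT * gdot G a b (amb_proj z)) | _ \<Rightarrow> 0) | _ \<Rightarrow> 0)
   | IxM c \<Rightarrow> (case i of
        IxT \<Rightarrow> (case j of IxM b \<Rightarrow> (if b = c then 1 else 0) * inverse (z $ IxT) | _ \<Rightarrow> 0)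
      | IxM a \<Rightarrow> (case j of IxT \<Rightarrow> (if a = c then 1 else 0) * inverse (z $ IxT)
          | IxM b \<Rightarrow> gam G c a b (amb_proj z) | IxRho \<Rightarrow> shp G c a (amb_proj z))
      | IxRho \<Rightarrow> (case j of IxM b \<Rightarrow> shp G c b (amb_proj z) | _ \<Rightarrow> 0))
   | IxRho \<Rightarrow> (case i of
        IxT \<Rightarrow> (case j of IxRho \<Rightarrow> inverse (z $ IxT) | _ \<Rightarrow> 0)
      | IxM a \<Rightarrow> (case j of IxM b \<Rightarrow> z $ IxRho * gdot G a b (amb_proj z) - G (amb_proj z) $ a $ b | _ \<Rightarrow> 0)
      | IxRho \<Rightarrow> (case j of IxT \<Rightarrow> inverse (z $ IxT) | _ \<Rightarrow> 0)))"

lemma axis_component: "axis i (1::real) $ j = (if j = i then 1 else 0)"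
  by (simp add: axis_def)

lemma dd_coord_sq_times:
  assumes "smooth_near F (amb_proj z)"
  shows "dd v (\<lambda>z. (z $ IxT)\<^sup>2 * F (amb_proj z)) z
    = 2 * v $ IxT * z $ IxT * F (amb_proj z) + (z $ IxT)\<^sup>2 * dd (amb_proj v) F (amb_proj z)"
proof -
  have s: "smooth_near (\<lambda>z. z $ IxT) z" for z :: "real^('a ambient_index)" by auto
  have "dd v (\<lambda>z. (z $ IxT)\<^sup>2) z = 2 * v $ IxT * z $ IxT"
    unfolding power2_eq_square by (simp add: dd_mult[OF s s] dd_coord)
  moreover have "smooth_near (\<lambda>z. (z $ IxT)\<^sup>2) z" by (intro smooth_near_power s)
  ultimately show ?thesis
    using dd_mult[OF _ smooth_near_lift[OF assms]] by (simp add: dd_lift[OF assms])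
qed

lemma christoffel_ambient:
  assumes t: "z $ IxT \<noteq> 0" and G: "metric_near G (amb_proj z)"
  shows "christoffel (ambm G) k i j z = amb_chr G k i j z"
proof -
  have d: "det (G (amb_proj z)) \<noteq> 0" using G by (simp add: metric_near_def)
  note s = smooth_near_fam(1)[OF G]
  have c2: "dd v (\<lambda>z. 2 * z $ i) z = 2 * v $ i" for v :: "real^'a ambient_index" and i
    by (simp add: dd_mult dd_coord smooth_near_nth)
  note D = partial_dd ambient_metric_entries dd_coord_sq_times[OF s] dd_coord c2
  note inv = ambient_metric_inverse(1)[of z G, OF t d]
  note sy = metric_near_symD[OF G] 
  have gs: "gdot G a b (amb_proj z) = gdot G b a (amb_proj z)" for a b
    unfolding gdot_def by (rule metric_near_entry_dd_sym[OF G])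
  have idl: "(\<Sum>l\<in>UNIV. matrix_inv (G (amb_proj z)) $ c $ l * G (amb_proj z) $ l $ b) = (if c = b then 1 else 0)" for c b
    using matrix_inv_entries(2)[OF d] .
  have idl': "(\<Sum>l\<in>UNIV. matrix_inv (G (amb_proj z)) $ c $ l * G (amb_proj z) $ b $ l) = (if c = b then 1 else 0)" for c b
    unfolding sy[of b] by (rule idl)
  have d0: "dd 0 (\<lambda>y. G y $ a $ b) (amb_proj z) = 0" for a b
    using linear_0[OF linear_dd[OF s]] .
  \<comment> \<open>The \<open>t\<close>-derivative of \<open>t^2 G\<close> is \<open>2 t G\<close>;
    contracting with the inverse of \<open>t^2 G\<close> leaves \<open>2 / t\<close> times the
    identity. In \<open>Y\<close> and \<open>Z\<close> the powers of \<open>t\<close>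
    cancel.\<close>
  have X: "(\<Sum>x\<in>UNIV. matrix_inv (G (amb_proj z)) $ c $ x / (z $ IxT)\<^sup>2 * (2 * z $ IxT * G (amb_proj z) $ b $ x))
     = 2 * (if c = b then 1 else 0) / z $ IxT" for b c
    unfolding idl'[symmetric] sum_distrib_left sum_divide_distrib using t
    by (intro sum.cong refl) (simp add: field_simps power2_eq_square)
  have Y: "(\<Sum>x\<in>UNIV. matrix_inv (G (amb_proj z)) $ c $ x / (z $ IxT)\<^sup>2 *
       ((z $ IxT)\<^sup>2 * p x + (z $ IxT)\<^sup>2 * q x - (z $ IxT)\<^sup>2 * r x))
     = (\<Sum>x\<in>UNIV. matrix_inv (G (amb_proj z)) $ c $ x * (p x + q x - r x))" for c p q r
    using t by (intro sum.cong refl) (simp add: field_simps)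
  have Z: "(\<Sum>x\<in>UNIV. matrix_inv (G (amb_proj z)) $ c $ x / (z $ IxT)\<^sup>2 * ((z $ IxT)\<^sup>2 * p x))
     = (\<Sum>x\<in>UNIV. matrix_inv (G (amb_proj z)) $ c $ x * p x)" for c p
    using t by (intro sum.cong refl) (simp add: field_simps)
  show ?thesis
    unfolding christoffel_def sum_ambient inv
    apply (cases k; cases i; cases j)
    using t
    apply (simp_all add: amb_inv_def D amb_chr_def axis_component d0 X Y Z del: times_divide_eq_left)
    apply (simp_all add: gdot_def gam_def shp_def power2_eq_square field_simps)
    done
qed

lemma dd_inverse_coord:
  "z $ i \<noteq> 0 \<Longrightarrow> dd v (\<lambda>z. inverse (z $ i)) (z :: real^'n) = - v $ i / (z $ i)\<^sup>2"
  by (rule dd_eqI[where f' = "\<lambda>v. - v $ i / (z $ i)\<^sup>2"])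
    (auto intro!: derivative_eq_intros bounded_linear_imp_has_derivative bounded_linear_vec_nth simp: power2_eq_square divide_inverse)

lemma smooth_near_coord: "smooth_near (\<lambda>z. z $ i) (z :: real^'n)"
  by auto

lemma partial_christoffel_ambient:
  assumes t: "z $ IxT \<noteq> 0" and G: "metric_near G (amb_proj z)"
  shows "partial w (christoffel (ambm G) k i j) z = dd (axis w 1) (amb_chr G k i j) z"
proof -
  have "\<forall>\<^sub>F z in nhds z. z $ IxT \<noteq> 0"
    using isCont_eventually_ne[OF smooth_near_isCont[OF smooth_near_coord] t] .
  moreover have "\<forall>\<^sub>F z in nhds z. metric_near G (amb_proj z)"
    by (rule eventually_amb_proj[OF metric_near_eventually[OF G]])
  ultimately have "\<forall>\<^sub>F z in nhds z. christoffel (ambm G) k i j z = amb_chr G k i j z"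
    by eventually_elim (rule christoffel_ambient)
  from dd_cong[OF this] show ?thesis by (simp add: partial_dd)
qed

lemma amb_chr_simps:
  "amb_chr G IxT (IxM a) (IxM b) z = - (1/2) * (z $ IxT * gdot G a b (amb_proj z))"
  "amb_chr G (IxM c) IxT (IxM b) z = (if b = c then 1 else 0) * inverse (z $ IxT)"
  "amb_chr G (IxM c) (IxM b) IxT z = (if b = c then 1 else 0) * inverse (z $ IxT)"
  "amb_chr G (IxM c) (IxM a) (IxM b) z = gam G c a b (amb_proj z)"
  "amb_chr G (IxM c) (IxM a) IxRho z = shp G c a (amb_proj z)"
  "amb_chr G (IxM c) IxRho (IxM a) z = shp G c a (amb_proj z)"
  "amb_chr G IxRho IxT IxRho z = inverse (z $ IxT)"
  "amb_chr G IxRho IxRho IxT z = inverse (z $ IxT)"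
  "amb_chr G IxRho (IxM a) (IxM b) z = z $ IxRho * gdot G a b (amb_proj z) - G (amb_proj z) $ a $ b"
  "amb_chr G IxT IxT j z = 0" "amb_chr G IxT IxRho j z = 0"
  "amb_chr G IxT (IxM a) IxT z = 0" "amb_chr G IxT (IxM a) IxRho z = 0"
  "amb_chr G (IxM c) IxT IxT z = 0" "amb_chr G (IxM c) IxT IxRho z = 0"
  "amb_chr G (IxM c) IxRho IxT z = 0" "amb_chr G (IxM c) IxRho IxRho z = 0"
  "amb_chr G IxRho IxT IxT z = 0" "amb_chr G IxRho IxT (IxM a) z = 0"
  "amb_chr G IxRho IxRho IxRho z = 0" "amb_chr G IxRho IxRho (IxM a) z = 0"
  "amb_chr G IxRho (IxM a) IxT z = 0" "amb_chr G IxRho (IxM a) IxRho z = 0"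
  by (simp_all add: amb_chr_def)

lemma dd_amb_chr:
  assumes t: "z $ IxT \<noteq> 0" and G: "metric_near G (amb_proj z)"
  shows
  "dd v (amb_chr G IxT (IxM a) (IxM b)) z
     = - (1/2) * (z $ IxT * dd (amb_proj v) (gdot G a b) (amb_proj z) + v $ IxT * gdot G a b (amb_proj z))" (is ?A1)
  "dd v (amb_chr G (IxM c) IxT (IxM b)) z = (if b = c then 1 else 0) * (- v $ IxT / (z $ IxT)\<^sup>2)" (is ?A2)
  "dd v (amb_chr G (IxM c) (IxM b) IxT) z = (if b = c then 1 else 0) * (- v $ IxT / (z $ IxT)\<^sup>2)" (is ?A3)
  "dd v (amb_chr G (IxM c) (IxM a) (IxM b)) z = dd (amb_proj v) (gam G c a b) (amb_proj z)" (is ?A4)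
  "dd v (amb_chr G (IxM c) (IxM a) IxRho) z = dd (amb_proj v) (shp G c a) (amb_proj z)" (is ?A5)
  "dd v (amb_chr G (IxM c) IxRho (IxM a)) z = dd (amb_proj v) (shp G c a) (amb_proj z)" (is ?A6)
  "dd v (amb_chr G IxRho IxT IxRho) z = - v $ IxT / (z $ IxT)\<^sup>2" (is ?A7)
  "dd v (amb_chr G IxRho IxRho IxT) z = - v $ IxT / (z $ IxT)\<^sup>2" (is ?A8)
  "dd v (amb_chr G IxRho (IxM a) (IxM b)) z
     = z $ IxRho * dd (amb_proj v) (gdot G a b) (amb_proj z) + v $ IxRho * gdot G a b (amb_proj z)
       - dd (amb_proj v) (\<lambda>y. G y $ a $ b) (amb_proj z)" (is ?A9)
  "dd v (amb_chr G IxT IxT j) z = 0" (is ?A10) "dd v (amb_chr G IxT IxRho j) z = 0" (is ?A11)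
  "dd v (amb_chr G IxT (IxM a) IxT) z = 0" (is ?A12) "dd v (amb_chr G IxT (IxM a) IxRho) z = 0" (is ?A13)
  "dd v (amb_chr G (IxM c) IxT IxT) z = 0" (is ?A14) "dd v (amb_chr G (IxM c) IxT IxRho) z = 0" (is ?A15)
  "dd v (amb_chr G (IxM c) IxRho IxT) z = 0" (is ?A16) "dd v (amb_chr G (IxM c) IxRho IxRho) z = 0" (is ?A17)
  "dd v (amb_chr G IxRho IxT IxT) z = 0" (is ?A18) "dd v (amb_chr G IxRho IxT (IxM a)) z = 0" (is ?A19)
  "dd v (amb_chr G IxRho IxRho IxRho) z = 0" (is ?A20) "dd v (amb_chr G IxRho IxRho (IxM a)) z = 0" (is ?A21)
  "dd v (amb_chr G IxRho (IxM a) IxT) z = 0" (is ?A22) "dd v (amb_chr G IxRho (IxM a) IxRho) z = 0" (is ?A23)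
proof -
  note s = smooth_near_fam[OF G]
  note l = s[THEN smooth_near_lift]
  have si: "smooth_near (\<lambda>z. inverse (z $ IxT)) z" by (rule smooth_near_inverse[OF t smooth_near_coord])
  note D = dd_mult[OF smooth_near_coord l(2)] dd_mult[OF smooth_near_const]
     dd_mult[OF smooth_near_const smooth_near_mult[OF smooth_near_coord l(2)]]
     dd_mult[OF smooth_near_const si] dd_diff[OF smooth_near_mult[OF smooth_near_coord l(2)] l(1)]
     dd_coord dd_inverse_coord[OF t] s[THEN dd_lift]
  show ?A1 ?A2 ?A3 ?A4 ?A5 ?A6 ?A7 ?A8 ?A9 ?A10 ?A11 ?A12 ?A13 ?A14 ?A15 ?A16 ?A17 ?A18 ?A19 ?A20 ?A21 ?A22 ?A23
    unfolding amb_chr_simps[abs_def] D by simp_all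
qed

section \<open>Ricci curvature of the ambient metric\<close>

lemma shp_contract:
  assumes "metric_near G y"
  shows "(\<Sum>c\<in>UNIV. G y $ b $ c * shp G c a y) = (1/2) * gdot G a b y"
proof -
  have d: "det (G y) \<noteq> 0" using assms by (simp add: metric_near_def)
  have "(\<Sum>c\<in>UNIV. G y $ b $ c * shp G c a y)
      = (1/2) * (\<Sum>c\<in>UNIV. \<Sum>d\<in>UNIV. G y $ b $ c * matrix_inv (G y) $ c $ d * gdot G a d y)"
    by (simp add: shp_def sum_distrib_left mult_ac)
  also have "\<dots> = (1/2) * (\<Sum>d\<in>UNIV. (\<Sum>c\<in>UNIV. G y $ b $ c * matrix_inv (G y) $ c $ d) * gdot G a d y)"
    by (subst sum.swap) (simp add: sum_distrib_right)
  also have "\<dots> = (1/2) * gdot G a b y"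
    unfolding matrix_inv_entries(1)[OF d] by (simp add: if_distrib[of "\<lambda>x. x * _"] cong: if_cong)
  finally show ?thesis .
qed

text \<open>
  The Fefferman--Graham expression
  \<open>\<rho> g'' - \<rho> g' g\<^sup>-\<^sup>1 g' + \<rho> tr (g\<^sup>-\<^sup>1 g') g' / 2 - (n / 2 - 1) g' - tr (g\<^sup>-\<^sup>1 g') g / 2 + Ric g\<close>.
\<close>

definition fg_op :: "('m cyl \<Rightarrow> real^'m^'m) \<Rightarrow> 'm \<Rightarrow> 'm \<Rightarrow> real \<times> (real^'m::finite) \<Rightarrow> real" where
  "fg_op G a b y = fst y * dd (1, 0) (gdot G a b) y - (real CARD('m) / 2 - 1) * gdot G a b y
     - (\<Sum>c\<in>UNIV. shp G c c y) * G y $ a $ b + fst y * (\<Sum>c\<in>UNIV. shp G c c y) * gdot G a b y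
     - fst y * (\<Sum>c\<in>UNIV. gdot G b c y * shp G c a y + gdot G a c y * shp G c b y) + ricY G a b y"

text \<open>The coefficient \<open>- (n / 2 - 1)\<close> of \<open>g'\<close> collects
  \<open>- 1/2\<close> from the \<open>t\<close>-derivative of the symbol with upper index
  \<open>t\<close>, \<open>- (n + 1) / 2\<close> from its product with the traced symbol, and
  \<open>+ 1/2\<close> from each of four quadratic terms. All powers of \<open>t\<close>
  cancel.\<close>

lemma ricci_ambient_tangential:
  assumes t: "z $ IxT \<noteq> 0" and G: "metric_near G (amb_proj z)"
  shows "ricci (ambm G) z $ IxM a $ IxM b = fg_op G a b (amb_proj z)"
proof -
  define y where "y = amb_proj z"
  note S = shp_contract[OF G, folded y_def]
  have rho: "z $ IxRho = fst y" by (simp add: y_def amb_proj_def)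
  have sy: "gdot G a b y = gdot G b a y" "G y $ a $ b = G y $ b $ a" for a b
    unfolding gdot_def y_def by (rule metric_near_entry_dd_sym[OF G] metric_near_symD[OF G])+
  note D = partial_christoffel_ambient[OF t G] christoffel_ambient[OF t G] dd_amb_chr[OF t G] amb_chr_simps
  have d0: "dd (1, 0) (\<lambda>y. G y $ a $ b) y = gdot G a b y" by (simp add: gdot_def)
  \<comment> \<open>Two of the four halves arise here and in \<open>s2\<close>: the part
    \<open>- g\<close> of the symbol with upper index \<rho>, contracted with \<open>shp\<close>,
    returns \<open>- g' / 2\<close>.\<close>
  have s1: "(\<Sum>c\<in>UNIV. shp G c b y * (fst y * gdot G a c y - G y $ a $ c))
     = fst y * (\<Sum>c\<in>UNIV. gdot G a c y * shp G c b y) - (1/2) * gdot G a b y"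
    using S[of a b] sy(1)[of a b] by (simp add: algebra_simps sum_subtractf sum_distrib_left)
  have s2: "(\<Sum>c\<in>UNIV. (fst y * gdot G b c y - G y $ b $ c) * shp G c a y)
     = fst y * (\<Sum>c\<in>UNIV. gdot G b c y * shp G c a y) - (1/2) * gdot G a b y"
    using S[of b a] by (simp add: algebra_simps sum_subtractf sum_distrib_left)
  have dz: "dd 0 (gdot G a b) y = 0" for a b
    unfolding y_def by (rule linear_0[OF linear_dd[OF smooth_near_fam(2)[OF G]]])
  have T1: "z $ IxT * g * ((if P then 1 else 0) * inverse (z $ IxT)) / 2 = (if P then g / 2 else 0)" for P g
    using t by simp
  have T2: "(if P then 1 else 0) * inverse (z $ IxT) * (z $ IxT * g) / 2 = (if P then g / 2 else 0)" for P g
    using t by simp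
  have T3: "inverse (z $ IxT) * (z $ IxT * g) / 2 = g / 2" for g
    using t by simp
  show ?thesis
    unfolding ricci_def sum_ambient
    apply (simp add: D sum_ambient axis_component rho dz T1 T2 T3 flip: y_def)
    apply (simp add: sum.distrib sum_subtractf sum_negf s1 s2 fg_op_def ricY_def)
    apply (simp add: sum_distrib_left sum_distrib_right sum.distrib sum_subtractf algebra_simps d0)
    using sy(1)[of b a] by simp
qed

lemma gam_sym: "metric_near G y \<Longrightarrow> gam G c a b y = gam G c b a y"
  unfolding gam_def using metric_near_entry_dd_sym[of G y _ a b] by (simp add: add.commute)

text \<open>Naturality transports the full Ricci tensor, so all components of the model must be
  known to vanish. Those along \<open>t\<close> vanish for every family; the other three are
  conditions on \<open>shp\<close> and \<open>gam\<close>.\<close>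

lemma ricci_ambient_other:
  assumes t: "z $ IxT \<noteq> 0" and G: "metric_near G (amb_proj z)"
  shows "ricci (ambm G) z $ IxT $ IxT = 0" (is ?A1)
    "ricci (ambm G) z $ IxT $ IxM a = 0" (is ?A2) "ricci (ambm G) z $ IxM a $ IxT = 0" (is ?A3)
    "ricci (ambm G) z $ IxT $ IxRho = 0" (is ?A4) "ricci (ambm G) z $ IxRho $ IxT = 0" (is ?A5)
    "ricci (ambm G) z $ IxM a $ IxRho
      = (\<Sum>c\<in>UNIV. dd (0, axis c 1) (shp G c a) (amb_proj z) - dd (1, 0) (gam G c a c) (amb_proj z)
          + (\<Sum>d\<in>UNIV. gam G c c d (amb_proj z) * shp G d a (amb_proj z)
            - shp G c d (amb_proj z) * gam G d a c (amb_proj z)))" (is ?A6)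
    "ricci (ambm G) z $ IxRho $ IxM a
      = (\<Sum>c\<in>UNIV. dd (0, axis c 1) (shp G c a) (amb_proj z) - dd (0, axis a 1) (shp G c c) (amb_proj z)
          + (\<Sum>d\<in>UNIV. gam G c c d (amb_proj z) * shp G d a (amb_proj z)
            - gam G c a d (amb_proj z) * shp G d c (amb_proj z)))" (is ?A7)
    "ricci (ambm G) z $ IxRho $ IxRho
      = - (\<Sum>c\<in>UNIV. dd (1, 0) (shp G c c) (amb_proj z)
          + (\<Sum>d\<in>UNIV. shp G c d (amb_proj z) * shp G d c (amb_proj z)))" (is ?A8)
proof -
  define y where "y = amb_proj z"
  have rho: "z $ IxRho = fst y" by (simp add: y_def amb_proj_def)
  note D = partial_christoffel_ambient[OF t G] christoffel_ambient[OF t G] dd_amb_chr[OF t G] amb_chr_simps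
  have dz: "dd 0 (gdot G a b) y = 0" "dd 0 (gam G c a b) y = 0" "dd 0 (shp G c a) y = 0" for a b c
    unfolding y_def by (rule linear_0[OF linear_dd] smooth_near_fam[OF G])+
  have gs: "gam G c a b y = gam G c b a y" for a b c
    unfolding y_def by (rule gam_sym[OF G])
  have T1: "(if P then 1 else 0) * inverse (z $ IxT) = (if P then inverse (z $ IxT) else 0)" for P
    by simp
  show ?A1 ?A2 ?A3 ?A4 ?A5 ?A6 ?A7 ?A8
    unfolding ricci_def sum_ambient
    apply (simp_all add: D sum_ambient axis_component rho dz T1 flip: y_def)
    apply (simp_all add: sum.distrib sum_subtractf sum_negf algebra_simps if_distrib[of "\<lambda>x. x * _"] if_distrib[of "\<lambda>x. _ * x"] cong: if_cong)
    by (simp_all add: power2_eq_square divide_inverse gs[of _ _ a])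
qed

section \<open>Gauge fixing for a conformal change\<close>

lemma smooth_near_fst0: "smooth_near fst y"
  by (rule smooth_near_linear[OF bounded_linear_fst])

lemma fcong_exp: 
  assumes "fcong m f f' x" shows "fcong m (\<lambda>y. exp (f y)) (\<lambda>y. exp (f' y)) x"
proof -
  have "flat m (\<lambda>y. exp (f y) - exp (f' y)) x"
    using assms by (intro flat_compose_diff[where F = exp]) (auto simp: fcong_def)
  then show ?thesis using assms by (auto simp: fcong_def)
qed

lemma fcong_flat: "fcong m f g x \<Longrightarrow> flat m g x \<Longrightarrow> flat m f x"
  using flat_add[of m "\<lambda>y. f y - g y" x g] by (auto simp: fcong_def)

text \<open>A factor \<rho> buys back the order that a \<rho>-derivative costs.\<close>

lemma fcong_rho:
  fixes x :: "'e::euclidean_space"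
  assumes "fcong m F F' (0::real, x)"
  shows "fcong (Suc m) (\<lambda>y. fst y * F y) (\<lambda>y. fst y * F' y) (0, x)"
proof -
  have "flat 1 fst (0::real, x)" using flat_rho_power[of 1 x] by simp
  moreover have "fcong (Suc m) fst fst (0::real, x)" by (rule fcong_refl) (rule smooth_near_fst0)
  ultimately show ?thesis
    using assms by (intro fcong_mult_flat[where k = 1 and j = 0 and l = m and m = "Suc m"]) auto
qed

lemma smooth_near_comp_slice:
  "smooth_near F (0::real, snd y) \<Longrightarrow> smooth_near (\<lambda>y. F (0::real, snd y :: 'e::euclidean_space)) y"
  by (rule smooth_near_compose[OF _ smooth_near_Pair[OF smooth_near_const smooth_near_linear[OF bounded_linear_snd]]])

text \<open>\<open>F y - F (0, snd y)\<close> vanishes at \<rho> = 0 and so supplies the extra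
  order.\<close>

lemma fcong_slice:
  fixes x :: "'e::euclidean_space"
  assumes "smooth_near F (0::real, x)"
  shows "fcong (Suc m) (\<lambda>y. fst y ^ m * F y) (\<lambda>y. fst y ^ m * F (0, snd y)) (0, x)"
proof -
  have s: "smooth_near (\<lambda>y. F (0, snd y)) (0, x)" using assms by (intro smooth_near_comp_slice) simp
  have "flat (m + 1) (\<lambda>y. fst y ^ m * (F y - F (0, snd y))) (0, x)"
    by (rule flat_mult) (use s assms in \<open>auto intro: flat_rho_power smooth_near_rho_power\<close>)
  then show ?thesis
    using s assms by (auto simp: fcong_def algebra_simps intro!: smooth_near_mult smooth_near_rho_power)
qed

lemma dd_tangential_restrict:
  fixes F :: "real \<times> 'e::euclidean_space \<Rightarrow> 'b::real_normed_vector"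
  assumes "smooth_near F (0, x)"
  shows "dd (0, u) F (0, x) = dd u (\<lambda>x. F (0, x)) x"
  using dd_compose[of F "\<lambda>x. (0, x)" x u] dd_linear[of "\<lambda>x. (0::real, x::'e)" u x] assms
  by (simp add: smooth_near_Pair bounded_linear_Pair bounded_linear_zero bounded_linear_ident)

text \<open>The mechanism of both gauge steps and of the indicial operator: a change of order
  \<open>\<rho>^(m+1)\<close> is felt at order \<open>\<rho>^m\<close> through the \<rho>-derivative
  alone.\<close>

lemma fcong_perturb:
  fixes F :: "real \<times> 'e::euclidean_space \<Rightarrow> real" and m :: nat
  assumes F: "smooth_near F (0, x)" and \<gamma>: "smooth_near \<gamma> x"
  defines "F' \<equiv> \<lambda>y. F y + fst y ^ Suc m * \<gamma> (snd y)"
  shows "fcong (Suc m) F' F (0, x)" (is ?A1)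
    "fcong (Suc m) (dd (0, u) F') (dd (0, u) F) (0, x)" (is ?A2)
    "fcong (Suc m) (dd (1, 0) F') (\<lambda>y. dd (1, 0) F y + fst y ^ m * (real (Suc m) * \<gamma> (snd y))) (0, x)" (is ?A3)
proof -
  have g: "smooth_near (\<lambda>y. \<gamma> (snd y)) (0::real, x)" using \<gamma> by (intro smooth_near_comp_snd) simp
  have gu: "smooth_near (\<lambda>y. dd v \<gamma> (snd y)) (0::real, x)" for v
    using smooth_near_dd[OF \<gamma>] by (intro smooth_near_comp_snd) simp
  have fr: "fcong (Suc m) (\<lambda>y. H y + fst y ^ Suc m * h y) H (0, x)" 
    if "smooth_near H (0, x)" "smooth_near h (0, x)" for H h
    using flat_mult_right[OF flat_rho_power[of "Suc m" x] smooth_near_rho_power that(2)] that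
      smooth_near_mult[OF smooth_near_rho_power that(2)]
    by (auto simp: fcong_def simp del: power_Suc)
  show 1: "fcong (Suc m) F' F (0, x)" unfolding F'_def by (rule fr[OF F g])
  have "\<forall>\<^sub>F y in nhds (0::real, x). smooth_near \<gamma> (snd y)"
    by (rule eventually_compose_filterlim[OF smooth_near_eventually[OF \<gamma>]])
      (use smooth_near_isCont[OF smooth_near_linear[OF bounded_linear_snd], of "(0::real, x)"] in
        \<open>simp add: isCont_def tendsto_nhds_iff\<close>)
  then have ev: "\<forall>\<^sub>F y in nhds (0, x). dd v F' y
    = dd v F y + (real (Suc m) * fst v * fst y ^ m * \<gamma> (snd y) + fst y ^ Suc m * dd (snd v) \<gamma> (snd y))" for v
    using smooth_near_eventually[OF F]
  proof eventually_elim
    case (elim y)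
    have "smooth_near (\<lambda>y. fst y ^ Suc m * \<gamma> (snd y)) y"
      by (intro smooth_near_mult smooth_near_rho_power smooth_near_comp_snd elim)
    from dd_add[OF elim(2) this, of v] dd_rho_power_times[OF elim(1), of v m]
    show ?case unfolding F'_def by simp
  qed
  show ?A2
    by (rule fcong_transfer[OF fr[OF smooth_near_dd[OF F] gu[of u]]])
      (use ev[of "(0, u)"] in \<open>auto elim: eventually_mono\<close>)
  have s: "smooth_near (\<lambda>y. dd (1, 0) F y + fst y ^ m * (real (Suc m) * \<gamma> (snd y))) (0, x)"
    by (intro smooth_intros F smooth_near_rho_power g)
  show ?A3
    by (rule fcong_transfer[OF fr[OF s gu[of 0]]])
      (use ev[of "(1, 0)"] in \<open>auto elim!: eventually_mono simp: algebra_simps\<close>)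
qed

text \<open>
  With \<open>q = t\<^sup>2 \<rho>\<close> one has \<open>2 t dt d\<rho> + 2 \<rho> dt\<^sup>2 = 2 (dt / t) dq - 2 q (dt / t)\<^sup>2\<close>.  The substitution
  \<open>t \<mapsto> t exp f\<close>, \<open>\<rho> \<mapsto> \<rho> exp (- 2 f)\<close> fixes \<open>q\<close> and shifts \<open>dt / t\<close> by \<open>df\<close>, hence adds
  \<open>t\<^sup>2 (2 df d\<rho> - 2 \<rho> df\<^sup>2)\<close>.  This is the origin of the form \<open>khat\<close>.
\<close>

definition gphi :: "('m cyl \<Rightarrow> real) \<Rightarrow> ('m cyl \<Rightarrow> real^'m) \<Rightarrow> 'm cyl \<Rightarrow> 'm cyl" where
  "gphi f \<xi> y = (fst y * exp (- 2 * f y), \<xi> y)"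

definition khat :: "('m cyl \<Rightarrow> real^'m^'m) \<Rightarrow> ('m cyl \<Rightarrow> real) \<Rightarrow> ('m cyl \<Rightarrow> real^'m)
    \<Rightarrow> 'm cyl \<Rightarrow> 'm cyl \<Rightarrow> 'm cyl \<Rightarrow> real" where
  "khat G f \<xi> p q y = dd p f y * fst q + dd q f y * fst p - 2 * (fst y * (dd p f y * dd q f y))
     + exp (2 * f y) * (\<Sum>i\<in>UNIV. \<Sum>j\<in>UNIV. G (gphi f \<xi> y) $ i $ j * dd p (\<lambda>y. \<xi> y $ i) y * dd q (\<lambda>y. \<xi> y $ j) y)"

context
  fixes X :: "(real^'m::finite) set" and G :: "'m cyl \<Rightarrow> real^'m^'m" and w :: "real^'m \<Rightarrow> real"
  assumes X: "open X" and G_all: "\<forall>x\<in>X. metric_near G (0, x)" and w_all: "\<forall>x\<in>X. smooth_near w x"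
begin

private lemma G: "x \<in> X \<Longrightarrow> metric_near G (0, x)" and w: "x \<in> X \<Longrightarrow> smooth_near w x"
  using G_all w_all by auto

definition gadm :: "('m cyl \<Rightarrow> real) \<Rightarrow> ('m cyl \<Rightarrow> real^'m) \<Rightarrow> bool" where
  "gadm f \<xi> \<longleftrightarrow> (\<forall>x\<in>X. smooth_near f (0, x) \<and> smooth_near \<xi> (0, x) \<and> f (0, x) = w x \<and> \<xi> (0, x) = x)"

lemma gadmD:
  assumes "gadm f \<xi>" "x \<in> X"
  shows "smooth_near f (0, x)" "smooth_near \<xi> (0, x)" "f (0, x) = w x" "\<xi> (0, x) = x"
    "smooth_near (\<lambda>y. \<xi> y $ i) (0, x)" "gphi f \<xi> (0, x) = (0, x)" "smooth_near (gphi f \<xi>) (0, x)"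
    "smooth_near (\<lambda>y. G (gphi f \<xi> y) $ i $ j) (0, x)"
proof -
  show 1: "smooth_near f (0, x)" "smooth_near \<xi> (0, x)" "f (0, x) = w x" "\<xi> (0, x) = x"
    using assms by (auto simp: gadm_def)
  then show 2: "smooth_near (\<lambda>y. \<xi> y $ i) (0, x)" "gphi f \<xi> (0, x) = (0, x)"
    by (auto simp: gphi_def)
  show 3: "smooth_near (gphi f \<xi>) (0, x)"
    unfolding gphi_def[abs_def]
    by (intro smooth_near_Pair smooth_intros smooth_near_fst0 1)
  show "smooth_near (\<lambda>y. G (gphi f \<xi> y) $ i $ j) (0, x)"
    by (rule smooth_near_compose[OF _ 3]) (simp add: 2 smooth_near_fam(1) G assms)
qed

lemma fcong_G_gphi:
  assumes a: "gadm f \<xi>" "gadm f' \<xi>'" "x \<in> X" and f: "fcong n f f' (0, x)"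
    and \<xi>: "\<And>i. fcong n (\<lambda>y. \<xi> y $ i) (\<lambda>y. \<xi>' y $ i) (0, x)"
  shows "fcong n (\<lambda>y. G (gphi f \<xi> y) $ i $ j) (\<lambda>y. G (gphi f' \<xi>' y) $ i $ j) (0, x)"
proof -
  have e: "fcong n (\<lambda>y. fst y * exp (- 2 * f y)) (\<lambda>y. fst y * exp (- 2 * f' y)) (0, x)"
    by (rule fcong_mult[OF fcong_refl[OF smooth_near_fst0] fcong_exp[OF fcong_mult[OF fcong_const f]]])
  have "flat n (\<lambda>y. G (gphi f \<xi> y) $ i $ j - G (gphi f' \<xi>' y) $ i $ j) (0, x)"
  proof (rule flat_compose_diff[OF gadmD(7)[OF a(1,3)] gadmD(7)[OF a(2,3)]])
    show "smooth_near (\<lambda>y. G y $ i $ j) (gphi f \<xi> (0, x))"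
      by (simp add: gadmD[OF a(1,3)] smooth_near_fam(1) G a)
    show "\<forall>b\<in>Basis. flat n (\<lambda>y. (gphi f \<xi> y - gphi f' \<xi>' y) \<bullet> b) (0, x)"
      using e \<xi> by (auto simp: Basis_prod_def gphi_def Basis_vec_def inner_axis fcong_def)
  qed
  then show ?thesis
    using gadmD(8)[OF a(1,3)] gadmD(8)[OF a(2,3)] by (simp add: fcong_def)
qed

lemma smooth_near_khat:
  assumes "gadm f \<xi>" "x \<in> X" shows "smooth_near (khat G f \<xi> p q) (0, x)"
  unfolding khat_def[abs_def]
  by (intro smooth_intros smooth_near_fst0 gadmD[OF assms])

lemma dd_xi_tangential:
  assumes "gadm f \<xi>" "x \<in> X"
  shows "dd (0, axis u 1) (\<lambda>y. \<xi> y $ j) (0, x) = (if j = u then 1 else 0)"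
proof -
  have "dd (0, axis u 1) (\<lambda>y. \<xi> y $ j) (0, x) = dd (axis u 1) (\<lambda>x. \<xi> (0, x) $ j) x"
    by (rule dd_tangential_restrict) (rule gadmD[OF assms])
  also have "\<dots> = dd (axis u 1) (\<lambda>x. x $ j) x"
    by (rule dd_cong) (rule eventually_nhds_open[OF X assms(2)], simp add: gadmD[OF assms(1)])
  finally show ?thesis by (simp add: dd_coord axis_component)
qed

text \<open>At order \<open>\<rho>\<^sup>N\<close> a change of \<open>\<xi>\<close> shifts the \<open>dx d\<rho>\<close> coefficient by \<open>(N + 1) exp (2 w) g V\<close>; a change of \<open>f\<close> then
  shifts the \<open>d\<rho>\<^sup>2\<close> coefficient by \<open>2 (N + 1) \<gamma>\<close> without disturbing the former.\<close>

lemma gauge_step_V: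
  assumes a: "gadm f \<xi>"
    and A: "\<And>x. x \<in> X \<Longrightarrow> flat N (khat G f \<xi> (1, 0) (1, 0)) (0, x)"
    and B: "\<And>x u. x \<in> X \<Longrightarrow> flat N (khat G f \<xi> (1, 0) (0, axis u 1)) (0, x)"
  shows "\<exists>\<xi>'. gadm f \<xi>' \<and> (\<forall>x\<in>X. flat N (khat G f \<xi>' (1, 0) (1, 0)) (0, x)
      \<and> (\<forall>u. flat (Suc N) (khat G f \<xi>' (1, 0) (0, axis u 1)) (0, x)))"
proof -
  have "\<forall>u. \<exists>\<beta>. (\<forall>x\<in>X. smooth_near \<beta> x) \<and>
     (\<forall>x\<in>X. flat (Suc N) (\<lambda>y. khat G f \<xi> (1, 0) (0, axis u 1) y - fst y ^ N * \<beta> (snd y)) (0, x))"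
    by (intro allI flat_leading_coeff[OF X] smooth_near_khat a B)
  from choice[OF this] obtain \<beta> where "\<forall>u. (\<forall>x\<in>X. smooth_near (\<beta> u) x) \<and>
     (\<forall>x\<in>X. flat (Suc N) (\<lambda>y. khat G f \<xi> (1, 0) (0, axis u 1) y - fst y ^ N * \<beta> u (snd y)) (0, x))" ..
  then have \<beta>: "\<And>u x. x \<in> X \<Longrightarrow> smooth_near (\<beta> u) x"
    "\<And>u x. x \<in> X \<Longrightarrow> flat (Suc N) (\<lambda>y. khat G f \<xi> (1, 0) (0, axis u 1) y - fst y ^ N * \<beta> u (snd y)) (0, x)"
    by (simp_all del: flat.simps)
  \<comment> \<open>Solves \<open>exp (2 w) (N + 1) G V = - \<beta>\<close> on the slice, which
    removes the term of order \<open>\<rho>^N\<close> from the mixed coefficient.\<close>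
  define V where "V = (\<lambda>i x. - (1 / real (Suc N)) * exp (- 2 * w x) * (\<Sum>u\<in>UNIV. matrix_inv (G (0, x)) $ i $ u * \<beta> u x))"
  have sG: "smooth_near (\<lambda>x. G (0, x)) x" if "x \<in> X" for x
    by (rule smooth_near_compose[of G]) (use G[OF that] in \<open>auto simp: metric_near_def intro: smooth_near_Pair\<close>)
  have V: "smooth_near (V i) x" if "x \<in> X" for i x
    unfolding V_def using that G[OF that]
    by (intro smooth_intros w \<beta> smooth_near_nth smooth_near_matrix_inv sG)
      (auto simp: metric_near_def)
  have V_eq: "exp (2 * w x) * (real (Suc N) * (\<Sum>i\<in>UNIV. G (0, x) $ i $ u * V i x)) = - \<beta> u x" if x: "x \<in> X" for x u
  proof -
    have d: "det (G (0, x)) \<noteq> 0" using G[OF x] by (simp add: metric_near_def)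
    have "(\<Sum>i\<in>UNIV. G (0, x) $ i $ u * V i x)
      = - (1 / real (Suc N)) * exp (- 2 * w x) * (\<Sum>i\<in>UNIV. \<Sum>v\<in>UNIV. G (0, x) $ u $ i * matrix_inv (G (0, x)) $ i $ v * \<beta> v x)"
      unfolding metric_near_symD[OF G[OF x], of _ u] by (simp add: V_def sum_distrib_left mult_ac)
    also have "(\<Sum>i\<in>UNIV. \<Sum>v\<in>UNIV. G (0, x) $ u $ i * matrix_inv (G (0, x)) $ i $ v * \<beta> v x)
      = (\<Sum>v\<in>UNIV. (\<Sum>i\<in>UNIV. G (0, x) $ u $ i * matrix_inv (G (0, x)) $ i $ v) * \<beta> v x)"
      by (subst sum.swap) (simp add: sum_distrib_right)
    also have "\<dots> = \<beta> u x"
      unfolding matrix_inv_entries(1)[OF d] by (simp add: if_distrib[of "\<lambda>x. x * _"] cong: if_cong)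
    finally have "exp (2 * w x) * (real (Suc N) * (\<Sum>i\<in>UNIV. G (0, x) $ i $ u * V i x))
      = - (real (Suc N) / real (Suc N)) * (exp (2 * w x) * exp (- 2 * w x)) * \<beta> u x"
      by (simp only: mult_ac) simp
    then show ?thesis by (simp flip: exp_add)
  qed
  define \<xi>' where "\<xi>' = (\<lambda>y. \<xi> y + fst y ^ Suc N *\<^sub>R (\<chi> i. V i (snd y)))"
  have \<xi>'c: "(\<lambda>y. \<xi>' y $ i) = (\<lambda>y. \<xi> y $ i + fst y ^ Suc N * V i (snd y))" for i
    by (simp add: \<xi>'_def)
  have a': "gadm f \<xi>'"
    unfolding gadm_def
  proof (intro ballI conjI)
    fix x assume x: "x \<in> X"
    show "smooth_near f (0, x)" "f (0, x) = w x" by (rule gadmD[OF a x])+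
    show "\<xi>' (0, x) = x" by (simp add: \<xi>'_def gadmD[OF a x])
    show "smooth_near \<xi>' (0, x)"
      unfolding smooth_near_vec_iff \<xi>'c
      by (intro allI smooth_intros smooth_near_rho_power gadmD[OF a x] smooth_near_comp_snd) (simp add: V x)
  qed
  have "flat N (khat G f \<xi>' (1, 0) (1, 0)) (0, x) \<and> flat (Suc N) (khat G f \<xi>' (1, 0) (0, axis u 1)) (0, x)"
    if x: "x \<in> X" for x u
  proof -
    have P: "fcong (Suc N) (\<lambda>y. \<xi>' y $ i) (\<lambda>y. \<xi> y $ i) (0, x)"
      "fcong (Suc N) (dd (0, v) (\<lambda>y. \<xi>' y $ i)) (dd (0, v) (\<lambda>y. \<xi> y $ i)) (0, x)"
      "fcong (Suc N) (dd (1, 0) (\<lambda>y. \<xi>' y $ i))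
         (\<lambda>y. dd (1, 0) (\<lambda>y. \<xi> y $ i) y + fst y ^ N * (real (Suc N) * V i (snd y))) (0, x)" for i v
      unfolding \<xi>'c by (rule fcong_perturb[OF gadmD(5)[OF a x] V[OF x]])+
    note Gc = fcong_G_gphi[OF a' a x fcong_refl[OF gadmD(1)[OF a x]] P(1)]
    \<comment> \<open>The \<open>d\<rho>^2\<close> coefficient contains \<rho>-derivatives of
      \<open>\<xi>\<close>, so it is preserved here to order \<open>N\<close>; its term of order
      \<open>\<rho>^N\<close> is left to the change of \<open>f\<close>.\<close>
    have "fcong N (khat G f \<xi>' (1, 0) (1, 0)) (khat G f \<xi> (1, 0) (1, 0)) (0, x)"
      unfolding khat_def[abs_def]
      by (intro fcong_add fcong_diff fcong_mult fcong_sum fcong_exp fcong_mono[OF Gc] fcong_dd[OF P(1)])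
        (auto intro!: fcong_refl smooth_near_dd smooth_near_fst0 gadmD[OF a x])
    then have 1: "flat N (khat G f \<xi>' (1, 0) (1, 0)) (0, x)"
      using fcong_flat A[OF x] by blast
    let ?F = "\<lambda>y. exp (2 * f y) * (\<Sum>i\<in>UNIV. \<Sum>j\<in>UNIV. G (gphi f \<xi> y) $ i $ j * (real (Suc N) * V i (snd y)) * dd (0, axis u 1) (\<lambda>y. \<xi> y $ j) y)"
    have sV: "smooth_near (\<lambda>y. V i (snd y)) (0::real, x)" for i
      using V[OF x] by (intro smooth_near_comp_snd) simp
    have sF: "smooth_near ?F (0, x)"
      by (intro smooth_intros gadmD[OF a x] sV)
    have "fcong (Suc N) (khat G f \<xi>' (1, 0) (0, axis u 1)) (\<lambda>y. dd (1, 0) f y * 0 + dd (0, axis u 1) f y * 1 - 2 * (fst y * (dd (1, 0) f y * dd (0, axis u 1) f y))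
      + exp (2 * f y) * (\<Sum>i\<in>UNIV. \<Sum>j\<in>UNIV. G (gphi f \<xi> y) $ i $ j * (dd (1, 0) (\<lambda>y. \<xi> y $ i) y + fst y ^ N * (real (Suc N) * V i (snd y))) * dd (0, axis u 1) (\<lambda>y. \<xi> y $ j) y)) (0, x)"
      unfolding khat_def[abs_def] fst_conv
      by (intro fcong_add fcong_diff fcong_mult fcong_sum fcong_exp Gc P)
        (auto intro!: fcong_refl smooth_near_dd smooth_near_fst0 gadmD[OF a x])
    moreover have "(\<lambda>y. dd (1, 0) f y * 0 + dd (0, axis u 1) f y * 1 - 2 * (fst y * (dd (1, 0) f y * dd (0, axis u 1) f y))
      + exp (2 * f y) * (\<Sum>i\<in>UNIV. \<Sum>j\<in>UNIV. G (gphi f \<xi> y) $ i $ j * (dd (1, 0) (\<lambda>y. \<xi> y $ i) y + fst y ^ N * (real (Suc N) * V i (snd y))) * dd (0, axis u 1) (\<lambda>y. \<xi> y $ j) y))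
      = (\<lambda>y. khat G f \<xi> (1, 0) (0, axis u 1) y + fst y ^ N * ?F y)"
      by (simp add: fun_eq_iff khat_def algebra_simps sum.distrib sum_distrib_left)
    ultimately have 2: "fcong (Suc N) (khat G f \<xi>' (1, 0) (0, axis u 1)) (\<lambda>y. khat G f \<xi> (1, 0) (0, axis u 1) y + fst y ^ N * ?F y) (0, x)"
      by simp
    have 3: "fcong (Suc N) (\<lambda>y. khat G f \<xi> (1, 0) (0, axis u 1) y + fst y ^ N * ?F y)
        (\<lambda>y. khat G f \<xi> (1, 0) (0, axis u 1) y + fst y ^ N * ?F (0, snd y)) (0, x)"
      using fcong_slice[OF sF, of N] by (intro fcong_add fcong_refl smooth_near_khat[OF a x])
    \<comment> \<open>On the slice \<open>\<xi>\<close> is the identity, so the sum over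
      \<open>j\<close> collapses to \<open>j = u\<close>.\<close>
    have F0: "?F (0, z) = - \<beta> u z" if "z \<in> X" for z
    proof -
      have "?F (0, z) = exp (2 * w z) * (real (Suc N) * (\<Sum>i\<in>UNIV. G (0, z) $ i $ u * V i z))"
        by (simp add: gadmD[OF a that] dd_xi_tangential[OF a that] sum_distrib_left mult_ac
            if_distrib[of "\<lambda>x. x * _"] if_distrib[of "\<lambda>x. _ * x"] cong: if_cong)
      then show ?thesis using V_eq[OF that] by simp
    qed
    have evX: "\<forall>\<^sub>F y in nhds (0::real, x). snd y \<in> X"
      by (rule eventually_snd_mem[OF X x])
    have "flat (Suc N) (\<lambda>y. khat G f \<xi> (1, 0) (0, axis u 1) y + fst y ^ N * ?F (0, snd y)) (0, x)"
    proof (rule flat_transfer[OF \<beta>(2)[OF x, of u]], rule eventually_mono[OF evX])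
      fix y :: "'m cyl" assume "snd y \<in> X"
      from F0[OF this]
      show "khat G f \<xi> (1, 0) (0, axis u 1) y - fst y ^ N * \<beta> u (snd y)
        = khat G f \<xi> (1, 0) (0, axis u 1) y + fst y ^ N * ?F (0, snd y)"
        by simp
    qed
    then have "flat (Suc N) (khat G f \<xi>' (1, 0) (0, axis u 1)) (0, x)"
      using fcong_flat fcong_trans[OF 2 3] by blast
    with 1 show ?thesis by simp
  qed
  with a' show ?thesis by blast
qed

lemma gauge_step_f:
  assumes a: "gadm f \<xi>"
    and A: "\<And>x. x \<in> X \<Longrightarrow> flat N (khat G f \<xi> (1, 0) (1, 0)) (0, x)"
    and B: "\<And>x u. x \<in> X \<Longrightarrow> flat (Suc N) (khat G f \<xi> (1, 0) (0, axis u 1)) (0, x)"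
  shows "\<exists>f'. gadm f' \<xi> \<and> (\<forall>x\<in>X. flat (Suc N) (khat G f' \<xi> (1, 0) (1, 0)) (0, x)
      \<and> (\<forall>u. flat (Suc N) (khat G f' \<xi> (1, 0) (0, axis u 1)) (0, x)))"
proof -
  have "\<exists>\<alpha>. (\<forall>x\<in>X. smooth_near \<alpha> x) \<and>
     (\<forall>x\<in>X. flat (Suc N) (\<lambda>y. khat G f \<xi> (1, 0) (1, 0) y - fst y ^ N * \<alpha> (snd y)) (0, x))"
    by (intro flat_leading_coeff[OF X] smooth_near_khat a A)
  then obtain \<alpha> where \<alpha>: "\<And>x. x \<in> X \<Longrightarrow> smooth_near \<alpha> x"
    "\<And>x. x \<in> X \<Longrightarrow> flat (Suc N) (\<lambda>y. khat G f \<xi> (1, 0) (1, 0) y - fst y ^ N * \<alpha> (snd y)) (0, x)"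
    by blast
  \<comment> \<open>The \<rho>-derivative of \<open>f\<close> enters the \<open>d\<rho>^2\<close>
    coefficient twice, so the equation to solve is
    \<open>2 (N + 1) \<gamma> = - \<alpha>\<close>.\<close>
  define \<gamma> where "\<gamma> = (\<lambda>x. - (1 / (2 * real (Suc N))) * \<alpha> x)"
  have \<gamma>: "smooth_near \<gamma> x" if "x \<in> X" for x
    unfolding \<gamma>_def using that by (intro smooth_intros \<alpha>)
  define f' where "f' = (\<lambda>y. f y + fst y ^ Suc N * \<gamma> (snd y))"
  have a': "gadm f' \<xi>"
    unfolding gadm_def
  proof (intro ballI conjI)
    fix x assume x: "x \<in> X"
    show "smooth_near \<xi> (0, x)" "\<xi> (0, x) = x" by (rule gadmD[OF a x])+
    show "f' (0, x) = w x" by (simp add: f'_def gadmD[OF a x])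
    show "smooth_near f' (0, x)"
      unfolding f'_def
      by (intro smooth_intros smooth_near_rho_power gadmD[OF a x] smooth_near_comp_snd) (simp add: \<gamma> x)
  qed
  have "flat (Suc N) (khat G f' \<xi> (1, 0) (1, 0)) (0, x) \<and> flat (Suc N) (khat G f' \<xi> (1, 0) (0, axis u 1)) (0, x)"
    if x: "x \<in> X" for x u
  proof -
    note P = fcong_perturb[OF gadmD(1)[OF a x] \<gamma>[OF x], of N, folded f'_def]
    note Gc = fcong_G_gphi[OF a' a x P(1) fcong_refl[OF gadmD(5)[OF a x]]]
    have "fcong (Suc N) (khat G f' \<xi> (1, 0) (0, axis u 1)) (\<lambda>y. dd (1, 0) f y * 0 + dd (0, axis u 1) f y * 1 - 2 * (fst y * (dd (1, 0) f y * dd (0, axis u 1) f y))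
      + exp (2 * f y) * (\<Sum>i\<in>UNIV. \<Sum>j\<in>UNIV. G (gphi f \<xi> y) $ i $ j * dd (1, 0) (\<lambda>y. \<xi> y $ i) y * dd (0, axis u 1) (\<lambda>y. \<xi> y $ j) y)) (0, x)"
    proof -
      \<comment> \<open>In the mixed coefficient the \<rho>-derivative of \<open>f\<close> occurs
        only with the factor \<open>fst q = 0\<close> or with a factor \<rho>, so its change of
        order \<open>\<rho>^N\<close> is invisible modulo \<open>\<rho>^(N+1)\<close>.\<close>
      have z: "fcong (Suc N) (\<lambda>y. dd (1, 0) f' y * 0) (\<lambda>y. dd (1, 0) f y * 0) (0, x)" by (simp add: fcong_const)
      show ?thesis
        unfolding khat_def[abs_def] fst_conv
        by (intro fcong_add fcong_diff z fcong_rho fcong_mult[OF fcong_const] fcong_mult[OF fcong_exp] fcong_mult[OF P(2)]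
            fcong_mult[OF fcong_dd[OF P(1)] fcong_mono[OF P(2)]] fcong_mult[OF fcong_mult[OF Gc]] fcong_sum P Gc)
          (auto intro!: fcong_refl smooth_near_dd smooth_near_fst0 gadmD[OF a x])
    qed
    then have "fcong (Suc N) (khat G f' \<xi> (1, 0) (0, axis u 1)) (khat G f \<xi> (1, 0) (0, axis u 1)) (0, x)"
      by (simp add: khat_def[abs_def])
    then have 1: "flat (Suc N) (khat G f' \<xi> (1, 0) (0, axis u 1)) (0, x)"
      using fcong_flat B[OF x] by blast
    have sg: "smooth_near (\<lambda>y. \<gamma> (snd y)) (0::real, x)" using \<gamma>[OF x] by (intro smooth_near_comp_snd) simp
    have "fcong (Suc N) (khat G f' \<xi> (1, 0) (1, 0)) (\<lambda>y. (dd (1, 0) f y + fst y ^ N * (real (Suc N) * \<gamma> (snd y))) * 1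
        + (dd (1, 0) f y + fst y ^ N * (real (Suc N) * \<gamma> (snd y))) * 1 - 2 * (fst y * (dd (1, 0) f y * dd (1, 0) f y))
      + exp (2 * f y) * (\<Sum>i\<in>UNIV. \<Sum>j\<in>UNIV. G (gphi f \<xi> y) $ i $ j * dd (1, 0) (\<lambda>y. \<xi> y $ i) y * dd (1, 0) (\<lambda>y. \<xi> y $ j) y)) (0, x)"
      unfolding khat_def[abs_def] fst_conv
      by (intro fcong_add fcong_diff fcong_rho fcong_mult[OF fcong_const] fcong_mult[OF fcong_exp] fcong_mult[OF P(3)]
          fcong_mult[OF fcong_dd[OF P(1)] fcong_dd[OF P(1)]] fcong_mult[OF fcong_mult[OF Gc]] fcong_sum P Gc)
        (auto intro!: fcong_refl smooth_near_dd smooth_near_fst0 gadmD[OF a x])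
    moreover have "(\<lambda>y. (dd (1, 0) f y + fst y ^ N * (real (Suc N) * \<gamma> (snd y))) * 1
        + (dd (1, 0) f y + fst y ^ N * (real (Suc N) * \<gamma> (snd y))) * 1 - 2 * (fst y * (dd (1, 0) f y * dd (1, 0) f y))
      + exp (2 * f y) * (\<Sum>i\<in>UNIV. \<Sum>j\<in>UNIV. G (gphi f \<xi> y) $ i $ j * dd (1, 0) (\<lambda>y. \<xi> y $ i) y * dd (1, 0) (\<lambda>y. \<xi> y $ j) y))
      = (\<lambda>y. khat G f \<xi> (1, 0) (1, 0) y - fst y ^ N * \<alpha> (snd y))"
    proof -
      have "(1 + real N) * \<gamma> z = - \<alpha> z / 2" for z
        by (simp add: \<gamma>_def field_simps)
      then show ?thesis by (simp add: fun_eq_iff khat_def)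
    qed
    ultimately have "fcong (Suc N) (khat G f' \<xi> (1, 0) (1, 0)) (\<lambda>y. khat G f \<xi> (1, 0) (1, 0) y - fst y ^ N * \<alpha> (snd y)) (0, x)"
      by simp
    from fcong_flat[OF this \<alpha>(2)[OF x]] have "flat (Suc N) (khat G f' \<xi> (1, 0) (1, 0)) (0, x)" .
    with 1 show ?thesis by simp
  qed
  with a' show ?thesis by blast
qed

lemma gauge_exists:
  "\<exists>f \<xi>. gadm f \<xi> \<and> (\<forall>x\<in>X. flat N (khat G f \<xi> (1, 0) (1, 0)) (0, x)
      \<and> (\<forall>u. flat N (khat G f \<xi> (1, 0) (0, axis u 1)) (0, x)))"
proof (induction N)
  case 0
  \<comment> \<open>Order 0 imposes nothing beyond the initial values, so their \<rho>-independent
    extension serves.\<close>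
  have "gadm (\<lambda>y. w (snd y)) snd"
    unfolding gadm_def using w
    by (intro ballI conjI smooth_near_linear[OF bounded_linear_snd]; (rule smooth_near_comp_snd)?) simp_all
  then show ?case by (auto simp del: split_paired_Ex)
next
  case (Suc N)
  then obtain f \<xi> where a: "gadm f \<xi>"
    and A: "\<And>x. x \<in> X \<Longrightarrow> flat N (khat G f \<xi> (1, 0) (1, 0)) (0, x)"
    and B: "\<And>x u. x \<in> X \<Longrightarrow> flat N (khat G f \<xi> (1, 0) (0, axis u 1)) (0, x)"
    by blast
  from gauge_step_V[OF this] obtain \<xi>' where a': "gadm f \<xi>'"
    and A': "\<And>x. x \<in> X \<Longrightarrow> flat N (khat G f \<xi>' (1, 0) (1, 0)) (0, x)"
    and B': "\<And>x u. x \<in> X \<Longrightarrow> flat (Suc N) (khat G f \<xi>' (1, 0) (0, axis u 1)) (0, x)"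
    by blast
  from gauge_step_f[OF this] show ?case by blast
qed

end

section \<open>Pullback of the ambient metric under the gauge map\<close>

definition gmap :: "('m cyl \<Rightarrow> real) \<Rightarrow> ('m cyl \<Rightarrow> real^'m) \<Rightarrow> real^('m::finite ambient_index) \<Rightarrow> real^('m ambient_index)" where
  "gmap f \<xi> z = (\<chi> k. case k of IxT \<Rightarrow> z $ IxT * exp (f (amb_proj z))
     | IxRho \<Rightarrow> z $ IxRho * exp (- 2 * f (amb_proj z)) | IxM a \<Rightarrow> \<xi> (amb_proj z) $ a)"

lemma gmap_nth:
  "gmap f \<xi> z $ IxT = z $ IxT * exp (f (amb_proj z))"
  "gmap f \<xi> z $ IxRho = z $ IxRho * exp (- 2 * f (amb_proj z))"
  "gmap f \<xi> z $ IxM a = \<xi> (amb_proj z) $ a"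
  by (simp_all add: gmap_def)

lemma amb_proj_gmap: "amb_proj (gmap f \<xi> z) = gphi f \<xi> (amb_proj z)"
  by (simp add: amb_proj_def gmap_def gphi_def)

lemma smooth_near_gmap:
  assumes "smooth_near f (amb_proj z)" "smooth_near \<xi> (amb_proj z)"
  shows "smooth_near (gmap f \<xi>) z"
proof -
  note l = smooth_near_lift[OF assms(1)] 
  have x: "smooth_near (\<lambda>z. \<xi> (amb_proj z) $ a) z" for a
    by (rule smooth_near_nth[OF smooth_near_lift[OF assms(2)]])
  have "smooth_near (\<lambda>z. gmap f \<xi> z $ k) z" for k
    by (cases k; simp only: gmap_nth)
      (intro smooth_intros smooth_near_coord l x)+
  then show ?thesis unfolding smooth_near_vec_iff by blast
qed

lemma dd_gmap:
  assumes f: "smooth_near f (amb_proj z)" and \<xi>: "smooth_near \<xi> (amb_proj z)"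
  shows "dd u (gmap f \<xi>) z $ IxT = exp (f (amb_proj z)) * (u $ IxT + z $ IxT * dd (amb_proj u) f (amb_proj z))" (is ?A1)
    "dd u (gmap f \<xi>) z $ IxRho = exp (- 2 * f (amb_proj z)) * (u $ IxRho - 2 * z $ IxRho * dd (amb_proj u) f (amb_proj z))" (is ?A2)
    "dd u (gmap f \<xi>) z $ IxM a = dd (amb_proj u) (\<lambda>y. \<xi> y $ a) (amb_proj z)" (is ?A3)
proof -
  note l = smooth_near_lift[OF f]
  have l2: "smooth_near (\<lambda>z. - 2 * f (amb_proj z)) z" by (intro smooth_intros l)
  note e = smooth_near_exp[OF l] smooth_near_exp[OF l2]
  have n: "dd u (gmap f \<xi>) z $ k = dd u (\<lambda>z. gmap f \<xi> z $ k) z" for k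
    using dd_nth[OF smooth_near_gmap[OF f \<xi>]] by simp
  have d2: "dd u (\<lambda>z. - 2 * f (amb_proj z)) z = - 2 * dd (amb_proj u) f (amb_proj z)"
    using dd_mult[OF smooth_near_const l, of u "- 2"] by (simp add: dd_lift[OF f])
  show ?A1
    unfolding n gmap_nth dd_mult[OF smooth_near_coord e(1)] dd_exp[OF l] dd_lift[OF f] dd_coord
    by (simp add: algebra_simps)
  show ?A2
    unfolding n gmap_nth dd_mult[OF smooth_near_coord e(2)] dd_exp[OF l2] d2 dd_coord
    by (simp add: algebra_simps)
  show ?A3
    unfolding n gmap_nth by (rule dd_lift[OF smooth_near_nth[OF \<xi>]])
qed

lemma gform_ambm:
  "gform (ambm G z) u v = 2 * z $ IxRho * u $ IxT * v $ IxT + z $ IxT * (u $ IxT * v $ IxRho + u $ IxRho * v $ IxT)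
    + (z $ IxT)\<^sup>2 * (\<Sum>a\<in>UNIV. \<Sum>b\<in>UNIV. G (amb_proj z) $ a $ b * u $ IxM a * v $ IxM b)"
  by (simp add: gform_sum sum_ambient ambient_metric_entries sum_distrib_left algebra_simps)

text \<open>The pulled back ambient metric: the terms with \<open>dt\<close> keep their shape and
  everything else is \<open>t^2 khat\<close>, including the unwanted \<open>dx d\<rho>\<close> and
  \<open>d\<rho>^2\<close> parts.\<close>

definition hform :: "('m cyl \<Rightarrow> real^'m^'m) \<Rightarrow> ('m cyl \<Rightarrow> real) \<Rightarrow> ('m cyl \<Rightarrow> real^'m)
    \<Rightarrow> real^('m::finite ambient_index) \<Rightarrow> real^('m ambient_index) \<Rightarrow> real^('m ambient_index) \<Rightarrow> real" where
  "hform G f \<xi> z u v = 2 * z $ IxRho * u $ IxT * v $ IxT + z $ IxT * (u $ IxT * v $ IxRho + u $ IxRho * v $ IxT)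
    + (z $ IxT)\<^sup>2 * khat G f \<xi> (amb_proj u) (amb_proj v) (amb_proj z)"

lemma gform_gmap:
  assumes f: "smooth_near f (amb_proj z)" and \<xi>: "smooth_near \<xi> (amb_proj z)"
  shows "gform (ambm G (gmap f \<xi> z)) (dd u (gmap f \<xi>) z) (dd v (gmap f \<xi>) z) = hform G f \<xi> z u v"
proof -
  \<comment> \<open>Writing all exponentials as powers of \<open>E\<close> reduces the identity to
    rational algebra.\<close>
  define E where "E = exp (f (amb_proj z))"
  have E: "E > 0" "exp (- 2 * f (amb_proj z)) = 1 / E\<^sup>2" "exp (2 * f (amb_proj z)) = E\<^sup>2"
    by (simp_all add: E_def exp_minus power2_eq_square divide_inverse flip: exp_add)
  have fp: "fst (amb_proj w) = w $ IxRho" for w :: "real^'a ambient_index" by (simp add: amb_proj_def)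
  show ?thesis
    unfolding gform_ambm hform_def khat_def dd_gmap[OF f \<xi>] gmap_nth amb_proj_gmap fp
    unfolding E_def[symmetric] E
    using E(1) by (simp add: field_simps power2_eq_square)
qed

lemma det_scaleR_nonzero:
  fixes A :: "real^'n^'n"
  assumes "det A \<noteq> 0" "c \<noteq> 0" shows "det (c *\<^sub>R A) \<noteq> 0"
proof (rule matrix_inv_unique(2))
  have "(c *\<^sub>R A) ** ((1 / c) *\<^sub>R matrix_inv A) = A ** matrix_inv A"
    using assms(2) by (simp add: matrix_matrix_mult_def vec_eq_iff)
  then show "(c *\<^sub>R A) ** ((1 / c) *\<^sub>R matrix_inv A) = mat 1"
    using matrix_inv_inverse(1)[of A] assms(1) by (simp add: invertible_det_nz)
qed

lemma gform_bilinear: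
  fixes h :: "real^'n \<Rightarrow> real^'n \<Rightarrow> real"
  assumes "\<And>v. linear (\<lambda>u. h u v)" "\<And>u. linear (h u)"
  shows "gform (\<chi> k l. h (axis k 1) (axis l 1)) u v = h u v"
proof -
  have e: "(\<Sum>k\<in>UNIV. x $ k *\<^sub>R axis k 1) = x" for x :: "real^'n"
    using basis_expansion[of x] by (simp add: scalar_mult_eq_scaleR)
  have "h u v = (\<Sum>k\<in>UNIV. u $ k * h (axis k 1) v)"
    using linear_sum[OF assms(1)[of v], of "\<lambda>k. u $ k *\<^sub>R axis k 1" UNIV] linear_cmul[OF assms(1)] by (simp add: e)
  moreover have "h x v = (\<Sum>l\<in>UNIV. v $ l * h x (axis l 1))" for x
    using linear_sum[OF assms(2)[of x], of "\<lambda>k. v $ k *\<^sub>R axis k 1" UNIV] linear_cmul[OF assms(2)] by (simp add: e)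
  ultimately show ?thesis by (simp add: gform_sum sum_distrib_left mult_ac)
qed

lemma khat_linear:
  assumes f: "smooth_near f y" and \<xi>: "smooth_near \<xi> y"
  shows "linear (\<lambda>p. khat G f \<xi> p q y)" (is ?A1) "linear (\<lambda>q. khat G f \<xi> p q y)" (is ?A2)
proof -
  note s = linear_add[OF linear_dd[OF f]] linear_cmul[OF linear_dd[OF f]]
    linear_add[OF linear_dd[OF smooth_near_nth[OF \<xi>]]] linear_cmul[OF linear_dd[OF smooth_near_nth[OF \<xi>]]]
  show ?A1 ?A2
    by - (rule linearI; simp only: khat_def s fst_add fst_scaleR; simp add: algebra_simps sum.distrib sum_distrib_left)+
qed

lemma hform_linear:
  assumes f: "smooth_near f (amb_proj z)" and \<xi>: "smooth_near \<xi> (amb_proj z)"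
  shows "linear (\<lambda>u. hform G f \<xi> z u v)" (is ?A1) "linear (hform G f \<xi> z u)" (is ?A2)
proof -
  note a = bounded_linear.linear[OF bounded_linear_amb_proj]
  note k = khat_linear[OF f \<xi>, of G]
  show ?A1 ?A2
    by - (rule linearI; simp add: hform_def linear_add[OF a] linear_cmul[OF a] linear_add[OF k(1)]
        linear_cmul[OF k(1)] linear_add[OF k(2)] linear_cmul[OF k(2)] algebra_simps)+
qed

definition hmat where "hmat G f \<xi> z = (\<chi> k l. hform G f \<xi> z (axis k 1) (axis l 1))"

text \<open>The candidate for the normal form family: \<open>khat\<close> with its d\<rho>
  components dropped.\<close>

definition ghat :: "('m cyl \<Rightarrow> real^'m^'m) \<Rightarrow> ('m cyl \<Rightarrow> real) \<Rightarrow> ('m cyl \<Rightarrow> real^'m)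
    \<Rightarrow> 'm cyl \<Rightarrow> real^'m^'m::finite" where
  "ghat G f \<xi> y = (\<chi> a b. khat G f \<xi> (0, axis a 1) (0, axis b 1) y)"

lemma ghat_nth: "ghat G f \<xi> y $ a $ b = khat G f \<xi> (0, axis a 1) (0, axis b 1) y"
  by (simp add: ghat_def)

lemma khat_sym: "transpose (G (gphi f \<xi> y)) = G (gphi f \<xi> y) \<Longrightarrow> khat G f \<xi> p q y = khat G f \<xi> q p y"
proof -
  assume "transpose (G (gphi f \<xi> y)) = G (gphi f \<xi> y)"
  then have s: "G (gphi f \<xi> y) $ i $ j = G (gphi f \<xi> y) $ j $ i" for i j
    by (simp add: transpose_def vec_eq_iff)
  have "(\<Sum>i\<in>UNIV. \<Sum>j\<in>UNIV. G (gphi f \<xi> y) $ i $ j * dd p (\<lambda>y. \<xi> y $ i) y * dd q (\<lambda>y. \<xi> y $ j) y)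
    = (\<Sum>i\<in>UNIV. \<Sum>j\<in>UNIV. G (gphi f \<xi> y) $ i $ j * dd q (\<lambda>y. \<xi> y $ i) y * dd p (\<lambda>y. \<xi> y $ j) y)"
    by (subst sum.swap, subst s) (simp add: mult_ac)
  then show ?thesis by (simp add: khat_def algebra_simps)
qed

text \<open>The slice \<open>t = 1\<close>, a right inverse of \<open>amb_proj\<close>, along which
  jets on the ambient space are brought back to \<open>(\<rho>, x)\<close>.\<close>

definition amb_section :: "'m cyl \<Rightarrow> real^('m::finite ambient_index)" where
  "amb_section y = (\<chi> k. case k of IxT \<Rightarrow> 1 | IxRho \<Rightarrow> fst y | IxM a \<Rightarrow> snd y $ a)"

lemma amb_section: "amb_section y $ IxT = 1" "amb_proj (amb_section y) = y"
  by (simp_all add: amb_section_def amb_proj_def prod_eq_iff vec_eq_iff)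

lemma smooth_near_amb_section: "smooth_near amb_section y"
proof -
  have "smooth_near (\<lambda>y. amb_section y $ k) y" for k
    by (cases k) (simp_all add: amb_section_def smooth_near_fst0 smooth_near_nth[OF smooth_near_linear[OF bounded_linear_snd]])
  then show ?thesis unfolding smooth_near_vec_iff by blast
qed

section \<open>The normal form family of the conformal metric\<close>

context
  fixes X :: "(real^'m::finite) set" and G :: "'m cyl \<Rightarrow> real^'m^'m" and w :: "real^'m \<Rightarrow> real"
  assumes X: "open X" and G_all: "\<forall>x\<in>X. metric_near G (0, x)" and w_all: "\<forall>x\<in>X. smooth_near w x"
    and RF: "\<forall>x\<in>X. \<forall>\<^sub>F y in nhds (0, x). \<forall>z. amb_proj z = y \<longrightarrow> z $ IxT \<noteq> 0 \<longrightarrow> ricci (ambm G) z = 0"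
begin

private lemma G_near: "x \<in> X \<Longrightarrow> metric_near G (0, x)" and w_near: "x \<in> X \<Longrightarrow> smooth_near w x"
  using G_all w_all by auto

private lemmas gD = gadmD[OF X G_all w_all]

text \<open>Tangential arguments kill the \<open>df d\<rho>\<close> terms and \<rho> = 0 kills the
  \<open>df^2\<close> term of \<open>khat\<close>; what survives is \<open>exp (2 f)\<close> times
  \<open>G\<close>, with \<open>f = w\<close> and \<open>\<xi>\<close> the identity.\<close>

lemma ghat_initial:
  assumes a: "gadm X w f \<xi>" and x: "x \<in> X"
  shows "ghat G f \<xi> (0, x) = exp (2 * w x) *\<^sub>R G (0, x)"
proof -
  note d = dd_xi_tangential[OF X G_all w_all a x]
  have "khat G f \<xi> (0, axis a 1) (0, axis b 1) (0, x) = exp (2 * w x) * G (0, x) $ a $ b" for a b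
    by (simp add: khat_def gD[OF a x] d if_distrib[of "\<lambda>x. x * _"] if_distrib[of "\<lambda>x. _ * x"] cong: if_cong)
  then show ?thesis by (simp add: ghat_def vec_eq_iff)
qed

lemma eventually_gphi:
  assumes a: "gadm X w f \<xi>" and x: "x \<in> X" and P: "\<forall>\<^sub>F y in nhds (0, x). P y"
  shows "\<forall>\<^sub>F y in nhds (0, x). P (gphi f \<xi> y)"
  by (rule eventually_compose_filterlim[OF P])
    (use smooth_near_isCont[OF gD(7)[OF a x]] in \<open>simp add: isCont_def tendsto_nhds_iff gD(6)[OF a x]\<close>)

lemma ghat_metric_near:
  assumes a: "gadm X w f \<xi>" and x: "x \<in> X"
  shows "metric_near (ghat G f \<xi>) (0, x)"
  unfolding metric_near_def
proof (intro conjI)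
  show "smooth_near (ghat G f \<xi>) (0, x)"
    unfolding smooth_near_entries by (simp add: ghat_def smooth_near_khat[OF X G_all w_all a x])
  show "det (ghat G f \<xi> (0, x)) \<noteq> 0"
    using G_near[OF x] unfolding ghat_initial[OF a x] metric_near_def
    by (intro det_scaleR_nonzero) auto
  have "\<forall>\<^sub>F y in nhds (0, x). transpose (G y) = G y" using G_near[OF x] by (simp add: metric_near_def)
  from eventually_gphi[OF a x this]
  show "\<forall>\<^sub>F y in nhds (0, x). transpose (ghat G f \<xi> y) = ghat G f \<xi> y"
    by eventually_elim (simp add: ghat_def transpose_def vec_eq_iff khat_sym)
qed

text \<open>\<open>hmat\<close> is exactly Ricci flat, being a pullback. The ambient metric of
  \<open>ghat\<close> differs from it by the dropped components, which are flat to order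
  \<open>M + 2\<close>, and the Ricci tensor loses two orders.\<close>

lemma ghat_ricci_flat_order:
  assumes a: "gadm X w f \<xi>" and x: "x \<in> X" and N: "N = Suc (Suc M)"
    and A: "flat N (khat G f \<xi> (1, 0) (1, 0)) (0, x)"
    and B: "\<And>u. flat N (khat G f \<xi> (1, 0) (0, axis u 1)) (0, x)"
  shows "flat M (fg_op (ghat G f \<xi>) a b) (0, x)"
proof -
  define z0 where "z0 = amb_section (0::real, x)"
  have z0: "z0 $ IxT \<noteq> 0" "amb_proj z0 = (0, x)" by (simp_all add: z0_def amb_section)
  note sf = gD(1)[OF a x, folded z0(2)] and s\<xi> = gD(2)[OF a x, folded z0(2)]
  note sk = smooth_near_khat[OF X G_all w_all a x]
  have evT: "\<forall>\<^sub>F z in nhds z0. z $ IxT \<noteq> 0"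
    by (rule isCont_eventually_ne[OF smooth_near_isCont[OF smooth_near_coord] z0(1)])
  have ev: "\<forall>\<^sub>F y in nhds (0, x). smooth_near f y \<and> smooth_near \<xi> y"
    using smooth_near_eventually[OF gD(1)[OF a x]] smooth_near_eventually[OF gD(2)[OF a x]] by eventually_elim simp
  have evz: "\<forall>\<^sub>F z in nhds z0. smooth_near f (amb_proj z) \<and> smooth_near \<xi> (amb_proj z)"
    using ev by (intro eventually_amb_proj) (simp add: z0)
  have evs: "\<forall>\<^sub>F y in nhds (0, x). khat G f \<xi> p q y = khat G f \<xi> q p y" for p q
  proof -
    have "\<forall>\<^sub>F y in nhds (0, x). transpose (G y) = G y" using G_near[OF x] by (simp add: metric_near_def)
    from eventually_gphi[OF a x this] show ?thesis by eventually_elim (rule khat_sym)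
  qed
  \<comment> \<open>Entries with an index \<open>t\<close> correspond to the projected direction 0,
    where \<open>khat\<close> vanishes by linearity.\<close>
  have k0: "flat N (khat G f \<xi> 0 q) (0, x)" for q
  proof -
    have "\<forall>\<^sub>F y in nhds (0, x). 0 = khat G f \<xi> 0 q y"
      using ev
    proof eventually_elim
      case (elim y)
      from linear_0[OF khat_linear(1)[of f y \<xi> G q]] elim show ?case by simp
    qed
    from flat_transfer[OF flat_zero this] show ?thesis .
  qed
  have k0': "flat N (khat G f \<xi> q 0) (0, x)" for q
    by (rule flat_transfer[OF k0 evs])
  have B': "flat N (khat G f \<xi> (0, axis u 1) (1, 0)) (0, x)" for u
    by (rule flat_transfer[OF B evs])
  have hm: "fcong N (\<lambda>z. ambm (ghat G f \<xi>) z $ k $ l) (\<lambda>z. hmat G f \<xi> z $ k $ l) z0" for k l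
  proof -
    \<comment> \<open>The discrepancy between the two matrices divided by \<open>t^2\<close>: zero
      on the tangential block, a component of \<open>khat\<close> elsewhere.\<close>
    define D where "D = (\<lambda>y. if (\<exists>a. k = IxM a) \<and> (\<exists>b. l = IxM b) then 0
       else khat G f \<xi> (amb_proj (axis k 1)) (amb_proj (axis l 1)) y)"
    have D: "flat N D (amb_proj z0)" "smooth_near D (amb_proj z0)"
      unfolding D_def z0 using A B B' k0 k0' sk by (cases k; cases l; simp del: flat.simps)+
    have e: "hmat G f \<xi> z $ k $ l = ambm (ghat G f \<xi>) z $ k $ l + (z $ IxT)\<^sup>2 * D (amb_proj z)" for z
      by (cases k; cases l) (simp_all add: hmat_def hform_def ambient_metric_entries ghat_nth D_def axis_component)
    have l: "flat N (\<lambda>z. D (amb_proj z)) z0" "smooth_near (\<lambda>z. D (amb_proj z)) z0"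
      using D by (auto intro: flat_compose smooth_near_linear bounded_linear_amb_proj smooth_near_lift)
    have s: "smooth_near (\<lambda>z. ambm (ghat G f \<xi>) z $ k $ l) z0"
      using ambient_metric_near[OF z0(1), of "ghat G f \<xi>"] ghat_metric_near[OF a x]
      by (auto simp: z0 metric_near_def)
    have "flat N (\<lambda>z. (z $ IxT)\<^sup>2 * D (amb_proj z)) z0"
      by (rule flat_mult_left[OF l]) (intro smooth_near_power smooth_near_coord)
    moreover have "smooth_near (\<lambda>z. (z $ IxT)\<^sup>2 * D (amb_proj z)) z0"
      by (intro smooth_intros smooth_near_coord l)
    ultimately have "fcong N (\<lambda>z. hmat G f \<xi> z $ k $ l) (\<lambda>z. ambm (ghat G f \<xi>) z $ k $ l) z0"
      unfolding fcong_def e using s by auto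
    then show ?thesis by (rule fcong_sym)
  qed
  note gm = ambient_metric_near[OF z0(1) ghat_metric_near[OF a x, folded z0(2)]]
  have hm_eq: "hmat G f \<xi> z0 = ambm (ghat G f \<xi>) z0"
    using hm unfolding N fcong_def by (auto simp: vec_eq_iff)
  have mH: "metric_near (hmat G f \<xi>) z0"
    unfolding metric_near_def
  proof (intro conjI)
    show "smooth_near (hmat G f \<xi>) z0" unfolding smooth_near_entries using hm by (simp add: fcong_def)
    show "det (hmat G f \<xi> z0) \<noteq> 0" using gm by (simp add: hm_eq metric_near_def)
    have "\<forall>\<^sub>F y in nhds (0, x). transpose (G y) = G y" using G_near[OF x] by (simp add: metric_near_def)
    from eventually_amb_proj[OF eventually_gphi[OF a x this, folded z0(2)]]
    show "\<forall>\<^sub>F z in nhds z0. transpose (hmat G f \<xi> z) = hmat G f \<xi> z"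
      by eventually_elim (simp add: hmat_def hform_def transpose_def vec_eq_iff khat_sym mult_ac add_ac)
  qed
  have pb: "\<forall>\<^sub>F z in nhds z0. \<forall>u v. gform (hmat G f \<xi> z) u v
      = gform (ambm G (gmap f \<xi> z)) (dd u (gmap f \<xi>) z) (dd v (gmap f \<xi>) z)"
    using evz
  proof eventually_elim
    case (elim z)
    then show ?case
      unfolding hmat_def by (simp add: gform_gmap gform_bilinear[of "hform G f \<xi> z"] hform_linear)
  qed
  have rH: "\<forall>\<^sub>F z in nhds z0. ricci (hmat G f \<xi>) z = 0"
  proof -
    have evG: "\<forall>\<^sub>F z in nhds z0. metric_near G (gphi f \<xi> (amb_proj z))"
      by (rule eventually_amb_proj[OF eventually_gphi[OF a x metric_near_eventually[OF G_near[OF x]], folded z0(2)]])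
    have evR: "\<forall>\<^sub>F z in nhds z0. \<forall>z'. amb_proj z' = gphi f \<xi> (amb_proj z) \<longrightarrow> z' $ IxT \<noteq> 0 \<longrightarrow> ricci (ambm G) z' = 0"
      by (rule eventually_amb_proj[OF eventually_gphi[OF a x RF[rule_format, OF x], folded z0(2)]])
    have evP: "\<forall>\<^sub>F z in nhds z0. pulls_back (gmap f \<xi>) (ambm G) (hmat G f \<xi>) z"
      using pb by (simp add: pulls_back_def eventually_eventually)
    from evT evz evG evR evP metric_near_eventually[OF mH] show ?thesis
    proof eventually_elim
      case (elim z)
      have t: "gmap f \<xi> z $ IxT \<noteq> 0" using elim(1) by (simp add: gmap_nth)
      show ?case
        by (rule ricci_flat_pullback[OF elim(5) smooth_near_gmap ambient_metric_near[OF t] elim(6)])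
          (use elim t in \<open>simp_all add: amb_proj_gmap\<close>)
    qed
  qed
  have "fcong M (\<lambda>z. ricci (ambm (ghat G f \<xi>)) z $ IxM a $ IxM b) (\<lambda>z. ricci (hmat G f \<xi>) z $ IxM a $ IxM b) z0"
    by (rule fcong_ricci[OF hm[unfolded N]]) (use gm mH in \<open>simp_all add: metric_near_def\<close>)
  moreover have "flat M (\<lambda>z. ricci (hmat G f \<xi>) z $ IxM a $ IxM b) z0"
    by (rule flat_transfer[OF flat_zero]) (use rH in \<open>eventually_elim, simp\<close>)
  ultimately have "flat M (\<lambda>z. ricci (ambm (ghat G f \<xi>)) z $ IxM a $ IxM b) z0"
    "smooth_near (\<lambda>z. ricci (ambm (ghat G f \<xi>)) z $ IxM a $ IxM b) z0"
    using fcong_flat unfolding fcong_def by blast+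
  then have "flat M (\<lambda>y. ricci (ambm (ghat G f \<xi>)) (amb_section y) $ IxM a $ IxM b) (0, x)"
    unfolding z0_def by (rule flat_compose[OF smooth_near_amb_section])
  moreover have "\<forall>\<^sub>F y in nhds (0, x). ricci (ambm (ghat G f \<xi>)) (amb_section y) $ IxM a $ IxM b = fg_op (ghat G f \<xi>) a b y"
    using metric_near_eventually[OF ghat_metric_near[OF a x]]
  proof eventually_elim
    case (elim y)
    then show ?case
      using ricci_ambient_tangential[of "amb_section y" "ghat G f \<xi>" a b] by (simp add: amb_section)
  qed
  ultimately show ?thesis by (rule flat_transfer)
qed

theorem conformal_family_exists:
  "\<exists>Gh. (\<forall>x\<in>X. metric_near Gh (0, x) \<and> Gh (0, x) = exp (2 * w x) *\<^sub>R G (0, x) \<and> (\<forall>a b. flat M (fg_op Gh a b) (0, x)))"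
proof -
  obtain f \<xi> where a: "gadm X w f \<xi>" and *: "\<forall>x\<in>X. flat (Suc (Suc M)) (khat G f \<xi> (1, 0) (1, 0)) (0, x)
      \<and> (\<forall>u. flat (Suc (Suc M)) (khat G f \<xi> (1, 0) (0, axis u 1)) (0, x))"
    using gauge_exists[OF X G_all w_all, of "Suc (Suc M)"] by blast
  show ?thesis
    by (intro exI[of _ "ghat G f \<xi>"] ballI conjI allI ghat_metric_near[OF a] ghat_initial[OF a]
        ghat_ricci_flat_order[OF a _ refl]) (use * in blast)+
qed

end

section \<open>Uniqueness of the normal form\<close>

text \<open>Bookkeeping for a first variation at order \<open>\<rho>^j\<close>, in which all other
  factors get frozen at \<rho> = 0. The case \<open>k = 0\<close> expresses plain agreement.\<close>

definition leads :: "nat \<Rightarrow> (real \<times> 'e::euclidean_space \<Rightarrow> real) \<Rightarrow> (real \<times> 'e \<Rightarrow> real) \<Rightarrow> ('e \<Rightarrow> real) \<Rightarrow> 'e \<Rightarrow> bool" where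
  "leads j f h k x \<longleftrightarrow> smooth_near h (0, x) \<and> smooth_near k x \<and>
     fcong (Suc j) f (\<lambda>y. h y + fst y ^ j * k (snd y)) (0, x)"

lemma smooth_near_rho_times:
  "smooth_near k x \<Longrightarrow> smooth_near (\<lambda>y. fst y ^ j * k (snd y)) (0::real, x :: 'e::euclidean_space)"
  by (intro smooth_near_mult smooth_near_rho_power smooth_near_comp_snd) simp

lemma leads_refl: "fcong (Suc j) f h (0, x) \<Longrightarrow> leads j f h (\<lambda>x. 0) x"
  by (auto simp: leads_def fcong_def)

lemma leads_cong: "leads j f h k x \<Longrightarrow> h = h' \<Longrightarrow> k = k' \<Longrightarrow> leads j f h' k' x"
  by simp

lemma leads_add:
  assumes "leads j f h k x" "leads j f' h' k' x"
  shows "leads j (\<lambda>y. f y + f' y) (\<lambda>y. h y + h' y) (\<lambda>x. k x + k' x) x"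
proof -
  have "fcong (Suc j) (\<lambda>y. f y + f' y) (\<lambda>y. (h y + fst y ^ j * k (snd y)) + (h' y + fst y ^ j * k' (snd y))) (0, x)"
    using assms by (intro fcong_add) (auto simp: leads_def)
  moreover have "(\<lambda>y. (h y + fst y ^ j * k (snd y)) + (h' y + fst y ^ j * k' (snd y)))
    = (\<lambda>y. h y + h' y + fst y ^ j * (k (snd y) + k' (snd y)))"
    by (simp add: fun_eq_iff algebra_simps)
  ultimately show ?thesis using assms by (auto simp: leads_def)
qed

text \<open>By \<open>fcong_slice\<close> only the restriction of \<open>f'\<close> to \<rho> = 0
  multiplies the leading coefficient.\<close>

lemma leads_mult:
  assumes f: "fcong (Suc j) f f' (0, x)" and g: "leads j g h k x"
  shows "leads j (\<lambda>y. f y * g y) (\<lambda>y. f' y * h y) (\<lambda>x. f' (0, x) * k x) x"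
proof -
  have s: "smooth_near f' (0, x)" "smooth_near h (0, x)" "smooth_near k x"
    using assms by (auto simp: fcong_def leads_def)
  have s0: "smooth_near (\<lambda>x. f' (0, x)) x"
    by (rule smooth_near_compose[of f']) (use s in \<open>auto intro: smooth_near_Pair\<close>)
  have "fcong (Suc j) (\<lambda>y. f y * g y) (\<lambda>y. f' y * (h y + fst y ^ j * k (snd y))) (0, x)"
    using f g by (intro fcong_mult) (auto simp: leads_def)
  moreover have "(\<lambda>y. f' y * (h y + fst y ^ j * k (snd y))) = (\<lambda>y. f' y * h y + (fst y ^ j * f' y) * k (snd y))"
    by (simp add: fun_eq_iff algebra_simps)
  moreover have "fcong (Suc j) (\<lambda>y. f' y * h y + (fst y ^ j * f' y) * k (snd y))
      (\<lambda>y. f' y * h y + (fst y ^ j * f' (0, snd y)) * k (snd y)) (0, x)"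
    using s by (intro fcong_add fcong_mult[OF fcong_slice] fcong_refl smooth_near_mult smooth_near_comp_snd) auto
  moreover have "(\<lambda>y. f' y * h y + (fst y ^ j * f' (0, snd y)) * k (snd y)) = (\<lambda>y. f' y * h y + fst y ^ j * (f' (0, snd y) * k (snd y)))"
    by (simp add: fun_eq_iff algebra_simps)
  ultimately have "fcong (Suc j) (\<lambda>y. f y * g y) (\<lambda>y. f' y * h y + fst y ^ j * (f' (0, snd y) * k (snd y))) (0, x)"
    using fcong_trans by simp
  then show ?thesis
    unfolding leads_def using smooth_near_mult[OF s(1,2)] smooth_near_mult[OF s0 s(3)] by simp
qed

lemma leads_const_mult: "leads j g h k x \<Longrightarrow> leads j (\<lambda>y. c * g y) (\<lambda>y. c * h y) (\<lambda>x. c * k x) x"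
  by (rule leads_mult[OF fcong_const])

lemma leads_sum:
  "(\<And>i. i \<in> I \<Longrightarrow> leads j (f i) (h i) (k i) x) \<Longrightarrow>
    leads j (\<lambda>y. \<Sum>i\<in>I. f i y) (\<lambda>y. \<Sum>i\<in>I. h i y) (\<lambda>x. \<Sum>i\<in>I. k i x) x"
  by (induction I rule: infinite_finite_induct) (auto intro: leads_add leads_refl fcong_const)

text \<open>Turns the formal coefficient back into an actual limit, by \<open>flat_lineD\<close>
  along the \<rho>-axis through \<open>x\<close>; \<open>h\<close> drops out by its own order of
  vanishing.\<close>

lemma leads_limit:
  assumes "leads j f h k x" "flat (Suc j) h (0, x)"
  shows "((\<lambda>\<rho>. f (\<rho>, x) / \<rho> ^ j) \<longlongrightarrow> k x) (at 0)"
proof -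
  let ?r = "\<lambda>y. f y - fst y ^ j * k (snd y)"
  have s: "smooth_near h (0, x)" "smooth_near f (0, x)" "smooth_near k x"
    and fl: "flat (Suc j) (\<lambda>y. f y - (h y + fst y ^ j * k (snd y))) (0, x)"
    using assms by (auto simp: leads_def fcong_def simp del: flat.simps)
  note sk = smooth_near_rho_times[OF s(3), of j]
  have "flat (Suc j) (\<lambda>y. (f y - (h y + fst y ^ j * k (snd y))) + h y) (0, x)"
    by (rule flat_add[OF fl assms(2)]) (use s sk in auto)
  then have "flat (Suc j) ?r (0, x)" by (simp add: algebra_simps del: flat.simps)
  moreover have "smooth_near ?r (0, x)" using s sk by auto
  ultimately have "((\<lambda>\<rho>. ?r ((0, x) + \<rho> *\<^sub>R (1, 0)) / \<rho> ^ j) \<longlongrightarrow> 0) (at 0)"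
    by (intro flat_lineD)
  then have "((\<lambda>\<rho>. (f (\<rho>, x) - \<rho> ^ j * k x) / \<rho> ^ j + k x) \<longlongrightarrow> 0 + k x) (at 0)"
    by (intro tendsto_add tendsto_const) simp
  then have "((\<lambda>\<rho>. (f (\<rho>, x) - \<rho> ^ j * k x) / \<rho> ^ j + k x) \<longlongrightarrow> k x) (at 0)" by simp
  moreover have "\<forall>\<^sub>F \<rho> in at 0. (f (\<rho>, x) - \<rho> ^ j * k x) / \<rho> ^ j + k x = f (\<rho>, x) / \<rho> ^ j"
    by (auto simp: eventually_at field_simps intro!: exI[of _ 1])
  ultimately show ?thesis by (rule Lim_transform_eventually)
qed

definition mtrace :: "real^'m^'m \<Rightarrow> ('m \<Rightarrow> 'm \<Rightarrow> real) \<Rightarrow> real" where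
  "mtrace G A = (\<Sum>c\<in>UNIV. \<Sum>d\<in>UNIV. matrix_inv G $ c $ d * A c d)"

section \<open>The indicial operator, and comparison with an arbitrary family\<close>

context
  fixes X :: "(real^'m::finite) set" and G H :: "'m cyl \<Rightarrow> real^'m^'m"
  assumes X: "open X" and G: "\<forall>x\<in>X. metric_near G (0, x)" and H: "\<forall>x\<in>X. metric_near H (0, x)"
begin

private lemma det_ne: "x \<in> X \<Longrightarrow> det (G (0, x)) \<noteq> 0" "x \<in> X \<Longrightarrow> det (H (0, x)) \<noteq> 0"
  using G H by (auto simp: metric_near_def)

text \<open>No order is lost because the congruence holds on all of the open set
  \<open>X\<close>.\<close>

lemma fcong_tangential:
  assumes "\<forall>x\<in>X. fcong m f h (0::real, x)"
  shows "\<forall>x\<in>X. fcong m (dd (0, u) f) (dd (0, u) h) (0, x)"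
proof
  fix x assume x: "x \<in> X"
  have s: "smooth_near f (0, x)" "smooth_near h (0, x)" if "x \<in> X" for x using assms that by (auto simp: fcong_def)
  have "flat m (dd (0, u) (\<lambda>y. f y - h y)) (0, x)"
    by (rule flat_tangential[OF X _ _ x]) (use assms in \<open>auto simp: fcong_def\<close>)
  moreover have "\<forall>\<^sub>F y in nhds (0, x). dd (0, u) (\<lambda>y. f y - h y) y = dd (0, u) f y - dd (0, u) h y"
    using s[OF x, THEN smooth_near_eventually] by eventually_elim (rule dd_diff)
  ultimately have "flat m (\<lambda>y. dd (0, u) f y - dd (0, u) h y) (0, x)" by (rule flat_transfer)
  then show "fcong m (dd (0, u) f) (dd (0, u) h) (0, x)"
    using s[OF x] by (simp add: fcong_def smooth_near_dd)
qed

lemma fcong_gam: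
  assumes c: "\<forall>x\<in>X. \<forall>a b. fcong m (\<lambda>y. G y $ a $ b) (\<lambda>y. H y $ a $ b) (0, x)"
  shows "\<forall>x\<in>X. fcong m (gam G c a b) (gam H c a b) (0, x)"
proof
  fix x assume x: "x \<in> X"
  have t: "fcong m (dd (0, u) (\<lambda>y. G y $ a $ b)) (dd (0, u) (\<lambda>y. H y $ a $ b)) (0, x)" for u a b
    using fcong_tangential[of m "\<lambda>y. G y $ a $ b" "\<lambda>y. H y $ a $ b" u] c x by simp
  have i: "fcong m (\<lambda>y. matrix_inv (G y) $ a $ b) (\<lambda>y. matrix_inv (H y) $ a $ b) (0, x)" for a b
    using c x det_ne[OF x] by (intro fcong_matrix_inv) auto
  show "fcong m (gam G c a b) (gam H c a b) (0, x)"
    unfolding gam_def[abs_def]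
    by (intro fcong_mult[OF fcong_const] fcong_sum fcong_mult[OF i] fcong_add fcong_diff t)
qed

text \<open>The Ricci tensor of the slices contains tangential derivatives only, so it contributes
  nothing to the first variation; this keeps the recursion algebraic in each coefficient.\<close>

lemma fcong_ricY:
  assumes c: "\<forall>x\<in>X. \<forall>a b. fcong m (\<lambda>y. G y $ a $ b) (\<lambda>y. H y $ a $ b) (0, x)" and x: "x \<in> X"
  shows "fcong m (ricY G a b) (ricY H a b) (0, x)"
proof -
  note g = fcong_gam[OF c]
  note t = fcong_tangential[OF g, rule_format, OF x]
  show ?thesis
    unfolding ricY_def[abs_def]
    by (intro fcong_sum fcong_add fcong_diff fcong_mult t g[rule_format, OF x])
qed

text \<open>The indicial operator: it is invertible for \<open>Suc j < n / 2\<close>, and for \<open>Suc j = n / 2\<close> its range consists of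
  multiples of the metric.\<close>

lemma leads_fg_op:
  assumes c: "\<forall>x\<in>X. \<forall>a b. fcong (Suc j) (\<lambda>y. G y $ a $ b) (\<lambda>y. H y $ a $ b) (0, x)"
    and A: "\<And>a b x. x \<in> X \<Longrightarrow> smooth_near (A a b) x"
      "\<And>a b x. x \<in> X \<Longrightarrow> flat (Suc (Suc j)) (\<lambda>y. (G y $ a $ b - H y $ a $ b) - fst y ^ Suc j * A a b (snd y)) (0, x)"
    and x: "x \<in> X"
  shows "leads j (fg_op G a b) (fg_op H a b) (\<lambda>x. real (Suc j) * ((real (Suc j) - real CARD('m) / 2) * A a b x)
     - real (Suc j) / 2 * mtrace (H (0, x)) (\<lambda>a b. A a b x) * H (0, x) $ a $ b) x"
proof -
  have sG: "smooth_near (\<lambda>y. G y $ a $ b) (0, x)" "smooth_near (\<lambda>y. H y $ a $ b) (0, x)" for a b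
    using G H x by (auto intro: smooth_near_fam)
  note sA = smooth_near_rho_times[OF A(1)[OF x]]
  have c1: "fcong (Suc j) (\<lambda>y. G y $ a $ b) (\<lambda>y. H y $ a $ b) (0, x)" for a b using c x by blast
  have inv: "fcong (Suc j) (\<lambda>y. matrix_inv (G y) $ a $ b) (\<lambda>y. matrix_inv (H y) $ a $ b) (0, x)" for a b
    using c1 det_ne[OF x] by (intro fcong_matrix_inv) auto
  have c2: "fcong (Suc (Suc j)) (\<lambda>y. G y $ a $ b) (\<lambda>y. H y $ a $ b + fst y ^ Suc j * A a b (snd y)) (0, x)" for a b
    using A(2)[OF x, of a b] sG sA by (auto simp: fcong_def diff_diff_eq simp del: flat.simps power_Suc)
  have d1: "leads j (gdot G a b) (gdot H a b) (\<lambda>x. real (Suc j) * A a b x) x" for a b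
    unfolding leads_def gdot_def
  proof (intro conjI)
    show "smooth_near (dd (1, 0) (\<lambda>y. H y $ a $ b)) (0, x)" by (intro smooth_near_dd sG)
    show "smooth_near (\<lambda>x. real (Suc j) * A a b x) x" by (intro smooth_intros A x)
    show "fcong (Suc j) (dd (1, 0) (\<lambda>y. G y $ a $ b)) (\<lambda>y. dd (1, 0) (\<lambda>y. H y $ a $ b) y + fst y ^ j * (real (Suc j) * A a b (snd y))) (0, x)"
      by (rule fcong_trans[OF fcong_dd[OF c2] fcong_perturb(3)[OF sG(2) A(1)[OF x]]])
  qed
  \<comment> \<open>One order is lost here, which suffices: in \<open>t3\<close> and
    \<open>t4\<close> a factor \<rho> restores it.\<close>
  have d1': "fcong j (gdot G a b) (gdot H a b) (0, x)" for a b
    unfolding gdot_def by (rule fcong_dd[OF c1])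
  \<comment> \<open>\<rho> times the second derivative of \<open>\<rho>^(j+1) A\<close> is
    \<open>j (j + 1) \<rho>^j A\<close>. For \<open>j = 0\<close> the second derivatives are not
    compared; the factor \<rho> alone gives agreement, matching the zero coefficient.\<close>
  have d2: "leads j (\<lambda>y. fst y * dd (1, 0) (gdot G a b) y) (\<lambda>y. fst y * dd (1, 0) (gdot H a b) y)
      (\<lambda>x. real j * (real (Suc j) * A a b x)) x"
  proof (cases j)
    case 0
    have "smooth_near (dd (1, 0) (gdot G a b)) (0, x)" "smooth_near (dd (1, 0) (gdot H a b)) (0, x)"
      unfolding gdot_def by (intro smooth_near_dd sG)+
    then have "fcong (Suc 0) (\<lambda>y. fst y * dd (1, 0) (gdot G a b) y) (\<lambda>y. fst y * dd (1, 0) (gdot H a b) y) (0, x)"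
      by (intro fcong_rho) (simp add: fcong_def)
    from leads_refl[OF this] 0 show ?thesis by simp
  next
    case (Suc i)
    have "fcong (Suc (Suc i)) (gdot G a b) (\<lambda>y. gdot H a b y + fst y ^ Suc i * (real (Suc j) * A a b (snd y))) (0, x)"
      using d1[of a b] Suc by (simp add: leads_def)
    from fcong_trans[OF fcong_dd[OF this] fcong_perturb(3)]
    have "fcong (Suc i) (dd (1, 0) (gdot G a b))
      (\<lambda>y. dd (1, 0) (gdot H a b) y + fst y ^ i * (real (Suc i) * (real (Suc j) * A a b (snd y)))) (0, x)"
      using d1[of a b] by (simp add: leads_def)
    from fcong_rho[OF this]
    have "fcong (Suc j) (\<lambda>y. fst y * dd (1, 0) (gdot G a b) y)
      (\<lambda>y. fst y * dd (1, 0) (gdot H a b) y + fst y ^ j * (real j * (real (Suc j) * A a b (snd y)))) (0, x)"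
      by (simp add: Suc algebra_simps)
    moreover have "smooth_near (\<lambda>y. fst y * dd (1, 0) (gdot H a b) y) (0, x)"
      using d1[of a b] by (intro smooth_intros smooth_near_fst0) (simp add: leads_def)
    moreover have "smooth_near (\<lambda>x. real j * (real (Suc j) * A a b x)) x"
      by (intro smooth_intros A x)
    ultimately show ?thesis by (simp add: leads_def)
  qed
  have sh: "leads j (shp G c a) (shp H c a) (\<lambda>x. 1/2 * (\<Sum>d\<in>UNIV. matrix_inv (H (0, x)) $ c $ d * (real (Suc j) * A a d x))) x" for c a
    unfolding shp_def[abs_def] by (intro leads_const_mult leads_sum leads_mult inv d1)
  have sh': "fcong j (shp G c a) (shp H c a) (0, x)" for c a
    unfolding shp_def[abs_def] by (intro fcong_mult[OF fcong_const] fcong_sum fcong_mult d1' fcong_mono[OF inv]) simp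
  have tr: "leads j (\<lambda>y. \<Sum>c\<in>UNIV. shp G c c y) (\<lambda>y. \<Sum>c\<in>UNIV. shp H c c y)
      (\<lambda>x. real (Suc j) / 2 * mtrace (H (0, x)) (\<lambda>a b. A a b x)) x"
    by (rule leads_cong[OF leads_sum[OF sh] refl]) (simp add: fun_eq_iff mtrace_def sum_distrib_left mult_ac)
  have t1: "leads j (\<lambda>y. - (real CARD('m) / 2 - 1) * gdot G a b y) (\<lambda>y. - (real CARD('m) / 2 - 1) * gdot H a b y)
     (\<lambda>x. - (real CARD('m) / 2 - 1) * (real (Suc j) * A a b x)) x"
    by (rule leads_const_mult[OF d1])
  have t2: "leads j (\<lambda>y. (- 1 * G y $ a $ b) * (\<Sum>c\<in>UNIV. shp G c c y)) (\<lambda>y. (- 1 * H y $ a $ b) * (\<Sum>c\<in>UNIV. shp H c c y))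
     (\<lambda>x. (- 1 * H (0, x) $ a $ b) * (real (Suc j) / 2 * mtrace (H (0, x)) (\<lambda>a b. A a b x))) x"
    by (rule leads_mult[OF fcong_mult[OF fcong_const c1] tr])
  have t3: "leads j (\<lambda>y. fst y * ((\<Sum>c\<in>UNIV. shp G c c y) * gdot G a b y)) (\<lambda>y. fst y * ((\<Sum>c\<in>UNIV. shp H c c y) * gdot H a b y)) (\<lambda>x. 0) x"
    by (intro leads_refl fcong_rho fcong_mult fcong_sum sh' d1')
  have t4: "leads j (\<lambda>y. - 1 * (fst y * (\<Sum>c\<in>UNIV. gdot G b c y * shp G c a y + gdot G a c y * shp G c b y)))
      (\<lambda>y. - 1 * (fst y * (\<Sum>c\<in>UNIV. gdot H b c y * shp H c a y + gdot H a c y * shp H c b y))) (\<lambda>x. 0) x"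
    by (intro leads_refl fcong_mult[OF fcong_const] fcong_rho fcong_add fcong_mult fcong_sum sh' d1')
  have t5: "leads j (ricY G a b) (ricY H a b) (\<lambda>x. 0) x"
    by (intro leads_refl fcong_ricY c x)
  have "leads j (\<lambda>y. fst y * dd (1, 0) (gdot G a b) y + - (real CARD('m) / 2 - 1) * gdot G a b y
      + (- 1 * G y $ a $ b) * (\<Sum>c\<in>UNIV. shp G c c y) + fst y * ((\<Sum>c\<in>UNIV. shp G c c y) * gdot G a b y)
      + - 1 * (fst y * (\<Sum>c\<in>UNIV. gdot G b c y * shp G c a y + gdot G a c y * shp G c b y)) + ricY G a b y)
    (\<lambda>y. fst y * dd (1, 0) (gdot H a b) y + - (real CARD('m) / 2 - 1) * gdot H a b y
      + (- 1 * H y $ a $ b) * (\<Sum>c\<in>UNIV. shp H c c y) + fst y * ((\<Sum>c\<in>UNIV. shp H c c y) * gdot H a b y)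
      + - 1 * (fst y * (\<Sum>c\<in>UNIV. gdot H b c y * shp H c a y + gdot H a c y * shp H c b y)) + ricY H a b y)
    (\<lambda>x. real j * (real (Suc j) * A a b x) + - (real CARD('m) / 2 - 1) * (real (Suc j) * A a b x)
      + (- 1 * H (0, x) $ a $ b) * (real (Suc j) / 2 * mtrace (H (0, x)) (\<lambda>a b. A a b x)) + 0 + 0 + 0) x"
    by (intro leads_add d2 t1 t2 t3 t4 t5)
  moreover have "(\<lambda>y. fst y * dd (1, 0) (gdot F a b) y + - (real CARD('m) / 2 - 1) * gdot F a b y
      + (- 1 * F y $ a $ b) * (\<Sum>c\<in>UNIV. shp F c c y) + fst y * ((\<Sum>c\<in>UNIV. shp F c c y) * gdot F a b y)
      + - 1 * (fst y * (\<Sum>c\<in>UNIV. gdot F b c y * shp F c a y + gdot F a c y * shp F c b y)) + ricY F a b y)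
    = fg_op F a b" for F
    by (simp add: fun_eq_iff fg_op_def mult_ac) (simp add: algebra_simps)
  \<comment> \<open>\<open>j (j + 1) - (n / 2 - 1) (j + 1) = (j + 1) (j + 1 - n / 2)\<close>, the
    indicial factor that vanishes at the critical order.\<close>
  moreover have "(\<lambda>x. real j * (real (Suc j) * A a b x) + - (real CARD('m) / 2 - 1) * (real (Suc j) * A a b x)
      + (- 1 * H (0, x) $ a $ b) * (real (Suc j) / 2 * mtrace (H (0, x)) (\<lambda>a b. A a b x)) + 0 + 0 + 0)
     = (\<lambda>x. real (Suc j) * ((real (Suc j) - real CARD('m) / 2) * A a b x)
     - real (Suc j) / 2 * mtrace (H (0, x)) (\<lambda>a b. A a b x) * H (0, x) $ a $ b)"
    by (simp add: fun_eq_iff field_simps)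
  ultimately show ?thesis by simp
qed

lemma mtrace_linear: "mtrace M (\<lambda>a b. p * A a b - q * B a b) = p * mtrace M A - q * mtrace M B"
  by (simp add: mtrace_def algebra_simps sum_subtractf sum_distrib_left)

lemma mtrace_self:
  assumes "x \<in> X" shows "mtrace (H (0, x)) (\<lambda>a b. H (0, x) $ a $ b) = real CARD('m)"
proof -
  have "metric_near H (0, x)" using H assms by blast
  then have "mtrace (H (0, x)) (\<lambda>a b. H (0, x) $ a $ b)
     = (\<Sum>c\<in>UNIV. \<Sum>d\<in>UNIV. matrix_inv (H (0, x)) $ c $ d * H (0, x) $ d $ c)"
    unfolding mtrace_def by (intro sum.cong refl) (simp add: metric_near_symD[of H "(0, x)"])
  then show ?thesis
    using matrix_inv_entries(2)[OF det_ne(2)[OF assms]] by simp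
qed

text \<open>Coefficient by coefficient, \<open>G - H\<close> is pushed up to order
  \<open>n / 2\<close>; there the indicial factor is zero and only the trace term can contribute to
  \<open>L\<close>.\<close>

lemma obstruction_pure_trace:
  assumes n: "even CARD('m)" "CARD('m) \<ge> 4"
    and init: "\<forall>x\<in>X. G (0, x) = H (0, x)"
    and fH: "\<forall>x\<in>X. \<forall>a b. flat (CARD('m) div 2) (fg_op H a b) (0, x)"
    and fG: "\<forall>x\<in>X. \<forall>a b. (\<lambda>\<rho>. fg_op G a b (\<rho>, x)) \<in> O[at 0](\<lambda>\<rho>. \<rho> ^ (CARD('m) div 2 - 1))"
    and x: "x \<in> X"
    and L: "\<And>a b. ((\<lambda>\<rho>. fg_op G a b (\<rho>, x) / \<rho> ^ (CARD('m) div 2 - 1)) \<longlongrightarrow> L $ a $ b) (at 0)"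
  shows "\<exists>c. L = c *\<^sub>R G (0, x)"
proof -
  define h where "h = CARD('m) div 2"
  have h: "real CARD('m) = 2 * real h" "h \<ge> 2" using n by (auto simp: h_def)
  have coeff: "\<exists>A. (\<forall>a b. \<forall>x\<in>X. smooth_near (A a b) x) \<and>
      (\<forall>a b. \<forall>x\<in>X. flat (Suc (Suc j)) (\<lambda>y. (G y $ a $ b - H y $ a $ b) - fst y ^ Suc j * A a b (snd y)) (0, x))"
    if "\<forall>x\<in>X. \<forall>a b. fcong (Suc j) (\<lambda>y. G y $ a $ b) (\<lambda>y. H y $ a $ b) (0, x)" for j
  proof -
    have "\<exists>\<gamma>. (\<forall>x\<in>X. smooth_near \<gamma> x) \<and>
      (\<forall>x\<in>X. flat (Suc (Suc j)) (\<lambda>y. (G y $ a $ b - H y $ a $ b) - fst y ^ Suc j * \<gamma> (snd y)) (0, x))" for a b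
      by (rule flat_leading_coeff[OF X]) (use that in \<open>auto simp: fcong_def simp del: flat.simps\<close>)
    then have "\<forall>ab. \<exists>\<gamma>. (\<forall>x\<in>X. smooth_near \<gamma> x) \<and>
      (\<forall>x\<in>X. flat (Suc (Suc j)) (\<lambda>y. (G y $ fst ab $ snd ab - H y $ fst ab $ snd ab) - fst y ^ Suc j * \<gamma> (snd y)) (0, x))"
      by blast
    from choice[OF this] obtain A where A: "\<forall>ab. (\<forall>x\<in>X. smooth_near (A ab) x) \<and>
      (\<forall>x\<in>X. flat (Suc (Suc j)) (\<lambda>y. (G y $ fst ab $ snd ab - H y $ fst ab $ snd ab) - fst y ^ Suc j * A ab (snd y)) (0, x))" ..
    show ?thesis
    proof (intro exI[of _ "\<lambda>a b. A (a, b)"] conjI allI)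
      fix a b
      show "\<forall>x\<in>X. smooth_near (A (a, b)) x"
        "\<forall>x\<in>X. flat (Suc (Suc j)) (\<lambda>y. (G y $ a $ b - H y $ a $ b) - fst y ^ Suc j * A (a, b) (snd y)) (0, x)"
        using A[rule_format, of "(a, b)"] by (simp_all del: flat.simps)
    qed
  qed
  have "\<forall>x\<in>X. \<forall>a b. fcong (Suc j) (\<lambda>y. G y $ a $ b) (\<lambda>y. H y $ a $ b) (0, x)" if "j < h" for j
    using that
  proof (induction j)
    case 0
    then show ?case using init G H by (auto simp: fcong_def smooth_near_fam)
  next
    case (Suc j)
    then have c: "\<forall>x\<in>X. \<forall>a b. fcong (Suc j) (\<lambda>y. G y $ a $ b) (\<lambda>y. H y $ a $ b) (0, x)" by simp
    from coeff[OF this] obtain A where A: "\<And>a b x. x \<in> X \<Longrightarrow> smooth_near (A a b) x"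
      "\<And>a b x. x \<in> X \<Longrightarrow> flat (Suc (Suc j)) (\<lambda>y. (G y $ a $ b - H y $ a $ b) - fst y ^ Suc j * A a b (snd y)) (0, x)"
      by blast
    have A0: "A a b x = 0" if x: "x \<in> X" for a b x
    proof -
      \<comment> \<open>The indicial operator applied to \<open>A\<close>. It must vanish: it is the
        limit of a quotient by \<open>\<rho>^j\<close> whose numerator is of order
        \<open>\<rho>^(h-1)\<close>, and \<open>j < h - 1\<close>.\<close>
      define K where "K = (\<lambda>a b. real (Suc j) * ((real (Suc j) - real CARD('m) / 2) * A a b x)
        - real (Suc j) / 2 * mtrace (H (0, x)) (\<lambda>a b. A a b x) * H (0, x) $ a $ b)"
      have K: "K a b = 0" for a b
      proof -
        have "((\<lambda>\<rho>. fg_op G a b (\<rho>, x) / \<rho> ^ j) \<longlongrightarrow> K a b) (at 0)"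
          unfolding K_def
          by (rule leads_limit[OF leads_fg_op[OF c A x]])
            (use fH x Suc.prems in \<open>auto intro: flat_mono[of "CARD('m) div 2"] simp: h_def simp del: flat.simps\<close>)
        moreover have "((\<lambda>\<rho>. fg_op G a b (\<rho>, x) / \<rho> ^ j) \<longlongrightarrow> 0) (at 0)"
        proof -
          have "(\<lambda>\<rho>::real. \<rho> ^ (h - 1)) \<in> o[at 0](\<lambda>\<rho>. \<rho> ^ j)"
          proof (rule smalloI_tendsto)
            have "(0::real) ^ (h - 1 - j) = 0" using Suc.prems by simp
            moreover have "(\<lambda>\<rho>::real. \<rho> ^ (h - 1 - j)) \<midarrow>0\<rightarrow> 0 ^ (h - 1 - j)"
              by (intro tendsto_intros)
            ultimately have "(\<lambda>\<rho>::real. \<rho> ^ (h - 1 - j)) \<midarrow>0\<rightarrow> 0" by simp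
            moreover have "\<forall>\<^sub>F \<rho>::real in at 0. \<rho> ^ (h - 1 - j) = \<rho> ^ (h - 1) / \<rho> ^ j"
            proof -
              have "\<rho> ^ (h - 1 - j) = \<rho> ^ (h - 1) / \<rho> ^ j" if "\<rho> \<noteq> 0" for \<rho> :: real
                using Suc.prems that by (intro power_diff) auto
              then show ?thesis by (auto simp: eventually_at intro!: exI[of _ 1])
            qed
            ultimately show "(\<lambda>\<rho>::real. \<rho> ^ (h - 1) / \<rho> ^ j) \<midarrow>0\<rightarrow> 0"
              by (rule Lim_transform_eventually)
            show "\<forall>\<^sub>F \<rho>::real in at 0. \<rho> ^ j \<noteq> 0"
              unfolding eventually_at by (auto intro!: exI[of _ 1])
          qed
          from landau_o.big_small_trans[OF fG[rule_format, OF x, folded h_def] this]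
          show ?thesis by (rule smalloD_tendsto)
        qed
        ultimately show ?thesis by (rule LIM_unique)
      qed
      define T where "T = mtrace (H (0, x)) (\<lambda>a b. A a b x)"
      \<comment> \<open>The trace decouples: the terms combine to
        \<open>(j + 1) (j + 1 - n) T\<close>, so \<open>T = 0\<close>. What is left of
        \<open>K\<close> is a nonzero multiple of \<open>A\<close>, because
        \<open>j + 1 < n / 2\<close>.\<close>
      have "mtrace (H (0, x)) K = real (Suc j) * (real (Suc j) - real CARD('m) / 2) * T - real (Suc j) / 2 * T * real CARD('m)"
        unfolding K_def T_def mult.assoc[symmetric] mtrace_linear mtrace_self[OF x] ..
      moreover have "mtrace (H (0, x)) K = 0" by (simp add: mtrace_def K)
      ultimately have "real (Suc j) * (real (Suc j) - real CARD('m)) * T = 0" by (simp add: field_simps)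
      moreover have "real (Suc j) \<noteq> real CARD('m)" using Suc.prems h by simp
      ultimately have T: "T = 0" by simp
      show "A a b x = 0"
        using K[of a b] Suc.prems h unfolding K_def T_def[symmetric] T by simp
    qed
    show ?case
    proof (intro ballI allI)
      fix x a b assume x: "x \<in> X"
      have "\<forall>\<^sub>F y in nhds (0::real, x). snd y \<in> X"
        by (rule eventually_snd_mem[OF X x])
      then have "\<forall>\<^sub>F y in nhds (0, x). (G y $ a $ b - H y $ a $ b) - fst y ^ Suc j * A a b (snd y) = G y $ a $ b - H y $ a $ b"
        by eventually_elim (simp add: A0)
      from flat_transfer[OF A(2)[OF x] this]
      show "fcong (Suc (Suc j)) (\<lambda>y. G y $ a $ b) (\<lambda>y. H y $ a $ b) (0, x)"
        using G H x by (simp add: fcong_def smooth_near_fam del: flat.simps)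
    qed
  qed
  from this[of "h - 1"] have c: "\<forall>x\<in>X. \<forall>a b. fcong (Suc (h - 1)) (\<lambda>y. G y $ a $ b) (\<lambda>y. H y $ a $ b) (0, x)"
    using h by simp
  from coeff[OF this] obtain A where A: "\<And>a b x. x \<in> X \<Longrightarrow> smooth_near (A a b) x"
    "\<And>a b x. x \<in> X \<Longrightarrow> flat (Suc (Suc (h - 1))) (\<lambda>y. (G y $ a $ b - H y $ a $ b) - fst y ^ Suc (h - 1) * A a b (snd y)) (0, x)"
    by blast
  have Sh: "Suc (h - 1) = h" using h by simp
  define T where "T = mtrace (H (0, x)) (\<lambda>a b. A a b x)"
  \<comment> \<open>At \<open>j + 1 = h = n / 2\<close> the factor in front of \<open>A\<close> is
    zero, so a multiple of the metric remains, whatever the trace-free part of \<open>A\<close>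
    is.\<close>
  have "L $ a $ b = - real h / 2 * T * H (0, x) $ a $ b" for a b
  proof (rule LIM_unique[OF L])
    have "flat (Suc (h - 1)) (fg_op H a b) (0, x)" unfolding Sh using fH[rule_format, OF x] by (simp add: h_def)
    from leads_limit[OF leads_fg_op[OF c A x] this]
    show "((\<lambda>\<rho>. fg_op G a b (\<rho>, x) / \<rho> ^ (CARD('m) div 2 - 1)) \<longlongrightarrow> - real h / 2 * T * H (0, x) $ a $ b) (at 0)"
      unfolding Sh h_def[symmetric] T_def h(1) by simp
  qed
  then have "L = (- real h / 2 * T) *\<^sub>R G (0, x)"
    using init x by (simp add: vec_eq_iff)
  then show ?thesis ..
qed

end

section \<open>The product of two Einstein metrics\<close>

lemma sum_sum_type:
  fixes f :: "'a::finite + 'b::finite \<Rightarrow> 'c::comm_monoid_add"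
  shows "(\<Sum>k\<in>UNIV. f k) = (\<Sum>a\<in>UNIV. f (Inl a)) + (\<Sum>b\<in>UNIV. f (Inr b))"
  unfolding UNIV_sum by (subst sum.union_disjoint) (auto simp: sum.reindex)

definition left_part :: "real^('m1::finite + 'm2::finite) \<Rightarrow> real^'m1" where "left_part z = (\<chi> c. z $ Inl c)"
definition right_part :: "real^('m1::finite + 'm2::finite) \<Rightarrow> real^'m2" where "right_part z = (\<chi> c. z $ Inr c)"

abbreviation lpart :: "('m1::finite + 'm2::finite) cyl \<Rightarrow> real^'m1" where "lpart y \<equiv> left_part (snd y)"
abbreviation rpart :: "('m1::finite + 'm2::finite) cyl \<Rightarrow> real^'m2" where "rpart y \<equiv> right_part (snd y)"

lemma bounded_linear_parts: "bounded_linear left_part" "bounded_linear right_part"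
  unfolding linear_conv_bounded_linear[symmetric]
  by (auto intro!: linearI simp: left_part_def right_part_def vec_eq_iff)

lemma parts_axis [simp]:
  "left_part (axis (Inl a) 1) = axis a (1::real)" "left_part (axis (Inr b) (1::real)) = 0"
  "right_part (axis (Inr b) 1) = axis b (1::real)" "right_part (axis (Inl a) (1::real)) = 0"
  "left_part 0 = 0" "right_part 0 = 0"
  by (auto simp: left_part_def right_part_def axis_def vec_eq_iff)

lemma smooth_near_part:
  fixes F :: "real^'k \<Rightarrow> 'b::real_normed_vector" and \<pi> :: "real^'n \<Rightarrow> real^'k"
  assumes "bounded_linear \<pi>" "smooth_near F (\<pi> (snd y))"
  shows "smooth_near (\<lambda>y :: real \<times> (real^'n). F (\<pi> (snd y))) y"
  by (rule smooth_near_compose[OF assms(2) smooth_near_linear[OF bounded_linear_compose[OF assms(1) bounded_linear_snd]]])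

lemma dd_part:
  fixes F :: "real^'k \<Rightarrow> 'b::real_normed_vector" and \<pi> :: "real^'n \<Rightarrow> real^'k"
  assumes "bounded_linear \<pi>" "smooth_near F (\<pi> (snd y))"
  shows "dd v (\<lambda>y :: real \<times> (real^'n). F (\<pi> (snd y))) y = dd (\<pi> (snd v)) F (\<pi> (snd y))"
proof -
  note b = bounded_linear_compose[OF assms(1) bounded_linear_snd]
  from dd_compose[OF assms(2) smooth_near_linear[OF b], of v] dd_linear[OF b, of v y]
  show ?thesis by simp
qed

lemma dd_warped:
  fixes F :: "real^'k \<Rightarrow> real" and \<pi> :: "real^'n \<Rightarrow> real^'k"
  assumes "bounded_linear \<pi>" "smooth_near F (\<pi> (snd y))"
  shows "dd v (\<lambda>y :: real \<times> (real^'n). (1 + \<kappa> * fst y)\<^sup>2 * F (\<pi> (snd y))) y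
    = 2 * \<kappa> * fst v * (1 + \<kappa> * fst y) * F (\<pi> (snd y)) + (1 + \<kappa> * fst y)\<^sup>2 * dd (\<pi> (snd v)) F (\<pi> (snd y))" (is ?A1)
    "smooth_near (\<lambda>y :: real \<times> (real^'n). (1 + \<kappa> * fst y)\<^sup>2 * F (\<pi> (snd y))) y" (is ?A2)
proof -
  have l: "smooth_near (\<lambda>y :: real \<times> (real^'n). 1 + \<kappa> * fst y) y" for y
    by (intro smooth_intros smooth_near_fst0)
  have "dd v (\<lambda>y :: real \<times> (real^'n). 1 + \<kappa> * fst y) y = \<kappa> * fst v"
    by (simp add: dd_add dd_mult smooth_near_mult smooth_near_fst0 dd_fst)
  then have d: "dd v (\<lambda>y :: real \<times> (real^'n). (1 + \<kappa> * fst y)\<^sup>2) y = 2 * \<kappa> * fst v * (1 + \<kappa> * fst y)"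
    unfolding power2_eq_square by (simp add: dd_mult[OF l l])
  have l2: "smooth_near (\<lambda>y :: real \<times> (real^'n). (1 + \<kappa> * fst y)\<^sup>2) y" by (rule smooth_near_power[OF l])
  note s = smooth_near_part[OF assms]
  show ?A1
    by (simp add: dd_mult[OF l2 s] d dd_part[OF assms])
  show ?A2
    by (rule smooth_near_mult[OF l2 s])
qed

lemma smooth_near_christoffel:
  assumes "metric_near G x" shows "smooth_near (christoffel G k i j) x"
proof (rule smooth_near_cong)
  show "\<forall>\<^sub>F y in nhds x. chr G y (axis i 1) (axis j 1) $ k = christoffel G k i j y"
    using metric_near_eventually[OF assms] by eventually_elim (simp add: christoffel_chr)
  show "smooth_near (\<lambda>y. chr G y (axis i 1) (axis j 1) $ k) x"
    by (rule smooth_near_nth[OF smooth_near_chr[OF assms]])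
qed

text \<open>Both blocks are written as \<open>(1 + c \<rho>)\<^sup>2\<close> with \<open>c = \<kappa>\<close> and \<open>c = - \<kappa>\<close>, so that the same computation
  serves for each.\<close>

definition prodfam :: "real \<Rightarrow> (real^'m1::finite \<Rightarrow> real^'m1^'m1) \<Rightarrow> (real^'m2::finite \<Rightarrow> real^'m2^'m2)
    \<Rightarrow> ('m1 + 'm2) cyl \<Rightarrow> real^('m1 + 'm2)^('m1 + 'm2)" where
  "prodfam \<kappa> g1 g2 y = (\<chi> k l. case k of
      Inl a \<Rightarrow> (case l of Inl b \<Rightarrow> (1 + \<kappa> * fst y)\<^sup>2 * g1 (left_part (snd y)) $ a $ b | Inr b \<Rightarrow> 0)
    | Inr a \<Rightarrow> (case l of Inl b \<Rightarrow> 0 | Inr b \<Rightarrow> (1 + (- \<kappa>) * fst y)\<^sup>2 * g2 (right_part (snd y)) $ a $ b))"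

lemma prodfam_entries:
  "prodfam \<kappa> g1 g2 y $ Inl a $ Inl b = (1 + \<kappa> * fst y)\<^sup>2 * g1 (left_part (snd y)) $ a $ b"
  "prodfam \<kappa> g1 g2 y $ Inr c $ Inr d = (1 + (- \<kappa>) * fst y)\<^sup>2 * g2 (right_part (snd y)) $ c $ d"
  "prodfam \<kappa> g1 g2 y $ Inl a $ Inr d = 0" "prodfam \<kappa> g1 g2 y $ Inr c $ Inl b = 0"
  by (simp_all add: prodfam_def)

context
  fixes \<kappa> :: real and g1 :: "real^'m1::finite \<Rightarrow> real^'m1^'m1" and g2 :: "real^'m2::finite \<Rightarrow> real^'m2^'m2"
begin

definition good :: "('m1 + 'm2) cyl \<Rightarrow> bool" where
  "good y \<longleftrightarrow> 1 + \<kappa> * fst y \<noteq> 0 \<and> 1 + (- \<kappa>) * fst y \<noteq> 0 \<and>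
     metric_near g1 (lpart y) \<and> metric_near g2 (rpart y)"

abbreviation "K \<equiv> prodfam \<kappa> g1 g2"

lemma eventually_part:
  fixes \<pi> :: "real^('m1 + 'm2) \<Rightarrow> real^'k"
  assumes "bounded_linear \<pi>" "\<forall>\<^sub>F x in nhds (\<pi> (snd y)). P x" 
  shows "\<forall>\<^sub>F y :: ('m1 + 'm2) cyl in nhds y. P (\<pi> (snd y))"
  using smooth_near_isCont[OF smooth_near_linear[OF bounded_linear_compose[OF assms(1) bounded_linear_snd]], of y] assms(2)
  by (auto simp: isCont_def tendsto_nhds_iff intro: eventually_compose_filterlim)

lemma good_eventually:
  assumes "good y" shows "\<forall>\<^sub>F y in nhds y. good y"
proof -
  have l: "isCont (\<lambda>y :: ('m1 + 'm2) cyl. 1 + c * fst y) y" for c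
    by (intro continuous_intros)
  have "\<forall>\<^sub>F y in nhds y. 1 + \<kappa> * fst y \<noteq> 0"
    by (rule isCont_eventually_ne[OF l]) (use assms in \<open>simp add: good_def\<close>)
  moreover have "\<forall>\<^sub>F y in nhds y. 1 + (- \<kappa>) * fst y \<noteq> 0"
    by (rule isCont_eventually_ne[OF l]) (use assms in \<open>simp add: good_def\<close>)
  moreover have "\<forall>\<^sub>F y :: ('m1 + 'm2) cyl in nhds y. metric_near g1 (lpart y)"
    by (rule eventually_part[OF bounded_linear_parts(1) metric_near_eventually]) (use assms in \<open>simp add: good_def\<close>)
  moreover have "\<forall>\<^sub>F y :: ('m1 + 'm2) cyl in nhds y. metric_near g2 (rpart y)"
    by (rule eventually_part[OF bounded_linear_parts(2) metric_near_eventually]) (use assms in \<open>simp add: good_def\<close>)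
  ultimately show ?thesis by eventually_elim (simp add: good_def)
qed

lemma good_smooth:
  assumes "good y"
  shows "smooth_near (\<lambda>x. g1 x $ a $ b) (lpart y)" "smooth_near (\<lambda>x. g2 x $ c $ d) (rpart y)"
  using assms by (auto simp: good_def metric_near_def)

lemma prodfam_inverse:
  assumes "good y"
  shows "matrix_inv (K y) $ Inl a $ Inl b = matrix_inv (g1 (lpart y)) $ a $ b / (1 + \<kappa> * fst y)\<^sup>2" (is ?A1)
    "matrix_inv (K y) $ Inr c $ Inr d = matrix_inv (g2 (rpart y)) $ c $ d / (1 + (- \<kappa>) * fst y)\<^sup>2" (is ?A2)
    "matrix_inv (K y) $ Inl a $ Inr d = 0" (is ?A3) "matrix_inv (K y) $ Inr c $ Inl b = 0" (is ?A4) "det (K y) \<noteq> 0" (is ?A5)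
proof -
  define B :: "real^('m1 + 'm2)^('m1 + 'm2)" where "B = (\<chi> k l. case k of
      Inl a \<Rightarrow> (case l of Inl b \<Rightarrow> matrix_inv (g1 (lpart y)) $ a $ b / (1 + \<kappa> * fst y)\<^sup>2 | Inr b \<Rightarrow> 0)
    | Inr a \<Rightarrow> (case l of Inl b \<Rightarrow> 0 | Inr b \<Rightarrow> matrix_inv (g2 (rpart y)) $ a $ b / (1 + (- \<kappa>) * fst y)\<^sup>2))"
  have d: "det (g1 (lpart y)) \<noteq> 0" "det (g2 (rpart y)) \<noteq> 0"
    and nz: "(1 + \<kappa> * fst y)\<^sup>2 \<noteq> 0" "(1 + (- \<kappa>) * fst y)\<^sup>2 \<noteq> 0"
    using assms by (auto simp: good_def metric_near_def)
  have nz3: "(1 - \<kappa> * fst y)\<^sup>2 \<noteq> 0" using nz(2) by simp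
  have c: "p * a * (b / p) = a * b" if "p \<noteq> 0" for p a b :: real using that by simp
  have "(K y ** B) $ k $ l = mat 1 $ k $ l" for k l
    by (cases k; cases l)
      (simp_all add: matrix_matrix_mult_def sum_sum_type prodfam_entries B_def mat_def c[OF nz(1)] c[OF nz(2)] c[OF nz3]
        matrix_inv_entries(1)[OF d(1)] matrix_inv_entries(1)[OF d(2)] del: mult_minus_left times_divide_eq_right)
  then have "K y ** B = mat 1" by (simp add: vec_eq_iff)
  from matrix_inv_unique[OF this]
  show ?A1 ?A2 ?A3 ?A4 ?A5
    by (simp_all add: B_def)
qed

lemma prodfam_near:
  assumes "good y" shows "metric_near K y"
  unfolding metric_near_def
proof (intro conjI)
  have "smooth_near (\<lambda>y. K y $ k $ l) y" for k l
    by (cases k; cases l)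
      (simp_all only: prodfam_entries smooth_near_const
        dd_warped(2)[where F = "\<lambda>x. g1 x $ _ $ _", OF bounded_linear_parts(1) good_smooth(1)[OF assms]]
        dd_warped(2)[where F = "\<lambda>x. g2 x $ _ $ _", OF bounded_linear_parts(2) good_smooth(2)[OF assms]])
  then show "smooth_near K y" by (simp add: smooth_near_entries)
  show "det (K y) \<noteq> 0" by (rule prodfam_inverse[OF assms])
  show "\<forall>\<^sub>F y in nhds y. transpose (K y) = K y"
    using good_eventually[OF assms]
  proof eventually_elim
    case (elim y)
    have t: "transpose (g1 (lpart y)) = g1 (lpart y)" "transpose (g2 (rpart y)) = g2 (rpart y)"
      using elim eventually_nhds_x_imp_x unfolding good_def metric_near_def by blast+
    have "K y $ l $ k = K y $ k $ l" for k l
      using t[symmetric] by (cases k; cases l) (simp_all add: prodfam_entries transpose_def vec_eq_iff)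
    then show ?case by (simp add: transpose_def vec_eq_iff)
  qed
qed

lemma dd_prodfam:
  assumes "good y"
  shows "dd v (\<lambda>y. K y $ Inl a $ Inl b) y = 2 * \<kappa> * fst v * (1 + \<kappa> * fst y) * g1 (lpart y) $ a $ b
      + (1 + \<kappa> * fst y)\<^sup>2 * dd (left_part (snd v)) (\<lambda>x. g1 x $ a $ b) (lpart y)"
    "dd v (\<lambda>y. K y $ Inr c $ Inr d) y = 2 * (- \<kappa>) * fst v * (1 + (- \<kappa>) * fst y) * g2 (rpart y) $ c $ d
      + (1 + (- \<kappa>) * fst y)\<^sup>2 * dd (right_part (snd v)) (\<lambda>x. g2 x $ c $ d) (rpart y)"
    "dd v (\<lambda>y. K y $ Inl a $ Inr d) y = 0" "dd v (\<lambda>y. K y $ Inr c $ Inl b) y = 0"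
  unfolding prodfam_entries
  by (simp_all only: dd_const dd_warped(1)[where F = "\<lambda>x. g1 x $ _ $ _", OF bounded_linear_parts(1) good_smooth(1)[OF assms]]
        dd_warped(1)[where F = "\<lambda>x. g2 x $ _ $ _", OF bounded_linear_parts(2) good_smooth(2)[OF assms]])

lemma dd_prodfam_tang:
  assumes "good y"
  shows "dd (0, axis (Inl e) 1) (\<lambda>y. K y $ Inl a $ Inl b) y = (1 + \<kappa> * fst y)\<^sup>2 * partial e (\<lambda>x. g1 x $ a $ b) (lpart y)"
    "dd (0, axis (Inr e') 1) (\<lambda>y. K y $ Inl a $ Inl b) y = 0"
    "dd (0, axis (Inr e') 1) (\<lambda>y. K y $ Inr c $ Inr d) y = (1 + (- \<kappa>) * fst y)\<^sup>2 * partial e' (\<lambda>x. g2 x $ c $ d) (rpart y)"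
    "dd (0, axis (Inl e) 1) (\<lambda>y. K y $ Inr c $ Inr d) y = 0"
  unfolding dd_prodfam[OF assms] partial_dd
  using linear_0[OF linear_dd[OF good_smooth(1)[OF assms]]] linear_0[OF linear_dd[OF good_smooth(2)[OF assms]]]
  by simp_all

text \<open>At fixed \<rho> each block is a constant multiple of \<open>g1\<close> or
  \<open>g2\<close>, and constant factors cancel in the Christoffel symbols.\<close>

lemma gam_prodfam:
  assumes "good y"
  shows "gam K (Inl c) (Inl a) (Inl b) y = christoffel g1 c a b (lpart y)" (is ?A1)
    "gam K (Inr c') (Inr a') (Inr b') y = christoffel g2 c' a' b' (rpart y)" (is ?A2)
    "gam K (Inl c) (Inl a) (Inr b') y = 0" (is ?A3) "gam K (Inl c) (Inr a') (Inl b) y = 0" (is ?A4) "gam K (Inl c) (Inr a') (Inr b') y = 0" (is ?A5)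
    "gam K (Inr c') (Inl a) (Inl b) y = 0" (is ?A6) "gam K (Inr c') (Inl a) (Inr b') y = 0" (is ?A7) "gam K (Inr c') (Inr a') (Inl b) y = 0" (is ?A8)
proof -
  have nz: "(1 + \<kappa> * fst y)\<^sup>2 \<noteq> 0" "(1 + (- \<kappa>) * fst y)\<^sup>2 \<noteq> 0"
    using assms by (auto simp: good_def)
  have c: "(i / p) * (p * r + p * s - p * t) = i * (r + s - t)" if "p \<noteq> 0" for p i r s t :: real
    using that by (simp add: field_simps)
  show ?A1 ?A2 ?A3 ?A4 ?A5 ?A6 ?A7 ?A8
    unfolding gam_def christoffel_def sum_sum_type prodfam_inverse[OF assms] dd_prodfam_tang[OF assms] dd_prodfam(3,4)[OF assms]
      c[OF nz(1)] c[OF nz(2)] by simp_all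
qed

lemma gdot_prodfam:
  assumes "good y"
  shows "gdot K (Inl a) (Inl b) y = 2 * \<kappa> * (1 + \<kappa> * fst y) * g1 (lpart y) $ a $ b"
    "gdot K (Inr a') (Inr b') y = 2 * (- \<kappa>) * (1 + (- \<kappa>) * fst y) * g2 (rpart y) $ a' $ b'"
    "gdot K (Inl a) (Inr b') y = 0" "gdot K (Inr a') (Inl b) y = 0"
  unfolding gdot_def dd_prodfam[OF assms]
  using linear_0[OF linear_dd[OF good_smooth(1)[OF assms]]] linear_0[OF linear_dd[OF good_smooth(2)[OF assms]]]
  by simp_all

text \<open>On each block, \<open>shp\<close> is half the logarithmic \<rho>-derivative of the
  squared warping factor, times the identity.\<close>

lemma shp_prodfam:
  assumes "good y"
  shows "shp K (Inl c) (Inl a) y = (if c = a then \<kappa> / (1 + \<kappa> * fst y) else 0)" (is ?A1)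
    "shp K (Inr c') (Inr a') y = (if c' = a' then (- \<kappa>) / (1 + (- \<kappa>) * fst y) else 0)" (is ?A2)
    "shp K (Inl c) (Inr a') y = 0" (is ?A3) "shp K (Inr c') (Inl a) y = 0" (is ?A4)
proof -
  have nz: "1 + \<kappa> * fst y \<noteq> 0" "1 + (- \<kappa>) * fst y \<noteq> 0" and m: "metric_near g1 (lpart y)" "metric_near g2 (rpart y)"
    using assms by (auto simp: good_def)
  have d: "det (g1 (lpart y)) \<noteq> 0" "det (g2 (rpart y)) \<noteq> 0"
    using m by (auto simp: metric_near_def)
  have t: "transpose (g1 (lpart y)) = g1 (lpart y)" "transpose (g2 (rpart y)) = g2 (rpart y)"
    using m eventually_nhds_x_imp_x unfolding metric_near_def by blast+
  have sy: "g1 (lpart y) $ i $ j = g1 (lpart y) $ j $ i" for i j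
    using t(1) by (simp add: transpose_def vec_eq_iff)
  have sy': "g2 (rpart y) $ i $ j = g2 (rpart y) $ j $ i" for i j
    using t(2) by (simp add: transpose_def vec_eq_iff)
  have s1: "1 / 2 * (\<Sum>x\<in>UNIV. I $ c $ x / u\<^sup>2 * (2 * k * u * M $ a $ x)) = (if c = a then k / u else 0)"
    if "u \<noteq> 0" "det M \<noteq> 0" "I = matrix_inv M" "\<And>i j. M $ i $ j = M $ j $ i" for u k :: real and M I :: "real^'q^'q" and a c
  proof -
    have "1 / 2 * (\<Sum>x\<in>UNIV. I $ c $ x / u\<^sup>2 * (2 * k * u * M $ a $ x)) = k / u * (\<Sum>x\<in>UNIV. I $ c $ x * M $ x $ a)"
      unfolding sum_distrib_left using that(1) 
      by (intro sum.cong refl) (simp add: that(4)[of a] power2_eq_square field_simps)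
    then show ?thesis using matrix_inv_entries(2)[OF that(2)] that(3) by simp
  qed
  show ?A1 ?A2 ?A3 ?A4
    unfolding shp_def sum_sum_type gdot_prodfam[OF assms] prodfam_inverse[OF assms]
    using s1[OF nz(1) d(1) refl sy, of c \<kappa> a] s1[OF nz(2) d(2) refl sy', of c' "- \<kappa>" a'] by simp_all
qed

lemma ricY_prodfam:
  assumes y: "good y"
  shows "ricY K (Inl a) (Inl b) y = ricci g1 (lpart y) $ a $ b" (is ?A1)
    "ricY K (Inr a') (Inr b') y = ricci g2 (rpart y) $ a' $ b'" (is ?A2)
    "ricY K (Inl a) (Inr b') y = 0" (is ?A3) "ricY K (Inr a') (Inl b) y = 0" (is ?A4)
proof -
  note ev = good_eventually[OF y]
  have s: "smooth_near (christoffel g1 c a b) (lpart y)" for c a b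
    using y unfolding good_def by (intro smooth_near_christoffel) simp
  have s': "smooth_near (christoffel g2 c a b) (rpart y)" for c a b
    using y unfolding good_def by (intro smooth_near_christoffel) simp
  have d: "dd v (gam K (Inl c) (Inl a) (Inl b)) y = dd (left_part (snd v)) (christoffel g1 c a b) (lpart y)" for v c a b
    using dd_cong[of "gam K (Inl c) (Inl a) (Inl b)" "\<lambda>y. christoffel g1 c a b (lpart y)" y v]
      eventually_mono[OF ev gam_prodfam(1)] dd_part[OF bounded_linear_parts(1) s] by simp
  have d': "dd v (gam K (Inr c) (Inr a) (Inr b)) y = dd (right_part (snd v)) (christoffel g2 c a b) (rpart y)" for v c a b
    using dd_cong[of "gam K (Inr c) (Inr a) (Inr b)" "\<lambda>y. christoffel g2 c a b (rpart y)" y v]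
      eventually_mono[OF ev gam_prodfam(2)] dd_part[OF bounded_linear_parts(2) s'] by simp
  have z: "dd v (gam K k i j) y = 0" if "\<And>y. good y \<Longrightarrow> gam K k i j y = 0" for v k i j
    using dd_cong[of "gam K k i j" "\<lambda>y. 0" y v] eventually_mono[OF ev that] by simp
  have zz: "dd v (gam K (Inl c) (Inl a) (Inr b')) y = 0" "dd v (gam K (Inl c) (Inr a') (Inl b)) y = 0"
    "dd v (gam K (Inl c) (Inr a') (Inr b')) y = 0" "dd v (gam K (Inr c') (Inl a) (Inl b)) y = 0"
    "dd v (gam K (Inr c') (Inl a) (Inr b')) y = 0" "dd v (gam K (Inr c') (Inr a') (Inl b)) y = 0" for v c c' a a' b b'
    by (rule z, rule gam_prodfam, assumption)+
  show ?A1 ?A2 ?A3 ?A4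
    unfolding ricY_def ricci_def sum_sum_type gam_prodfam[OF y] d d' zz partial_dd
    using linear_0[OF linear_dd[OF s]] linear_0[OF linear_dd[OF s']] by simp_all
qed

lemma dd_gdot_prodfam:
  assumes y: "good y"
  shows "dd (1, 0) (gdot K (Inl a) (Inl b)) y = 2 * \<kappa>\<^sup>2 * g1 (lpart y) $ a $ b" (is ?A1)
    "dd (1, 0) (gdot K (Inr a') (Inr b')) y = 2 * \<kappa>\<^sup>2 * g2 (rpart y) $ a' $ b'" (is ?A2)
    "dd (1, 0) (gdot K (Inl a) (Inr b')) y = 0" (is ?A3) "dd (1, 0) (gdot K (Inr a') (Inl b)) y = 0" (is ?A4)
proof -
  note ev = good_eventually[OF y]
  have l: "smooth_near (\<lambda>y :: ('m1 + 'm2) cyl. 2 * c * (1 + c * fst y)) y" for c y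
    by (intro smooth_intros smooth_near_fst0)
  have dl: "dd (1, 0) (\<lambda>y :: ('m1 + 'm2) cyl. 2 * c * (1 + c * fst y)) y = 2 * c\<^sup>2" for c y
    by (simp add: dd_add dd_mult smooth_near_mult smooth_near_add smooth_near_fst0 dd_fst power2_eq_square)
  have 1: "dd (1, 0) (\<lambda>y. 2 * \<kappa> * (1 + \<kappa> * fst y) * g1 (lpart y) $ a $ b) y = 2 * \<kappa>\<^sup>2 * g1 (lpart y) $ a $ b" for a b
    using dd_mult[OF l smooth_near_part[where F = "\<lambda>x. g1 x $ a $ b", OF bounded_linear_parts(1) good_smooth(1)[OF y]], of "(1, 0)" \<kappa>]
      linear_0[OF linear_dd[OF good_smooth(1)[OF y]]] dl
    by (simp add: dd_part[where F = "\<lambda>x. g1 x $ a $ b", OF bounded_linear_parts(1) good_smooth(1)[OF y]])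
  have 2: "dd (1, 0) (\<lambda>y. 2 * (- \<kappa>) * (1 + (- \<kappa>) * fst y) * g2 (rpart y) $ a $ b) y = 2 * (- \<kappa>)\<^sup>2 * g2 (rpart y) $ a $ b" for a b
    using dd_mult[OF l smooth_near_part[where F = "\<lambda>x. g2 x $ a $ b", OF bounded_linear_parts(2) good_smooth(2)[OF y]], of "(1, 0)" "- \<kappa>"]
      linear_0[OF linear_dd[OF good_smooth(2)[OF y]]] dl[of "- \<kappa>"]
    by (simp only: dd_part[where F = "\<lambda>x. g2 x $ a $ b", OF bounded_linear_parts(2) good_smooth(2)[OF y]]) simp
  have e1: "dd (1, 0) (gdot K (Inl a) (Inl b)) y = dd (1, 0) (\<lambda>y. 2 * \<kappa> * (1 + \<kappa> * fst y) * g1 (lpart y) $ a $ b) y"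
    by (rule dd_cong[OF eventually_mono[OF ev gdot_prodfam(1)]])
  have e2: "dd (1, 0) (gdot K (Inr a') (Inr b')) y = dd (1, 0) (\<lambda>y. 2 * (- \<kappa>) * (1 + (- \<kappa>) * fst y) * g2 (rpart y) $ a' $ b') y"
    by (rule dd_cong[OF eventually_mono[OF ev gdot_prodfam(2)]])
  have e3: "dd (1, 0) (gdot K (Inl a) (Inr b')) y = dd (1, 0) (\<lambda>y. 0) y"
    by (rule dd_cong[OF eventually_mono[OF ev gdot_prodfam(3)]])
  have e4: "dd (1, 0) (gdot K (Inr a') (Inl b)) y = dd (1, 0) (\<lambda>y. 0) y"
    by (rule dd_cong[OF eventually_mono[OF ev gdot_prodfam(4)]])
  show ?A1 ?A2 ?A3 ?A4
    unfolding e1 e2 e3 e4 1 2 by simp_all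
qed

lemma fg_op_prodfam:
  assumes y: "good y"
    and r1: "ricci g1 (lpart y) = (2 * (real CARD('m1) - 1) * \<kappa>) *\<^sub>R g1 (lpart y)"
    and r2: "ricci g2 (rpart y) = (- 2 * (real CARD('m2) - 1) * \<kappa>) *\<^sub>R g2 (rpart y)"
  shows "fg_op K k l y = 0"
proof -
  have nz: "1 + \<kappa> * fst y \<noteq> 0" "1 + (- \<kappa>) * fst y \<noteq> 0"
    using y by (auto simp: good_def)
  define u v where "u = 1 + \<kappa> * fst y" and "v = 1 + (- \<kappa>) * fst y"
  have uv: "u \<noteq> 0" "v \<noteq> 0" "\<kappa> * fst y = u - 1" "v = 2 - u" using nz by (auto simp: u_def v_def)
  \<comment> \<open>The scalar identity behind both blocks: \<open>r\<close> is \<rho>,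
    \<open>k\<close> the signed \<kappa>, \<open>s\<close> and \<open>t\<close> the warping factors
    of this and of the other block, \<open>p\<close> and \<open>q\<close> their dimensions. The last
    summand is the Einstein term.\<close>
  have main: "r * (2 * k\<^sup>2 * g) - ((p + q) / 2 - 1) * (2 * k * s * g) - (p * (k / s) + q * ((- k) / t)) * (s\<^sup>2 * g)
      + r * (p * (k / s) + q * ((- k) / t)) * (2 * k * s * g) - r * (2 * k * s * g * (k / s) + 2 * k * s * g * (k / s))
      + 2 * (p - 1) * k * g = 0" if "s = 1 + k * r" "t = 1 + (- k) * r" "s \<noteq> 0" "t \<noteq> 0" for r k g s t p q :: real
  proof -
    \<comment> \<open>The two trace terms combine through \<open>s - 2 k r = t\<close>; this clears
      both denominators and leaves a polynomial identity.\<close>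
    have "W * (s\<^sup>2 * g) - r * W * (2 * k * s * g) = W * s * g * (s - 2 * (k * r))" for W
      by (simp add: power2_eq_square algebra_simps)
    then have "(p * (k / s) + q * ((- k) / t)) * (s\<^sup>2 * g) - r * (p * (k / s) + q * ((- k) / t)) * (2 * k * s * g)
      = (p * (k / s) + q * ((- k) / t)) * s * g * (s - 2 * (k * r))" .
    also have "s - 2 * (k * r) = t" using that by simp
    also have "(p * (k / s) + q * ((- k) / t)) * s * g * t = (p * t - q * s) * k * g"
      using that(3,4) by (simp add: field_simps)
    finally have "(p * (k / s) + q * ((- k) / t)) * (s\<^sup>2 * g) - r * (p * (k / s) + q * ((- k) / t)) * (2 * k * s * g) = (p * t - q * s) * k * g" .
    moreover have "r * (2 * k * s * g * (k / s) + 2 * k * s * g * (k / s)) = 4 * r * k\<^sup>2 * g"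
      using that(3) by (simp add: power2_eq_square field_simps)
    moreover have "r * (2 * k\<^sup>2 * g) - ((p + q) / 2 - 1) * (2 * k * s * g) - (p * t - q * s) * k * g - 4 * r * k\<^sup>2 * g + 2 * (p - 1) * k * g = 0"
      unfolding that(1,2) by (simp add: power2_eq_square algebra_simps add_divide_distrib)
    ultimately show ?thesis by argo
  qed
  note D = fg_op_def sum_sum_type gdot_prodfam[OF y] dd_gdot_prodfam[OF y] shp_prodfam[OF y] ricY_prodfam[OF y] prodfam_entries
  have n: "real CARD('m1 + 'm2) = real CARD('m1) + real CARD('m2)" by simp
  have ss: "(\<Sum>c\<in>UNIV. f c * (if c = a then x else 0) + h c * (if c = b then x else 0)) = f a * x + h b * x"
    for f h :: "'q::finite \<Rightarrow> real" and a b x by (simp add: sum.distrib if_distrib[of "\<lambda>x. _ * x"] cong: if_cong)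
  have t: "transpose (g1 (lpart y)) = g1 (lpart y)" "transpose (g2 (rpart y)) = g2 (rpart y)"
    using y eventually_nhds_x_imp_x unfolding good_def metric_near_def by blast+
  have sy: "g1 (lpart y) $ i $ j = g1 (lpart y) $ j $ i" for i j
    using t(1) by (simp add: transpose_def vec_eq_iff)
  have sy': "g2 (rpart y) $ i $ j = g2 (rpart y) $ j $ i" for i j
    using t(2) by (simp add: transpose_def vec_eq_iff)
  have d1: "fg_op K (Inl a) (Inl b) y = 0" for a b
    unfolding D n r1 ss
    using main[OF refl refl nz, of "g1 (lpart y) $ a $ b" "real CARD('m1)" "real CARD('m2)"] nz sy[of a b]
    by simp
  \<comment> \<open>The same identity with \<kappa> replaced by \<open>- \<kappa>\<close> and the
    two dimensions exchanged.\<close>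
  have d2: "fg_op K (Inr a) (Inr b) y = 0" for a b
    unfolding D n r2 ss
    using main[OF refl _ nz(2), of "1 + \<kappa> * fst y" "g2 (rpart y) $ a $ b" "real CARD('m2)" "real CARD('m1)"] nz sy'[of a b]
    by (simp add: algebra_simps)
  have d3: "fg_op K (Inl a) (Inr b) y = 0" "fg_op K (Inr b) (Inl a) y = 0" for a b
    unfolding D by simp_all
  show ?thesis by (cases k; cases l) (simp_all add: d1 d2 d3)
qed

text \<open>Beyond the tangential part, the mixed components vanish since \<open>gam\<close> is
  independent of \<rho> and \<open>shp\<close> is constant along each slice and scalar on each
  block; the \<open>d\<rho>^2\<close> component vanishes since the warping factors are affine in
  \<rho>.\<close>

lemma ricci_prodfam:
  assumes y: "good y"
    and r1: "ricci g1 (lpart y) = (2 * (real CARD('m1) - 1) * \<kappa>) *\<^sub>R g1 (lpart y)"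
    and r2: "ricci g2 (rpart y) = (- 2 * (real CARD('m2) - 1) * \<kappa>) *\<^sub>R g2 (rpart y)"
    and z: "amb_proj z = y" "z $ IxT \<noteq> 0"
  shows "ricci (ambm K) z = 0"
proof -
  note ev = good_eventually[OF y]
  have near: "metric_near K (amb_proj z)" using prodfam_near[OF y] z by simp
  have m: "metric_near g1 (lpart y)" "metric_near g2 (rpart y)"
    and nz: "1 + \<kappa> * fst y \<noteq> 0" "1 + (- \<kappa>) * fst y \<noteq> 0"
    using y by (auto simp: good_def)
  have sc: "smooth_near (christoffel g1 c a b) (lpart y)" "smooth_near (christoffel g2 c' a' b') (rpart y)" for c a b c' a' b'
    using m by (auto intro: smooth_near_christoffel)
  have dgam: "dd (1, 0) (gam K k i k) y = 0" for k i
  proof -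
    have 1: "dd (1, 0) (gam K (Inl c) (Inl a) (Inl b)) y = 0" for c a b
    proof -
      have "dd (1, 0) (gam K (Inl c) (Inl a) (Inl b)) y = dd (1, 0) (\<lambda>y. christoffel g1 c a b (lpart y)) y"
        by (rule dd_cong[OF eventually_mono[OF ev gam_prodfam(1)]])
      then show ?thesis
        using dd_part[OF bounded_linear_parts(1) sc(1)] linear_0[OF linear_dd[OF sc(1)]] by simp
    qed
    have 2: "dd (1, 0) (gam K (Inr c) (Inr a) (Inr b)) y = 0" for c a b
    proof -
      have "dd (1, 0) (gam K (Inr c) (Inr a) (Inr b)) y = dd (1, 0) (\<lambda>y. christoffel g2 c a b (rpart y)) y"
        by (rule dd_cong[OF eventually_mono[OF ev gam_prodfam(2)]])
      then show ?thesis
        using dd_part[OF bounded_linear_parts(2) sc(2)] linear_0[OF linear_dd[OF sc(2)]] by simp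
    qed
    have "dd (1, 0) (gam K (Inl c) (Inr a) (Inl b)) y = dd (1, 0) (\<lambda>y. 0) y" for a b c
      by (rule dd_cong[OF eventually_mono[OF ev gam_prodfam(4)]])
    moreover have "dd (1, 0) (gam K (Inr d) (Inl e) (Inr f)) y = dd (1, 0) (\<lambda>y. 0) y" for d e f
      by (rule dd_cong[OF eventually_mono[OF ev gam_prodfam(7)]])
    ultimately have 3: "dd (1, 0) (gam K (Inl c) (Inr a) (Inl b)) y = 0" "dd (1, 0) (gam K (Inr d) (Inl e) (Inr f)) y = 0" for a b c d e f
      by simp_all
    show ?thesis by (cases k; cases i) (simp_all add: 1 2 3)
  qed
  have l: "smooth_near (\<lambda>y :: ('m1 + 'm2) cyl. 1 + c * fst y) y" for c y
    by (intro smooth_intros smooth_near_fst0)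
  \<comment> \<open>\<open>c / (1 + c \<rho>)\<close> solves the Riccati equation
    \<open>y' = - y^2\<close>, which is what makes the \<open>d\<rho>^2\<close> component
    vanish.\<close>
  have dl: "dd v (\<lambda>y :: ('m1 + 'm2) cyl. c / (1 + c * fst y)) y = - (c\<^sup>2 * fst v) / (1 + c * fst y)\<^sup>2"
    if "1 + c * fst y \<noteq> 0" for c v y
    using that
    by (intro dd_eqI[where f' = "\<lambda>v. - (c\<^sup>2 * fst v) / (1 + c * fst y)\<^sup>2"])
      (auto intro!: derivative_eq_intros simp: power2_eq_square divide_inverse)
  have e1: "dd v (shp K (Inl c) (Inl a)) y = dd v (\<lambda>y. if c = a then \<kappa> / (1 + \<kappa> * fst y) else 0) y" for v c a
    by (rule dd_cong[OF eventually_mono[OF ev shp_prodfam(1)]])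
  have e2: "dd v (shp K (Inr c) (Inr a)) y = dd v (\<lambda>y. if c = a then (- \<kappa>) / (1 + (- \<kappa>) * fst y) else 0) y" for v c a
    by (rule dd_cong[OF eventually_mono[OF ev shp_prodfam(2)]])
  have e3: "dd v (shp K (Inl c) (Inr a)) y = dd v (\<lambda>y. 0) y" for v c a
    by (rule dd_cong[OF eventually_mono[OF ev shp_prodfam(3)]])
  have e4: "dd v (shp K (Inr c) (Inl a)) y = dd v (\<lambda>y. 0) y" for v c a
    by (rule dd_cong[OF eventually_mono[OF ev shp_prodfam(4)]])
  have dshp: "dd v (shp K (Inl c) (Inl a)) y = (if c = a then - (\<kappa>\<^sup>2 * fst v) / (1 + \<kappa> * fst y)\<^sup>2 else 0)"
    "dd v (shp K (Inr c') (Inr a')) y = (if c' = a' then - ((- \<kappa>)\<^sup>2 * fst v) / (1 + (- \<kappa>) * fst y)\<^sup>2 else 0)"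
    "dd v (shp K (Inl c) (Inr a')) y = 0" "dd v (shp K (Inr c') (Inl a)) y = 0" for v c a c' a'
    unfolding e1 e2 e3 e4 using dl[OF nz(1), of v] dl[OF nz(2), of v] by (cases "c = a"; cases "c' = a'"; simp)+
  note O = ricci_ambient_other[OF z(2) near, unfolded z(1)]
  note S = sum_sum_type shp_prodfam[OF y] dshp dgam gam_prodfam[OF y]
  have c: "ricci (ambm K) z $ IxM a $ IxM b = 0" for a b
    using ricci_ambient_tangential[OF z(2) near] fg_op_prodfam[OF y r1 r2] z(1) by simp
  have cs: "christoffel g1 c i j (lpart y) = christoffel g1 c j i (lpart y)"
    "christoffel g2 c' i' j' (rpart y) = christoffel g2 c' j' i' (rpart y)" for c i j c' i' j'
    using christoffel_chr[OF m(1)] chr_sym[OF m(1)] christoffel_chr[OF m(2)] chr_sym[OF m(2)] by metis+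
  note D = sum.distrib sum_subtractf if_distrib[of "\<lambda>x. x * _"] if_distrib[of "\<lambda>x. _ * x"] sum_negf
  have o1: "ricci (ambm K) z $ IxM a $ IxRho = 0" for a
  proof (cases a)
    case (Inl a1)
    then show ?thesis unfolding O Inl S by (simp add: D cs(1)[of _ _ a1] cong: if_cong)
  next
    case (Inr a1)
    then show ?thesis unfolding O Inr S by (simp add: D cs(2)[of _ _ a1] cong: if_cong)
  qed
  have o2: "ricci (ambm K) z $ IxRho $ IxM a = 0" for a
  proof (cases a)
    case (Inl a1)
    then show ?thesis unfolding O Inl S by (simp add: D cs(1)[of _ _ a1] cong: if_cong)
  next
    case (Inr a1)
    then show ?thesis unfolding O Inr S by (simp add: D cs(2)[of _ _ a1] cong: if_cong)
  qed
  have o3: "ricci (ambm K) z $ IxRho $ IxRho = 0"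
    unfolding O S by (simp add: D power2_eq_square cong: if_cong)
  have "ricci (ambm K) z $ k $ l = 0" for k l
    by (cases k; cases l) (simp_all add: O(1-5) c o1 o2 o3)
  then show ?thesis by (simp add: vec_eq_iff)
qed

end

section \<open>The obstruction tensor of the product\<close>

lemma smooth_near_ln:
  fixes f :: "'a::real_normed_vector \<Rightarrow> real"
  assumes "f x > 0" "smooth_near f x" shows "smooth_near (\<lambda>x. ln (f x)) x"
proof (rule smooth_near_compose[OF _ assms(2)])
  have "Ck_on k {0<..} (ln :: real \<Rightarrow> real)" for k
  proof (cases k)
    case 0
    then show ?thesis by (auto intro!: continuous_intros)
  next
    case (Suc k')
    have "Ck_on (Suc k') {0<..} (ln :: real \<Rightarrow> real)"
    proof (rule Ck_on_SucI[OF open_greaterThan])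
      show "(ln has_derivative (\<lambda>v. v * inverse x)) (at x)" if "x \<in> {0<..}" for x :: real
        using that by (auto intro!: derivative_eq_intros simp: divide_inverse)
      show "Ck_on k' {0<..} (\<lambda>x::real. v * inverse x)" for v
        by (intro Ck_on_bilinear[OF open_greaterThan bounded_bilinear_mult] Ck_on_const Ck_on_inverse) auto
    qed
    with Suc show ?thesis by simp
  qed
  then show "smooth_near ln (f x)"
    using assms(1) unfolding smooth_near_def smooth_on_def by (intro exI[of _ "{0<..}"]) auto
qed

lemma metric_near_chart:
  assumes "open X" "smooth_on X g" "\<And>x. x \<in> X \<Longrightarrow> transpose (g x) = g x \<and> invertible (g x)" "x \<in> X"
  shows "metric_near g x"
  unfolding metric_near_def
  using smooth_on_imp_near[OF assms(1,2,4)] assms(3,4) eventually_nhds_open[OF assms(1,4), of "\<lambda>x. transpose (g x) = g x"]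
  by (simp add: invertible_det_nz)

lemma trace_free_part_multiple:
  fixes G :: "real^'k^'k"
  assumes "transpose G = G" "invertible G"
  shows "trace_free_part G (c *\<^sub>R G) = 0"
proof -
  have s: "G $ i $ j = G $ j $ i" for i j
    using assms(1) by (simp add: transpose_def vec_eq_iff)
  have "metric_trace G (c *\<^sub>R G) = c * (\<Sum>i\<in>UNIV. \<Sum>j\<in>UNIV. matrix_inv G $ i $ j * G $ i $ j)"
    by (simp add: metric_trace_def sum_distrib_left mult_ac)
  also have "(\<Sum>i\<in>UNIV. \<Sum>j\<in>UNIV. matrix_inv G $ i $ j * G $ i $ j) = (\<Sum>i\<in>UNIV. \<Sum>j\<in>UNIV. matrix_inv G $ i $ j * G $ j $ i)"
    using s by (intro sum.cong refl) simp
  also have "\<dots> = real CARD('k)"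
    using matrix_inv_entries(2)[of G] assms(2) by (simp add: invertible_det_nz)
  finally show ?thesis by (simp add: trace_free_part_def)
qed

lemma chart_img_prod:
  fixes M1 :: "('a, 'i, 'm1::finite) manifold" and M2 :: "('b, 'j, 'm2::finite) manifold"
  shows "chart_img (prod_manifold M1 M2) (i, j)
    = {z. left_part z \<in> chart_img M1 i \<and> right_part z \<in> chart_img M2 j}"
proof (intro set_eqI iffI)
  fix z assume "z \<in> chart_img (prod_manifold M1 M2) (i, j)"
  then obtain p q where "p \<in> chart_dom M1 i" "q \<in> chart_dom M2 j"
    "z = (\<chi> k. case k of Inl a \<Rightarrow> coords M1 i p $ a | Inr b \<Rightarrow> coords M2 j q $ b)"
    by (auto simp: chart_img_def prod_manifold_def)
  then show "z \<in> {z. left_part z \<in> chart_img M1 i \<and> right_part z \<in> chart_img M2 j}"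
    by (simp add: left_part_def right_part_def chart_img_def)
next
  fix z assume "z \<in> {z. left_part z \<in> chart_img M1 i \<and> right_part z \<in> chart_img M2 j}"
  then obtain p q where pq: "p \<in> chart_dom M1 i" "q \<in> chart_dom M2 j" "left_part z = coords M1 i p" "right_part z = coords M2 j q"
    by (auto simp: chart_img_def)
  have "z $ k = (case k of Inl a \<Rightarrow> coords M1 i p $ a | Inr b \<Rightarrow> coords M2 j q $ b)" for k
    by (cases k) (simp_all add: left_part_def right_part_def flip: pq(3,4))
  then have "z = coords (prod_manifold M1 M2) (i, j) (p, q)"
    by (simp add: prod_manifold_def vec_eq_iff)
  then show "z \<in> chart_img (prod_manifold M1 M2) (i, j)"
    using pq by (auto simp: chart_img_def prod_manifold_def)
qed

lemma open_chart_img: "smooth_manifold M \<Longrightarrow> i \<in> charts M \<Longrightarrow> open (chart_img M i)"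
  by (simp add: smooth_manifold_def)

lemma product_metric_prodfam: "product_metric g1 g2 (i, j) z = prodfam \<kappa> (g1 i) (g2 j) (0, z)"
  by (simp add: product_metric_def prodfam_def left_part_def right_part_def vec_eq_iff split: sum.split)

text \<open>The whole comparison in one chart at \<open>t = 1\<close>, for an arbitrary family
  \<open>G\<close> starting at the conformal metric. A pure trace is enough, since \<open>B\<close>
  is built from the trace-free part of \<open>L\<close>.\<close>

lemma local_obstruction_pure_trace:
  fixes X :: "(real^'m::finite) set" and G K :: "'m cyl \<Rightarrow> real^'m^'m"
  assumes X: "open X" and n: "even CARD('m)" "CARD('m) \<ge> 4"
    and K: "\<forall>x\<in>X. metric_near K (0, x)" and w: "\<forall>x\<in>X. smooth_near w x"
    and RF: "\<forall>x\<in>X. \<forall>\<^sub>F y in nhds (0, x). \<forall>z. amb_proj z = y \<longrightarrow> z $ IxT \<noteq> 0 \<longrightarrow> ricci (ambm K) z = 0"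
    and G: "\<forall>x\<in>X. metric_near G (0, x)" and init: "\<forall>x\<in>X. G (0, x) = exp (2 * w x) *\<^sub>R K (0, x)"
    and O: "\<forall>x\<in>X. \<forall>a b. (\<lambda>\<rho>. tangential_ricci (\<lambda>\<rho> x. G (\<rho>, x)) 1 x \<rho> $ a $ b) \<in> O[at 0](\<lambda>\<rho>. \<rho> ^ (CARD('m) div 2 - 1))"
    and x: "x \<in> X"
    and L: "((\<lambda>\<rho>. inverse (\<rho> ^ (CARD('m) div 2 - 1)) *\<^sub>R tangential_ricci (\<lambda>\<rho> x. G (\<rho>, x)) 1 x \<rho>) \<longlongrightarrow> L) (at 0)"
  shows "\<exists>c. L = c *\<^sub>R G (0, x)"
proof -
  obtain H where H: "\<And>x. x \<in> X \<Longrightarrow> metric_near H (0, x)" "\<And>x. x \<in> X \<Longrightarrow> H (0, x) = exp (2 * w x) *\<^sub>R K (0, x)"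
    "\<And>x a b. x \<in> X \<Longrightarrow> flat (CARD('m) div 2) (fg_op H a b) (0, x)"
    using conformal_family_exists[OF X K w RF, of "CARD('m) div 2"] by blast
  have ev: "\<forall>\<^sub>F \<rho> in at 0. tangential_ricci (\<lambda>\<rho> x. G (\<rho>, x)) 1 x \<rho> $ a $ b = fg_op G a b (\<rho>, x)" if "x \<in> X" for x a b
  proof -
    have "((\<lambda>\<rho>. (\<rho>, x)) \<longlongrightarrow> (0, x)) (at 0)" by (intro tendsto_intros)
    with metric_near_eventually[OF G[rule_format, OF that]]
    have "\<forall>\<^sub>F \<rho> in at 0. metric_near G (\<rho>, x)" by (rule eventually_compose_filterlim)
    then show ?thesis
    proof eventually_elim
      case (elim \<rho>)
      have p: "amb_proj (ambient_point 1 x \<rho>) = (\<rho>, x)" "ambient_point 1 x \<rho> $ IxT = 1"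
        by (simp_all add: amb_proj_def ambient_point_def vec_eq_iff)
      show ?case
        using ricci_ambient_tangential[of "ambient_point 1 x \<rho>" G a b] elim by (simp add: p tangential_ricci_def)
    qed
  qed
  show ?thesis
  proof (rule obstruction_pure_trace[OF X G _ n _ _ _ x])
    show "\<forall>x\<in>X. metric_near H (0, x)" "\<forall>x\<in>X. G (0, x) = H (0, x)"
      "\<forall>x\<in>X. \<forall>a b. flat (CARD('m) div 2) (fg_op H a b) (0, x)"
      using H init by (simp_all del: flat.simps)
    show "\<forall>x\<in>X. \<forall>a b. (\<lambda>\<rho>. fg_op G a b (\<rho>, x)) \<in> O[at 0](\<lambda>\<rho>. \<rho> ^ (CARD('m) div 2 - 1))"
      using O landau_o.big.in_cong[OF ev] by blast
    show "((\<lambda>\<rho>. fg_op G a b (\<rho>, x) / \<rho> ^ (CARD('m) div 2 - 1)) \<longlongrightarrow> L $ a $ b) (at 0)" for a b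
    proof (rule Lim_transform_eventually)
      show "((\<lambda>\<rho>. (inverse (\<rho> ^ (CARD('m) div 2 - 1)) *\<^sub>R tangential_ricci (\<lambda>\<rho> x. G (\<rho>, x)) 1 x \<rho>) $ a $ b) \<longlongrightarrow> L $ a $ b) (at 0)"
        by (intro tendsto_vec_nth L)
      show "\<forall>\<^sub>F \<rho> in at 0. (inverse (\<rho> ^ (CARD('m) div 2 - 1)) *\<^sub>R tangential_ricci (\<lambda>\<rho> x. G (\<rho>, x)) 1 x \<rho>) $ a $ b
          = fg_op G a b (\<rho>, x) / \<rho> ^ (CARD('m) div 2 - 1)"
        using ev[OF x, of a b] by eventually_elim (simp add: divide_inverse mult.commute)
    qed
  qed
qed

theorem corollary3p3:
  fixes M1 :: "('a, 'i, 'm1::finite) manifold"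
    and M2 :: "('b, 'j, 'm2::finite) manifold"
    and g1 :: "('i, 'm1) tensor2"
    and g2 :: "('j, 'm2) tensor2"
    and g B :: "('i \<times> 'j, 'm1 + 'm2) tensor2"
    and s1 s2 c :: real
  assumes "smooth_manifold M1" and "smooth_manifold M2"
    and "pseudo_riemannian_metric M1 g1" and "pseudo_riemannian_metric M2 g2"
    and "einstein M1 g1 s1" and "einstein M2 g2 s2"
    and "real CARD('m2) * (real CARD('m2) - 1) * s1 = - (real CARD('m1) * (real CARD('m1) - 1) * s2)"
    and "real CARD('m2) * (real CARD('m2) - 1) * s1 \<noteq> 0"
    and "even CARD('m1 + 'm2)" and "CARD('m1 + 'm2) \<ge> 4"
    and "pseudo_riemannian_metric (prod_manifold M1 M2) g"
    and "conformally_related (prod_manifold M1 M2) g (product_metric g1 g2)"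
    and "c \<noteq> 0"
    and "is_obstruction_tensor (prod_manifold M1 M2) c g B"
  shows "\<forall>k \<in> charts (prod_manifold M1 M2). \<forall>x \<in> chart_img (prod_manifold M1 M2) k. B k x = 0"
proof (intro ballI)
  fix k x assume k: "k \<in> charts (prod_manifold M1 M2)" and x: "x \<in> chart_img (prod_manifold M1 M2) k"
  obtain i j where ij: "k = (i, j)" "i \<in> charts M1" "j \<in> charts M2"
    using k by (auto simp: prod_manifold_def)
  define X where "X = chart_img (prod_manifold M1 M2) k"
  define X1 where "X1 = chart_img M1 i"
  define X2 where "X2 = chart_img M2 j"
  have o1: "open X1" and o2: "open X2"
    using open_chart_img assms(1,2) ij by (auto simp: X1_def X2_def)
  have X_eq: "X = left_part -` X1 \<inter> right_part -` X2"
    unfolding X_def X1_def X2_def ij(1) chart_img_prod by auto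
  have X: "open X"
    unfolding X_eq using bounded_linear_parts
    by (intro open_Int open_vimage o1 o2) (auto intro: linear_continuous_on)
  define m1 m2 where "m1 = real CARD('m1)" and "m2 = real CARD('m2)"
  define \<kappa> where "\<kappa> = s1 / (2 * m1 * (m1 - 1))"
  have sc: "m2 * (m2 - 1) * s1 = - (m1 * (m1 - 1) * s2)" "m2 * (m2 - 1) * s1 \<noteq> 0"
    using assms(7,8) by (simp_all add: m1_def m2_def)
  \<comment> \<open>The curvature relation has nonzero sides, so every factor is nonzero; this
    excludes one-dimensional factors and permits the divisions below.\<close>
  then have nz: "m1 \<noteq> 0" "m1 - 1 \<noteq> 0" "m2 \<noteq> 0" "m2 - 1 \<noteq> 0" by auto
  have k1: "s1 / m1 = 2 * (m1 - 1) * \<kappa>" using nz by (simp add: \<kappa>_def field_simps)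
  have k2: "s2 / m2 = - 2 * (m2 - 1) * \<kappa>"
  proof -
    have "s1 / (m1 * (m1 - 1)) = - (s2 / (m2 * (m2 - 1)))"
      using sc(1) nz by (simp add: divide_simps) (simp add: algebra_simps)
    then have "2 * \<kappa> = - (s2 / (m2 * (m2 - 1)))" by (simp add: \<kappa>_def mult.assoc)
    then show ?thesis using nz by (simp add: field_simps)
  qed
  have mn1: "metric_near (g1 i) y" if "y \<in> X1" for y
    using assms(3) ij that by (intro metric_near_chart[OF o1]) (auto simp: pseudo_riemannian_metric_def X1_def)
  have mn2: "metric_near (g2 j) y" if "y \<in> X2" for y
    using assms(4) ij that by (intro metric_near_chart[OF o2]) (auto simp: pseudo_riemannian_metric_def X2_def)
  have r1: "ricci (g1 i) y = (2 * (real CARD('m1) - 1) * \<kappa>) *\<^sub>R g1 i y" if "y \<in> X1" for y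
    using assms(5) ij that k1 by (simp add: einstein_def X1_def m1_def)
  have r2: "ricci (g2 j) y = (- 2 * (real CARD('m2) - 1) * \<kappa>) *\<^sub>R g2 j y" if "y \<in> X2" for y
    using assms(6) ij that k2 by (simp add: einstein_def X2_def m2_def)
  define K where "K = prodfam \<kappa> (g1 i) (g2 j)"
  \<comment> \<open>At \<rho> = 0 both warping factors equal 1.\<close>
  have good: "good \<kappa> (g1 i) (g2 j) (0, y)" if "y \<in> X" for y
    using that mn1 mn2 by (simp add: good_def X_eq)
  have RF: "\<forall>\<^sub>F y in nhds (0, x). \<forall>z. amb_proj z = y \<longrightarrow> z $ IxT \<noteq> 0 \<longrightarrow> ricci (ambm K) z = 0" if "x \<in> X" for x
  proof -
    have "\<forall>\<^sub>F y in nhds (0::real, x). snd y \<in> X"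
      by (rule eventually_snd_mem[OF X that])
    with good_eventually[OF good[OF that]] show ?thesis
    proof eventually_elim
      case (elim y)
      show ?case
        unfolding K_def using elim(2)
        by (intro allI impI ricci_prodfam[OF elim(1)] r1 r2) (auto simp: X_eq)
    qed
  qed
  obtain \<Omega> where \<Omega>: "\<And>p. p \<in> topspace (mtop (prod_manifold M1 M2)) \<Longrightarrow> \<Omega> p > 0"
    "smooth_on X (\<Omega> \<circ> chart_inv (prod_manifold M1 M2) k)"
    "\<And>p. p \<in> chart_dom (prod_manifold M1 M2) k \<Longrightarrow> g k (coords (prod_manifold M1 M2) k p)
       = (\<Omega> p)\<^sup>2 *\<^sub>R product_metric g1 g2 k (coords (prod_manifold M1 M2) k p)"
    using assms(12) k unfolding conformally_related_def X_def by blast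
  define \<omega> where "\<omega> = \<Omega> \<circ> chart_inv (prod_manifold M1 M2) k"
  have \<omega>: "\<omega> y > 0" "g k y = (\<omega> y)\<^sup>2 *\<^sub>R K (0, y)" if "y \<in> X" for y
  proof -
    define p where "p = chart_inv (prod_manifold M1 M2) k y"
    have p: "p \<in> chart_dom (prod_manifold M1 M2) k" "coords (prod_manifold M1 M2) k p = y"
      using that unfolding p_def X_def chart_img_def chart_inv_def by (auto intro: inv_into_into f_inv_into_f)
    have "chart_dom M1 i \<subseteq> topspace (mtop M1)" "chart_dom M2 j \<subseteq> topspace (mtop M2)"
      using assms(1,2) ij by (auto simp: smooth_manifold_def)
    then have "p \<in> topspace (mtop (prod_manifold M1 M2))"
      using p(1) by (auto simp: prod_manifold_def ij(1))
    from \<Omega>(1)[OF this] show "\<omega> y > 0" by (simp add: \<omega>_def p_def)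
    show "g k y = (\<omega> y)\<^sup>2 *\<^sub>R K (0, y)"
      using \<Omega>(3)[OF p(1), unfolded p(2)] unfolding ij(1) product_metric_prodfam[of g1 g2 i j _ \<kappa>]
      by (simp add: K_def \<omega>_def p_def flip: ij(1))
  qed
  obtain \<epsilon> gt where af: "admissible_family (prod_manifold M1 M2) g \<epsilon> gt"
    and BL: "\<exists>L. (\<forall>t>0. ((\<lambda>\<rho>. inverse (\<rho> ^ (CARD('m1 + 'm2) div 2 - 1)) *\<^sub>R
                       tangential_ricci (\<lambda>\<rho>'. gt \<rho>' k) t x \<rho>) \<longlongrightarrow> L) (at 0)) \<and>
           B k x = c *\<^sub>R trace_free_part (g k x) L"
    using assms(14) k x unfolding is_obstruction_tensor_def by blast
  \<comment> \<open>The limit is common to all \<open>t > 0\<close>; the local statement is applied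
    at \<open>t = 1\<close>.\<close>
  obtain L where L: "((\<lambda>\<rho>. inverse (\<rho> ^ (CARD('m1 + 'm2) div 2 - 1)) *\<^sub>R
                       tangential_ricci (\<lambda>\<rho>'. gt \<rho>' k) 1 x \<rho>) \<longlongrightarrow> L) (at 0)"
    and B: "B k x = c *\<^sub>R trace_free_part (g k x) L"
    using BL zero_less_one by blast
  define G where "G = (\<lambda>(\<rho>, y). gt \<rho> k y)"
  have \<epsilon>: "\<epsilon> > 0" using af by (simp add: admissible_family_def)
  have gt0: "gt 0 k y = g k y" if "y \<in> X" for y
    using af k that by (simp add: admissible_family_def X_def)
  have gtm: "transpose (gt \<rho> k y) = gt \<rho> k y" "invertible (gt \<rho> k y)" if "\<bar>\<rho>\<bar> < \<epsilon>" "y \<in> X" for \<rho> y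
    using af k that by (auto simp: admissible_family_def pseudo_riemannian_metric_def X_def abs_less_iff)
  have G: "metric_near G (0, y)" if y: "y \<in> X" for y
    unfolding metric_near_def
  proof (intro conjI)
    have o: "open ({- \<epsilon><..<\<epsilon>} \<times> X)" using X by (intro open_Times) auto
    show "smooth_near G (0, y)"
      by (rule smooth_on_imp_near[OF o]) (use af k y \<epsilon> in \<open>auto simp: admissible_family_def X_def G_def\<close>)
    show "det (G (0, y)) \<noteq> 0" using gtm(2)[of 0 y] \<epsilon> y by (simp add: G_def invertible_det_nz)
    show "\<forall>\<^sub>F y in nhds (0, y). transpose (G y) = G y"
      by (rule eventually_nhds_open[OF o]) (use y \<epsilon> gtm(1) in \<open>auto simp: G_def\<close>)
  qed
  have "\<exists>c. L = c *\<^sub>R G (0, x)"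
  \<comment> \<open>The conformal factor enters squared, so \<open>w = ln \<omega>\<close> gives
    \<open>exp (2 w) = \<omega>^2\<close>.\<close>
  proof (rule local_obstruction_pure_trace[OF X assms(9,10), where K = K and w = "\<lambda>y. ln (\<omega> y)"])
    show "\<forall>x\<in>X. metric_near K (0, x)" using prodfam_near[OF good] by (simp add: K_def)
    show "\<forall>x\<in>X. smooth_near (\<lambda>y. ln (\<omega> y)) x"
      using smooth_on_imp_near[OF X \<Omega>(2)[folded \<omega>_def]] \<omega>(1) by (intro ballI smooth_near_ln) auto
    show "\<forall>x\<in>X. \<forall>\<^sub>F y in nhds (0, x). \<forall>z. amb_proj z = y \<longrightarrow> z $ IxT \<noteq> 0 \<longrightarrow> ricci (ambm K) z = 0"
      using RF by blast
    show "\<forall>x\<in>X. metric_near G (0, x)" using G by blast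
    show "\<forall>x\<in>X. G (0, x) = exp (2 * ln (\<omega> x)) *\<^sub>R K (0, x)"
    proof
      fix y assume y: "y \<in> X"
      have "exp (2 * ln (\<omega> y)) = (\<omega> y)\<^sup>2"
        using \<omega>(1)[OF y] by (simp add: exp_double)
      then show "G (0, y) = exp (2 * ln (\<omega> y)) *\<^sub>R K (0, y)"
        using \<omega>(2)[OF y] gt0[OF y] by (simp add: G_def)
    qed
    show "\<forall>x\<in>X. \<forall>a b. (\<lambda>\<rho>. tangential_ricci (\<lambda>\<rho> x. G (\<rho>, x)) 1 x \<rho> $ a $ b)
        \<in> O[at 0](\<lambda>\<rho>. \<rho> ^ (CARD('m1 + 'm2) div 2 - 1))"
      using af k zero_less_one unfolding admissible_family_def X_def G_def case_prod_conv by blast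
    show "x \<in> X" using x by (simp add: X_def)
    show "((\<lambda>\<rho>. inverse (\<rho> ^ (CARD('m1 + 'm2) div 2 - 1)) *\<^sub>R tangential_ricci (\<lambda>\<rho> x. G (\<rho>, x)) 1 x \<rho>) \<longlongrightarrow> L) (at 0)"
      using L by (simp add: G_def)
  qed
  then obtain d where "L = d *\<^sub>R g k x"
    using gt0[of x] x by (auto simp: G_def X_def)
  moreover have "transpose (g k x) = g k x" "invertible (g k x)"
    using assms(11) k x by (auto simp: pseudo_riemannian_metric_def)
  ultimately show "B k x = 0"
    using B trace_free_part_multiple[of "g k x" d] by simp
qed

end
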